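(* Let $h^*$ be an additive multiplicative generalized cohomology theory. Let $f:F\to E$, $g:G\to E$ and $h:H\to E$ be three maps, and suppose that $g$ is the pull-back of an embedding, given by a pull-back square $p\circ g=\phi\circ q$ with $q:G\to M$, $p:E\to B$ and $\phi:M\hookrightarrow B$ as in the context, $\phi$ of codimension $m$. Let $e_\nu\in h^m(M)$ be the Euler class of the normal bundle $\nu$ of $\phi$. Let $ev_0:{}^gE^h\to G$, $(a,w,b)\mapsto a$, and $ev_1:{}^fE^g\to G$, $(a,w,b)\mapsto b$, be the projections. Let $\sigma:G\hookrightarrow {}^gE^g$, $b\mapsto (b,\text{constant path at }g(b),b)$, be the common section of $ev_0$ and $ev_1$ when $f=g=h$. Then: 1) The open string coproduct $lcp_{f,g,g}:h^*({}^fE^g)\otimes h^*({}^gE^g)\to h^{*+m}({}^fE^g)$ is given by $$lcp_{f,g,g}(a\otimes b)=a\cup ev_1^*\left(\sigma^*(b)\cup q^*(e_\nu)\right).$$ 2) The open string coproduct $lcp_{g,g,h}:h^*({}^gE^g)\otimes h^*({}^gE^h)\to h^{*+m}({}^gE^h)$ is given by $$lcp_{g,g,h}(b\otimes c)=ev_0^*\circ\sigma^*(b)\cup c\cup ev_0^*\circ q^*(e_\nu).$$ 3) In the case $f=g=h$, $ev_0^*\circ q^*(e_\nu)=ev_1^*\circ q^*(e_\nu)\in h^*({}^gE^g)$. 4) The ideal $\mathrm{Ker}\,(\sigma^*:h^*({}^gE^g)\to h^*(G))$ satisfies $\mathrm{Ker}\,\sigma^*\cup ev_0^*\circ q^*(e_\nu)=\{0\}$.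 5) The open string coproduct $lcp_{g,g,g}:h^*({}^gE^g)\otimes h^*({}^gE^g)\to h^{*+m}({}^gE^g)$ is given by $$lcp_{g,g,g}(a\otimes b)=ev_0^*\left(\sigma^*(a)\cup\sigma^*(b)\cup q^*(e_\nu)\right)=ev_1^*\left(\sigma^*(a)\cup\sigma^*(b)\cup q^*(e_\nu)\right).$$ 6) Let ${}^gE^g_0\subset {}^gE^g$ be the union of the path-connected components of the points $\sigma(\alpha)$, $\alpha\in G$. Then $lcp_{f,g,g}$ is trivial outside of $h^*({}^fE^g)\otimes h^*({}^gE^g_0)$; $lcp_{g,g,h}$ is trivial outside of $h^*({}^gE^g_0)\otimes h^*({}^gE^h)$; and $lcp_{g,g,g}$ is trivial outside of $h^*({}^gE^g_0)\otimes h^*({}^gE^g_0)$. 7) Writing $X_{[\alpha]}$ for the path-connected component of a point $\alpha$ in a space $X$: for every $\alpha\in{}^fE^g$, $lcp_{f,g,g}$ maps $h^*({}^fE^g_{[\alpha]})\otimes h^*({}^gE^g)$ to $h^{*+m}({}^fE^g_{[\alpha]})$; for every $\alpha\in{}^gE^h$, $lcp_{g,g,h}$ maps $h^*({}^gE^g)\otimes h^*({}^gE^h_{[\alpha]})$ to $h^{*+m}({}^gE^h_{[\alpha]})$; and the image of $lcp_{g,g,g}$ is contained in $h^*({}^gE^g_0)$. 8) Suppose that there is an integer $\dim G$ such that $h^i(G)=\{0\}$ for all $i>\dim G$. Then for all $a,b\in h^*({}^gE^g)$ with $|a|+|b|>\dim G-m$, $lcp_{g,g,g}(a\otimes b)=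0$.
   Context: Homotopy fibre product: for $f:F\to E$, $g:G\to E$, ${}^fE^g=\{(a,w,b)\in F\times E^I\times G: f(a)=w(0),\ g(b)=w(1)\}$. Pull-back of an embedding: $g:G\to E$ is equipped with a pull-back square $p\circ g=\phi\circ q$, where $\phi:M\hookrightarrow B$ is a proper smooth embedding of codimension $m$ between manifolds without boundary, with $h^*$-oriented normal bundle $\nu$, and $p:E\to B$ is a (Serre) fibration. Convention: fibrations are Hurewicz fibrations; Serre fibrations are allowed when $h^*$ sends weak equivalences to isomorphisms. Shriek map of the pull-back of an embedding: let $N\subset B$ be a closed tubular neighborhood of $M$, the image of the disk bundle $D(\nu)$ under a tubular neighborhood diffeomorphism, with boundary $\partial N$ (image of the sphere bundle $S(\nu)$), and let $u\in h^m(N,\partial N)$ be the Thom class. For a fibration $P:X\to B$ let $\tilde M=P^{-1}(M)$, $\tilde N=P^{-1}(N)$, $\widetilde{\partial N}=P^{-1}(\partial N)$, $\tilde u=P^*(u)\in h^m(\tilde N,\widetilde{\partial N})$, and let $\tilde\phi:\tilde M\to X$, $\tilde s:\tilde M\to\tilde N$, $\tilde i:(\tilde N,\widetilde{\partial N})\to (X,X-\tilde M)$, $\tilde j:X\to(X,X-\tilde M)$ be the inclusions. Then $\tilde s^*$ and $\tilde i^*$ are isomorphisms and $\tilde\phi^!:h^*(\tilde M)\to h^{*+m}(X)$ is $\tilde\phi^!(x)=\tilde j^*(\tilde i^* )^{-1}\big((\tilde s^* )^{-1}(x)\cup\tilde u\big)$. The Euler class $e_\nu\in h^m(M)$ is the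 restriction of $u$ to $M$. Open string coproduct: let ${}^fE^g\times_E{}^gE^h$ be the subspace of ${}^fE^g\times{}^gE^h$ of pairs $((a,w,b),(b,w',c))$ with the same middle point $b\in G$, with inclusion $\tilde\Delta$ into ${}^fE^g\times{}^gE^h$. Let $\mu_{f,g,h}:{}^fE^g\times_E{}^gE^h\to{}^fE^h$ be $((a,w,b),(b,w',c))\mapsto(a,w*w',c)$, where $w*w'$ is concatenation of paths. With $ev_{1/2}:{}^fE^h\to E$, $(a,w,c)\mapsto w(1/2)$, the map $\mu_{f,g,h}$ is the pull-back of $\phi$ along the fibration $p\circ ev_{1/2}:{}^fE^h\to B$, so there is a shriek map $\mu_{f,g,h}^!:h^*({}^fE^g\times_E{}^gE^h)\to h^{*+m}({}^fE^h)$. Then $lcp_{f,g,h}:h^*({}^fE^g)\otimes h^*({}^gE^h)\to h^{*+m}({}^fE^h)$ is $lcp_{f,g,h}(a\otimes b)=\mu_{f,g,h}^!(\tilde\Delta^*(a\times b))$, where $\times$ is the cross product. In 6) and 7), the cohomology of a space is identified with the product of the cohomologies of its path-connected components, so that $h^*$ of a union of components is a factor. "Trivial outside of $h^*(X)\otimes h^*(Y_0)$" means that the coproduct of two classes vanishes whenever the class in the restricted variable has zero component in the indicated factor. *)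

theory Defs
  imports "HOL-Analysis.Analysis" "HOL-Homology.Homology"
begin

section \<open>Multiplicative cohomology theories\<close>

text \<open>
  HOL cannot quantify over all types inside a formula, so a cohomology theory is given on all pairs
  of spaces whose points belong to one fixed type \<open>'u\<close>.  Later \<open>'u\<close> is instantiated by a type of
  points that is closed under the constructions needed (cartesian products and path spaces) and
  that contains a copy of an arbitrary type.

  As in \<open>HOL-Homology\<close>, the groups are multiplicatively written HOL-Algebra groups; so
  \<open>\<one>\<close> is the zero class and \<open>\<otimes>\<close> is the sum of classes.  The fields are: the groups
  \<open>h\<^sup>n(X,A)\<close>; the homomorphism \<open>h\<^sup>n(Y,B) \<rightarrow> h\<^sup>n(X,A)\<close> induced by a map of pairs; the coboundary
  \<open>h\<^sup>n(A) \<rightarrow> h\<^sup>n\<^sup>+\<^sup>1(X,A)\<close>; the cup product \<open>h\<^sup>k(X,A) \<times> h\<^sup>l(X,B) \<rightarrow> h\<^sup>k\<^sup>+\<^sup>l(X,A \<union> B)\<close>, used only for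
  excisive couples; the unit of \<open>h\<^sup>0(X)\<close>.
\<close>

record ('u, 'k) cohomology =
  Grp :: "int \<Rightarrow> 'u topology \<Rightarrow> 'u set \<Rightarrow> 'k monoid"
  Ind :: "int \<Rightarrow> 'u topology \<Rightarrow> 'u set \<Rightarrow> 'u topology \<Rightarrow> 'u set \<Rightarrow> ('u \<Rightarrow> 'u) \<Rightarrow> 'k \<Rightarrow> 'k"
  Bd :: "int \<Rightarrow> 'u topology \<Rightarrow> 'u set \<Rightarrow> 'k \<Rightarrow> 'k"
  Cup :: "int \<Rightarrow> int \<Rightarrow> 'u topology \<Rightarrow> 'u set \<Rightarrow> 'u set \<Rightarrow> 'k \<Rightarrow> 'k \<Rightarrow> 'k"
  One :: "'u topology \<Rightarrow> 'k"

abbreviation coh :: "('u, 'k) cohomology \<Rightarrow> int \<Rightarrow> 'u topology \<Rightarrow> 'k monoid" where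
  "coh ct n X \<equiv> Grp ct n X {}"

abbreviation pull ::
    "('u, 'k) cohomology \<Rightarrow> int \<Rightarrow> 'u topology \<Rightarrow> 'u topology \<Rightarrow> ('u \<Rightarrow> 'u) \<Rightarrow> 'k \<Rightarrow> 'k" where
  "pull ct n X Y f \<equiv> Ind ct n X {} Y {} f"

abbreviation cup :: "('u, 'k) cohomology \<Rightarrow> int \<Rightarrow> int \<Rightarrow> 'u topology \<Rightarrow> 'k \<Rightarrow> 'k \<Rightarrow> 'k" where
  "cup ct k l X \<equiv> Cup ct k l X {} {}"

definition pair_map :: "'a topology \<Rightarrow> 'a set \<Rightarrow> 'b topology \<Rightarrow> 'b set \<Rightarrow> ('a \<Rightarrow> 'b) \<Rightarrow> bool" where
  "pair_map X A Y B f \<longleftrightarrow>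
     A \<subseteq> topspace X \<and> B \<subseteq> topspace Y \<and> continuous_map X Y f \<and> f ` A \<subseteq> B"

definition excisive :: "'a topology \<Rightarrow> 'a set \<Rightarrow> 'a set \<Rightarrow> bool" where
  "excisive X A B \<longleftrightarrow> A \<subseteq> topspace X \<and> B \<subseteq> topspace X \<and>
     (subtopology X (A \<union> B)) interior_of A \<union> (subtopology X (A \<union> B)) interior_of B = A \<union> B"

locale cohomology_theory =
  fixes ct :: "('u, 'k) cohomology"
  assumes group: "A \<subseteq> topspace X \<Longrightarrow> comm_group (Grp ct n X A)"
    and ind_hom: "pair_map X A Y B f \<Longrightarrow> Ind ct n X A Y B f \<in> hom (Grp ct n Y B) (Grp ct n X A)"
    and ind_id: "\<lbrakk>A \<subseteq> topspace X; a \<in> carrier (Grp ct n X A)\<rbrakk> \<Longrightarrow> Ind ct n X A X A id a = a"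
    and ind_comp: "\<lbrakk>pair_map X A Y B f; pair_map Y B Z C g; a \<in> carrier (Grp ct n Z C)\<rbrakk>
      \<Longrightarrow> Ind ct n X A Z C (g \<circ> f) a = Ind ct n X A Y B f (Ind ct n Y B Z C g a)"
    and homotopy: "\<lbrakk>pair_map X A Y B f; pair_map X A Y B g;
        homotopic_with (\<lambda>k. k ` A \<subseteq> B) X Y f g; a \<in> carrier (Grp ct n Y B)\<rbrakk>
      \<Longrightarrow> Ind ct n X A Y B f a = Ind ct n X A Y B g a"
    and bd_hom: "A \<subseteq> topspace X
      \<Longrightarrow> Bd ct n X A \<in> hom (coh ct n (subtopology X A)) (Grp ct (n + 1) X A)"
    and bd_natural: "\<lbrakk>pair_map X A Y B f; a \<in> carrier (coh ct n (subtopology Y B))\<rbrakk>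
      \<Longrightarrow> Ind ct (n + 1) X A Y B f (Bd ct n Y B a)
        = Bd ct n X A (pull ct n (subtopology X A) (subtopology Y B) f a)"
    and exact_space: "A \<subseteq> topspace X
      \<Longrightarrow> Ind ct n X {} X A id ` carrier (Grp ct n X A)
        = kernel (coh ct n X) (coh ct n (subtopology X A)) (pull ct n (subtopology X A) X id)"
    and exact_subspace: "A \<subseteq> topspace X
      \<Longrightarrow> pull ct n (subtopology X A) X id ` carrier (coh ct n X)
        = kernel (coh ct n (subtopology X A)) (Grp ct (n + 1) X A) (Bd ct n X A)"
    and exact_pair: "A \<subseteq> topspace X
      \<Longrightarrow> Bd ct n X A ` carrier (coh ct n (subtopology X A))
        = kernel (Grp ct (n + 1) X A) (coh ct (n + 1) X) (Ind ct (n + 1) X {} X A id)"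
    and excision: "\<lbrakk>A \<subseteq> topspace X; W \<subseteq> A; X closure_of W \<subseteq> X interior_of A\<rbrakk>
      \<Longrightarrow> bij_betw (Ind ct n (subtopology X (topspace X - W)) (A - W) X A id)
            (carrier (Grp ct n X A))
            (carrier (Grp ct n (subtopology X (topspace X - W)) (A - W)))"

locale additive_cohomology_theory = cohomology_theory ct
  for ct :: "('u, 'k) cohomology" +
  assumes additivity: "\<lbrakk>\<And>U. U \<in> \<U> \<Longrightarrow> openin X U; disjoint \<U>; \<Union>\<U> = topspace X\<rbrakk>
      \<Longrightarrow> bij_betw (\<lambda>a. \<lambda>U\<in>\<U>. pull ct n (subtopology X U) X id a)
            (carrier (coh ct n X)) (\<Pi>\<^sub>E U\<in>\<U>. carrier (coh ct n (subtopology X U)))"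

text \<open>
  Graded commutativity of the cup product is not required; a graded commutative theory is a
  special case.
\<close>

locale multiplicative_cohomology_theory = cohomology_theory ct
  for ct :: "('u, 'k) cohomology" +
  assumes cup_closed: "\<lbrakk>excisive X A B; a \<in> carrier (Grp ct k X A); b \<in> carrier (Grp ct l X B)\<rbrakk>
      \<Longrightarrow> Cup ct k l X A B a b \<in> carrier (Grp ct (k + l) X (A \<union> B))"
    and cup_add_left: "\<lbrakk>excisive X A B; a \<in> carrier (Grp ct k X A); a' \<in> carrier (Grp ct k X A);
        b \<in> carrier (Grp ct l X B)\<rbrakk>
      \<Longrightarrow> Cup ct k l X A B (a \<otimes>\<^bsub>Grp ct k X A\<^esub> a') b
        = Cup ct k l X A B a b \<otimes>\<^bsub>Grp ct (k + l) X (A \<union> B)\<^esub> Cup ct k l X A B a' b"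
    and cup_add_right: "\<lbrakk>excisive X A B; a \<in> carrier (Grp ct k X A); b \<in> carrier (Grp ct l X B);
        b' \<in> carrier (Grp ct l X B)\<rbrakk>
      \<Longrightarrow> Cup ct k l X A B a (b \<otimes>\<^bsub>Grp ct l X B\<^esub> b')
        = Cup ct k l X A B a b \<otimes>\<^bsub>Grp ct (k + l) X (A \<union> B)\<^esub> Cup ct k l X A B a b'"
    and cup_natural: "\<lbrakk>excisive X A B; excisive Y A' B'; pair_map X A Y A' f; pair_map X B Y B' f;
        a \<in> carrier (Grp ct k Y A'); b \<in> carrier (Grp ct l Y B')\<rbrakk>
      \<Longrightarrow> Ind ct (k + l) X (A \<union> B) Y (A' \<union> B') f (Cup ct k l Y A' B' a b)
        = Cup ct k l X A B (Ind ct k X A Y A' f a) (Ind ct l X B Y B' f b)"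
    and cup_assoc: "\<lbrakk>excisive X A B; excisive X (A \<union> B) C; excisive X B C; excisive X A (B \<union> C);
        a \<in> carrier (Grp ct k X A); b \<in> carrier (Grp ct l X B); c \<in> carrier (Grp ct r X C)\<rbrakk>
      \<Longrightarrow> Cup ct (k + l) r X (A \<union> B) C (Cup ct k l X A B a b) c
        = Cup ct k (l + r) X A (B \<union> C) a (Cup ct l r X B C b c)"
    and one_closed: "One ct X \<in> carrier (coh ct 0 X)"
    and one_natural: "continuous_map X Y f \<Longrightarrow> pull ct 0 X Y f (One ct Y) = One ct X"
    and one_cup: "\<lbrakk>A \<subseteq> topspace X; a \<in> carrier (Grp ct k X A)\<rbrakk>
      \<Longrightarrow> Cup ct 0 k X {} A (One ct X) a = a"
    and cup_one: "\<lbrakk>A \<subseteq> topspace X; a \<in> carrier (Grp ct k X A)\<rbrakk>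
      \<Longrightarrow> Cup ct k 0 X A {} a (One ct X) = a"
    and bd_cup: "\<lbrakk>A \<subseteq> topspace X; a \<in> carrier (coh ct k (subtopology X A));
        b \<in> carrier (coh ct l X)\<rbrakk>
      \<Longrightarrow> Bd ct (k + l) X A
            (cup ct k l (subtopology X A) a (pull ct l (subtopology X A) X id b))
        = Cup ct (k + 1) l X A {} (Bd ct k X A a) b"
    and cup_bd: "\<lbrakk>A \<subseteq> topspace X; b \<in> carrier (coh ct k X);
        a \<in> carrier (coh ct l (subtopology X A))\<rbrakk>
      \<Longrightarrow> Bd ct (k + l) X A
            (cup ct k l (subtopology X A) (pull ct k (subtopology X A) X id b) a)
        = (let c = Cup ct k (l + 1) X {} A b (Bd ct l X A a)
           in if even k then c else inv\<^bsub>Grp ct (k + l + 1) X A\<^esub> c)"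

locale additive_multiplicative_cohomology_theory =
  additive_cohomology_theory ct + multiplicative_cohomology_theory ct
  for ct :: "('u, 'k) cohomology"

definition graded_ideal ::
    "('u, 'k) cohomology \<Rightarrow> 'u topology \<Rightarrow> (int \<Rightarrow> 'k set) \<Rightarrow> bool" where
  "graded_ideal ct X I \<longleftrightarrow>
     (\<forall>k. subgroup (I k) (coh ct k X)) \<and>
     (\<forall>k l. \<forall>a\<in>I k. \<forall>b\<in>carrier (coh ct l X).
        cup ct k l X a b \<in> I (k + l) \<and> cup ct l k X b a \<in> I (l + k))"

section \<open>Fibrations and weak equivalences\<close>

definition has_HLP ::
    "'a topology \<Rightarrow> 'b topology \<Rightarrow> ('a \<Rightarrow> 'b) \<Rightarrow> 'c topology \<Rightarrow> bool" where
  "has_HLP E B p Z \<longleftrightarrow>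
     (\<forall>f H. continuous_map Z E f \<and> continuous_map (prod_topology (top_of_set {0..1::real}) Z) B H \<and>
            (\<forall>z\<in>topspace Z. H (0, z) = p (f z)) \<longrightarrow>
        (\<exists>K. continuous_map (prod_topology (top_of_set {0..1}) Z) E K \<and>
             (\<forall>z\<in>topspace Z. K (0, z) = f z) \<and>
             (\<forall>t\<in>{0..1}. \<forall>z\<in>topspace Z. p (K (t, z)) = H (t, z))))"

definition cube :: "nat \<Rightarrow> (nat \<Rightarrow> real) topology" where
  "cube n = subtopology (Euclidean_space n) {x. \<forall>i<n. x i \<in> {0..1}}"

definition cube_boundary :: "nat \<Rightarrow> (nat \<Rightarrow> real) set" where
  "cube_boundary n = {x \<in> topspace (cube n). \<exists>i<n. x i = 0 \<or> x i = 1}"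

text \<open>
  The test spaces of a Hurewicz fibration range over all spaces on the universe \<open>'u\<close>.  When \<open>'u\<close> is
  the type of points introduced below, this includes the universal test space
  \<open>{(e,w) \<in> E \<times> B\<^sup>I. p e = w 0}\<close>, so nothing is lost.
\<close>

definition Hurewicz_fibration :: "'u topology \<Rightarrow> 'u topology \<Rightarrow> ('u \<Rightarrow> 'u) \<Rightarrow> bool" where
  "Hurewicz_fibration E B p \<longleftrightarrow> continuous_map E B p \<and> (\<forall>Z :: 'u topology. has_HLP E B p Z)"

definition Serre_fibration :: "'a topology \<Rightarrow> 'b topology \<Rightarrow> ('a \<Rightarrow> 'b) \<Rightarrow> bool" where
  "Serre_fibration E B p \<longleftrightarrow> continuous_map E B p \<and> (\<forall>n. has_HLP E B p (cube n))"

text \<open>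
  Representatives of the elements of \<open>\<pi>\<^sub>n(X,x\<^sub>0)\<close>; for \<open>n = 0\<close> the boundary of the cube is empty and
  one obtains the points of \<open>X\<close>, up to paths.
\<close>

definition spheroids :: "nat \<Rightarrow> 'a topology \<Rightarrow> 'a \<Rightarrow> ((nat \<Rightarrow> real) \<Rightarrow> 'a) set" where
  "spheroids n X x0 = {s. continuous_map (cube n) X s \<and> (\<forall>z\<in>cube_boundary n. s z = x0)}"

definition spheroid_homotopic ::
    "nat \<Rightarrow> 'a topology \<Rightarrow> 'a \<Rightarrow> ((nat \<Rightarrow> real) \<Rightarrow> 'a) \<Rightarrow> ((nat \<Rightarrow> real) \<Rightarrow> 'a) \<Rightarrow> bool" where
  "spheroid_homotopic n X x0 =
     homotopic_with (\<lambda>s. \<forall>z\<in>cube_boundary n. s z = x0) (cube n) X"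

definition weak_equivalence :: "'a topology \<Rightarrow> 'b topology \<Rightarrow> ('a \<Rightarrow> 'b) \<Rightarrow> bool" where
  "weak_equivalence X Y f \<longleftrightarrow>
     continuous_map X Y f \<and> (topspace X = {} \<longrightarrow> topspace Y = {}) \<and>
     (\<forall>n. \<forall>x0\<in>topspace X.
        (\<forall>s\<in>spheroids n X x0. \<forall>s'\<in>spheroids n X x0.
           spheroid_homotopic n Y (f x0) (f \<circ> s) (f \<circ> s') \<longrightarrow> spheroid_homotopic n X x0 s s') \<and>
        (\<forall>r\<in>spheroids n Y (f x0). \<exists>s\<in>spheroids n X x0. spheroid_homotopic n Y (f x0) (f \<circ> s) r))"

definition weakly_invariant :: "('u, 'k) cohomology \<Rightarrow> bool" where
  "weakly_invariant ct \<longleftrightarrow>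
     (\<forall>n X Y f. weak_equivalence X Y f \<longrightarrow>
        bij_betw (pull ct n X Y f) (carrier (coh ct n Y)) (carrier (coh ct n X)))"

section \<open>Smooth manifolds and vector bundles\<close>

text \<open>
  The dimension of a manifold is a natural number, possibly \<open>0\<close>, so charts take values in
  \<^const>\<open>Euclidean_space\<close> rather than in a type of class \<open>euclidean_space\<close>.
\<close>

definition partial :: "nat \<Rightarrow> ((nat \<Rightarrow> real) \<Rightarrow> real) \<Rightarrow> (nat \<Rightarrow> real) \<Rightarrow> real" where
  "partial i f x = deriv (\<lambda>t. f (x(i := t))) (x i)"

primrec Ck_on :: "nat \<Rightarrow> nat \<Rightarrow> (nat \<Rightarrow> real) set \<Rightarrow> ((nat \<Rightarrow> real) \<Rightarrow> real) \<Rightarrow> bool" where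
  "Ck_on 0 n U f \<longleftrightarrow> continuous_map (subtopology (Euclidean_space n) U) euclideanreal f"
| "Ck_on (Suc r) n U f \<longleftrightarrow>
     continuous_map (subtopology (Euclidean_space n) U) euclideanreal f \<and>
     (\<forall>i<n. (\<forall>x\<in>U. (\<lambda>t. f (x(i := t))) differentiable (at (x i))) \<and> Ck_on r n U (partial i f))"

text \<open>Used only for open \<open>U\<close>:\<close>

definition smooth_on :: "nat \<Rightarrow> (nat \<Rightarrow> real) set \<Rightarrow> ((nat \<Rightarrow> real) \<Rightarrow> real) \<Rightarrow> bool" where
  "smooth_on n U f \<longleftrightarrow> (\<forall>r. Ck_on r n U f)"

definition smooth_vec ::
    "nat \<Rightarrow> nat \<Rightarrow> (nat \<Rightarrow> real) set \<Rightarrow> ((nat \<Rightarrow> real) \<Rightarrow> (nat \<Rightarrow> real)) \<Rightarrow> bool" where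
  "smooth_vec n n' U F \<longleftrightarrow> (\<forall>j<n'. smooth_on n U (\<lambda>x. F x j))"

definition jacobian ::
    "nat \<Rightarrow> nat \<Rightarrow> ((nat \<Rightarrow> real) \<Rightarrow> (nat \<Rightarrow> real)) \<Rightarrow> (nat \<Rightarrow> real) \<Rightarrow> (nat \<Rightarrow> real) \<Rightarrow> (nat \<Rightarrow> real)"
  where
  "jacobian n n' F x \<xi> = (\<lambda>j. if j < n' then \<Sum>i<n. partial i (\<lambda>y. F y j) x * \<xi> i else 0)"

type_synonym 'a atlas = "('a set \<times> ('a \<Rightarrow> nat \<Rightarrow> real)) set"

definition smooth_atlas :: "nat \<Rightarrow> 'a topology \<Rightarrow> 'a atlas \<Rightarrow> bool" where
  "smooth_atlas n X \<A> \<longleftrightarrow>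
     (\<forall>(U, c)\<in>\<A>. openin X U \<and> openin (Euclidean_space n) (c ` U) \<and>
        homeomorphic_map (subtopology X U) (subtopology (Euclidean_space n) (c ` U)) c) \<and>
     (\<Union>(U, c)\<in>\<A>. U) = topspace X \<and>
     (\<forall>(U, c)\<in>\<A>. \<forall>(W, d)\<in>\<A>. smooth_vec n n (c ` (U \<inter> W)) (d \<circ> inv_into U c))"

definition smooth_manifold :: "nat \<Rightarrow> 'a topology \<Rightarrow> 'a atlas \<Rightarrow> bool" where
  "smooth_manifold n X \<A> \<longleftrightarrow> Hausdorff_space X \<and> second_countable X \<and> smooth_atlas n X \<A>"

definition smooth_map ::
    "nat \<Rightarrow> 'a topology \<Rightarrow> 'a atlas \<Rightarrow> nat \<Rightarrow> 'b topology \<Rightarrow> 'b atlas \<Rightarrow> ('a \<Rightarrow> 'b) \<Rightarrow> bool" where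
  "smooth_map k X \<A> n Y \<B> f \<longleftrightarrow> continuous_map X Y f \<and>
     (\<forall>(U, c)\<in>\<A>. \<forall>(W, d)\<in>\<B>. smooth_vec k n (c ` {x\<in>U. f x \<in> W}) (d \<circ> f \<circ> inv_into U c))"

definition immersive ::
    "nat \<Rightarrow> 'a atlas \<Rightarrow> nat \<Rightarrow> 'b atlas \<Rightarrow> ('a \<Rightarrow> 'b) \<Rightarrow> bool" where
  "immersive k \<A> n \<B> f \<longleftrightarrow>
     (\<forall>(U, c)\<in>\<A>. \<forall>(W, d)\<in>\<B>. \<forall>x\<in>U. f x \<in> W \<longrightarrow>
        inj_on (jacobian k n (d \<circ> f \<circ> inv_into U c) (c x)) (topspace (Euclidean_space k)))"

definition smooth_embedding ::
    "nat \<Rightarrow> 'a topology \<Rightarrow> 'a atlas \<Rightarrow> nat \<Rightarrow> 'b topology \<Rightarrow> 'b atlas \<Rightarrow> ('a \<Rightarrow> 'b) \<Rightarrow> bool" where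
  "smooth_embedding k X \<A> n Y \<B> f \<longleftrightarrow>
     smooth_map k X \<A> n Y \<B> f \<and> immersive k \<A> n \<B> f \<and> embedding_map X Y f"

definition smooth_scalar :: "nat \<Rightarrow> 'a atlas \<Rightarrow> 'a set \<Rightarrow> ('a \<Rightarrow> real) \<Rightarrow> bool" where
  "smooth_scalar k \<A> S f \<longleftrightarrow> (\<forall>(U, c)\<in>\<A>. smooth_on k (c ` (U \<inter> S)) (f \<circ> inv_into U c))"

text \<open>
  A smooth vector bundle of rank \<open>m\<close> with projection \<open>\<pi> : V \<rightarrow> M\<close> is presented by a set \<open>\<T>\<close> of local
  trivializations \<open>(L, \<tau>)\<close>, where \<open>\<tau>\<close> is the fibre coordinate on \<open>\<pi>\<^sup>-\<^sup>1(L)\<close>.  The transition maps are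
  required to be linear on the fibres, so \<open>\<T>\<close> determines the vector space structure of the fibres.
\<close>

definition smooth_vector_bundle ::
    "nat \<Rightarrow> 'a topology \<Rightarrow> 'a atlas \<Rightarrow> nat \<Rightarrow> 'v topology \<Rightarrow> ('v \<Rightarrow> 'a)
     \<Rightarrow> ('a set \<times> ('v \<Rightarrow> nat \<Rightarrow> real)) set \<Rightarrow> bool" where
  "smooth_vector_bundle k M \<A> m V \<pi> \<T> \<longleftrightarrow>
     continuous_map V M \<pi> \<and>
     (\<forall>(L, \<tau>)\<in>\<T>. openin M L \<and>
        homeomorphic_map (subtopology V {v \<in> topspace V. \<pi> v \<in> L})
          (prod_topology (subtopology M L) (Euclidean_space m)) (\<lambda>v. (\<pi> v, \<tau> v))) \<and>
     (\<Union>(L, \<tau>)\<in>\<T>. L) = topspace M \<and>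
     (\<forall>(L, \<tau>)\<in>\<T>. \<forall>(L', \<tau>')\<in>\<T>. \<exists>a :: 'a \<Rightarrow> nat \<Rightarrow> nat \<Rightarrow> real.
        (\<forall>j<m. \<forall>i<m. smooth_scalar k \<A> (L \<inter> L') (\<lambda>x. a x j i)) \<and>
        (\<forall>v\<in>topspace V. \<pi> v \<in> L \<inter> L' \<longrightarrow> (\<forall>j<m. \<tau>' v j = (\<Sum>i<m. a (\<pi> v) j i * \<tau> v i))))"

definition euclidean_metric ::
    "nat \<Rightarrow> 'a atlas \<Rightarrow> nat \<Rightarrow> 'v topology \<Rightarrow> ('v \<Rightarrow> 'a)
     \<Rightarrow> ('a set \<times> ('v \<Rightarrow> nat \<Rightarrow> real)) set \<Rightarrow> ('v \<Rightarrow> real) \<Rightarrow> bool" where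
  "euclidean_metric k \<A> m V \<pi> \<T> Q \<longleftrightarrow>
     (\<forall>(L, \<tau>)\<in>\<T>. \<exists>s :: 'a \<Rightarrow> nat \<Rightarrow> nat \<Rightarrow> real.
        (\<forall>i<m. \<forall>j<m. smooth_scalar k \<A> L (\<lambda>x. s x i j) \<and> (\<forall>x\<in>L. s x i j = s x j i)) \<and>
        (\<forall>v\<in>topspace V. \<pi> v \<in> L \<longrightarrow>
           Q v = (\<Sum>i<m. \<Sum>j<m. s (\<pi> v) i j * \<tau> v i * \<tau> v j) \<and>
           (\<tau> v \<noteq> (\<lambda>_. 0) \<longrightarrow> 0 < Q v)))"

definition bundle_zeros ::
    "'v topology \<Rightarrow> ('v \<Rightarrow> 'a) \<Rightarrow> ('a set \<times> ('v \<Rightarrow> nat \<Rightarrow> real)) set \<Rightarrow> 'v set" where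
  "bundle_zeros V \<pi> \<T> = {v \<in> topspace V. \<forall>(L, \<tau>)\<in>\<T>. \<pi> v \<in> L \<longrightarrow> \<tau> v = (\<lambda>_. 0)}"

definition bundle_atlas ::
    "nat \<Rightarrow> 'a atlas \<Rightarrow> 'v topology \<Rightarrow> ('v \<Rightarrow> 'a)
     \<Rightarrow> ('a set \<times> ('v \<Rightarrow> nat \<Rightarrow> real)) set \<Rightarrow> 'v atlas" where
  "bundle_atlas k \<A> V \<pi> \<T> =
     {({v \<in> topspace V. \<pi> v \<in> U \<inter> L}, \<lambda>v i. if i < k then c (\<pi> v) i else \<tau> v (i - k))
       | U c L \<tau>. (U, c) \<in> \<A> \<and> (L, \<tau>) \<in> \<T>}"

text \<open>
  The bundle \<open>V\<close> is the normal bundle of \<open>\<phi> : M \<rightarrow> B\<close> if it is the quotient of \<open>\<phi>\<^sup>*TB\<close> by \<open>TM\<close>.  The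
  quotient map is \<open>\<theta>\<close>: for a chart \<open>(W, d)\<close> of \<open>B\<close> at \<open>\<phi> x\<close>, \<open>\<theta> x (W, d) \<xi>\<close> is the class in the fibre over
  \<open>x\<close> of the tangent vector of \<open>B\<close> with coordinates \<open>\<xi>\<close> in that chart.  The clauses say that this
  depends only on the tangent vector, that it is smooth in \<open>x\<close> and linear in \<open>\<xi>\<close>, that it is onto the
  fibre, and that its kernel is the image of the differential of \<open>\<phi>\<close>.
\<close>

definition is_normal_bundle ::
    "nat \<Rightarrow> 'a atlas \<Rightarrow> nat \<Rightarrow> 'b atlas \<Rightarrow> ('a \<Rightarrow> 'b) \<Rightarrow> nat \<Rightarrow> 'v topology \<Rightarrow> ('v \<Rightarrow> 'a)
     \<Rightarrow> ('a set \<times> ('v \<Rightarrow> nat \<Rightarrow> real)) set \<Rightarrow> bool" where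
  "is_normal_bundle k \<A> n \<B> \<phi> m V \<pi> \<T> \<longleftrightarrow>
     (\<exists>\<theta> :: 'a \<Rightarrow> 'b set \<times> ('b \<Rightarrow> nat \<Rightarrow> real) \<Rightarrow> (nat \<Rightarrow> real) \<Rightarrow> 'v.
        (\<forall>(U, c)\<in>\<A>. \<forall>(W, d)\<in>\<B>. \<forall>x\<in>U. \<phi> x \<in> W \<longrightarrow>
           \<theta> x (W, d) ` topspace (Euclidean_space n) = {v \<in> topspace V. \<pi> v = x} \<and>
           {\<xi> \<in> topspace (Euclidean_space n). \<theta> x (W, d) \<xi> \<in> bundle_zeros V \<pi> \<T>}
             = jacobian k n (d \<circ> \<phi> \<circ> inv_into U c) (c x) ` topspace (Euclidean_space k) \<and>
           (\<forall>(W', d')\<in>\<B>. \<phi> x \<in> W' \<longrightarrow>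
              (\<forall>\<xi>\<in>topspace (Euclidean_space n).
                 \<theta> x (W', d') (jacobian n n (d' \<circ> inv_into W d) (d (\<phi> x)) \<xi>) = \<theta> x (W, d) \<xi>))) \<and>
        (\<forall>(W, d)\<in>\<B>. \<forall>(L, \<tau>)\<in>\<T>. \<exists>a :: 'a \<Rightarrow> nat \<Rightarrow> nat \<Rightarrow> real.
           (\<forall>j<m. \<forall>i<n. smooth_scalar k \<A> {x\<in>L. \<phi> x \<in> W} (\<lambda>x. a x j i)) \<and>
           (\<forall>x\<in>L. \<phi> x \<in> W \<longrightarrow> (\<forall>\<xi>\<in>topspace (Euclidean_space n). \<forall>j<m.
              \<tau> (\<theta> x (W, d) \<xi>) j = (\<Sum>i<n. a x j i * \<xi> i)))))"

section \<open>Embeddings with oriented normal bundle\<close>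

text \<open>
  An embedding \<open>\<phi> : M \<rightarrow> B\<close> together with its normal bundle, a metric on it (the function \<open>sqnorm\<close> is
  \<open>v \<mapsto> |v|\<^sup>2\<close>), a tubular neighbourhood diffeomorphism, and a Thom class.
\<close>

record ('u, 'v, 'k) embedding_data =
  source :: "'u topology"
  source_atlas :: "'u atlas"
  source_dim :: nat
  target :: "'u topology"
  target_atlas :: "'u atlas"
  codim :: nat
  emap :: "'u \<Rightarrow> 'u"
  total :: "'v topology"
  bproj :: "'v \<Rightarrow> 'u"
  triv :: "('u set \<times> ('v \<Rightarrow> nat \<Rightarrow> real)) set"
  sqnorm :: "'v \<Rightarrow> real"
  tubular :: "'v \<Rightarrow> 'u"
  thom :: 'k

definition disk_bundle :: "('u, 'v, 'k) embedding_data \<Rightarrow> 'v set" where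
  "disk_bundle \<Phi> = {v \<in> topspace (total \<Phi>). sqnorm \<Phi> v \<le> 1}"

definition sphere_bundle :: "('u, 'v, 'k) embedding_data \<Rightarrow> 'v set" where
  "sphere_bundle \<Phi> = {v \<in> topspace (total \<Phi>). sqnorm \<Phi> v = 1}"

definition tube :: "('u, 'v, 'k) embedding_data \<Rightarrow> 'u set" where
  "tube \<Phi> = tubular \<Phi> ` disk_bundle \<Phi>"

definition tube_boundary :: "('u, 'v, 'k) embedding_data \<Rightarrow> 'u set" where
  "tube_boundary \<Phi> = tubular \<Phi> ` sphere_bundle \<Phi>"

text \<open>
  A Thom class restricts, on each fibre \<open>(D\<^sub>x, S\<^sub>x)\<close>, to a generator of \<open>h\<^sup>*(D\<^sub>x, S\<^sub>x)\<close> as a free module of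
  rank one over the coefficient ring, here \<open>h\<^sup>*\<close> of the point \<open>\<phi> x\<close>.
\<close>

definition Thom_class :: "('u, 'k) cohomology \<Rightarrow> ('u, 'v, 'k) embedding_data \<Rightarrow> bool" where
  "Thom_class ct \<Phi> \<longleftrightarrow>
     (let B = target \<Phi>; m = int (codim \<Phi>); N = tube \<Phi>; dN = tube_boundary \<Phi> in
        thom \<Phi> \<in> carrier (Grp ct m (subtopology B N) dN) \<and>
        (\<forall>x\<in>topspace (source \<Phi>).
           let D = tubular \<Phi> ` {v \<in> disk_bundle \<Phi>. bproj \<Phi> v = x};
               S = tubular \<Phi> ` {v \<in> sphere_bundle \<Phi>. bproj \<Phi> v = x};
               pt = subtopology B {emap \<Phi> x};
               r = Ind ct m (subtopology B D) S (subtopology B N) dN id (thom \<Phi>)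
           in \<forall>j. bij_betw
                    (\<lambda>c. Cup ct j m (subtopology B D) {} S
                           (pull ct j (subtopology B D) pt (\<lambda>_. emap \<Phi> x) c) r)
                    (carrier (coh ct j pt)) (carrier (Grp ct (j + m) (subtopology B D) S))))"

definition oriented_proper_embedding ::
    "('u, 'k) cohomology \<Rightarrow> ('u, 'v, 'k) embedding_data \<Rightarrow> bool" where
  "oriented_proper_embedding ct \<Phi> \<longleftrightarrow>
     (let k = source_dim \<Phi>; m = codim \<Phi>; n = k + m;
          M = source \<Phi>; \<A> = source_atlas \<Phi>; B = target \<Phi>; \<B> = target_atlas \<Phi>;
          V = total \<Phi>; \<pi> = bproj \<Phi>; \<T> = triv \<Phi>
      in smooth_manifold k M \<A> \<and> smooth_manifold n B \<B> \<and>
         smooth_embedding k M \<A> n B \<B> (emap \<Phi>) \<and> proper_map M B (emap \<Phi>) \<and>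
         smooth_vector_bundle k M \<A> m V \<pi> \<T> \<and>
         is_normal_bundle k \<A> n \<B> (emap \<Phi>) m V \<pi> \<T> \<and>
         euclidean_metric k \<A> m V \<pi> \<T> (sqnorm \<Phi>) \<and>
         smooth_embedding n V (bundle_atlas k \<A> V \<pi> \<T>) n B \<B> (tubular \<Phi>) \<and>
         openin B (tubular \<Phi> ` topspace V) \<and>
         (\<forall>v\<in>bundle_zeros V \<pi> \<T>. tubular \<Phi> v = emap \<Phi> (\<pi> v)) \<and>
         Thom_class ct \<Phi>)"

definition Euler_class :: "('u, 'k) cohomology \<Rightarrow> ('u, 'v, 'k) embedding_data \<Rightarrow> 'k" where
  "Euler_class ct \<Phi> =
     Ind ct (int (codim \<Phi>)) (source \<Phi>) {} (subtopology (target \<Phi>) (tube \<Phi>)) (tube_boundary \<Phi>)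
       (emap \<Phi>) (thom \<Phi>)"

text \<open>
  The shriek map of a map \<open>\<psi> : Y \<rightarrow> X\<close> that is the pull-back of the embedding along \<open>P : X \<rightarrow> B\<close>; that is,
  it identifies \<open>Y\<close> with \<open>P\<^sup>-\<^sup>1(M) \<subseteq> X\<close>.  The isomorphisms \<open>s\<^sup>*\<close> and \<open>i\<^sup>*\<close> are inverted by
  \<^const>\<open>inv_into\<close>.
\<close>

definition shriek ::
    "('u, 'k) cohomology \<Rightarrow> ('u, 'v, 'k) embedding_data \<Rightarrow> int \<Rightarrow> 'u topology \<Rightarrow> 'u topology
     \<Rightarrow> ('u \<Rightarrow> 'u) \<Rightarrow> ('u \<Rightarrow> 'u) \<Rightarrow> 'k \<Rightarrow> 'k" where
  "shriek ct \<Phi> k Y X \<psi> P x =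
     (let m = int (codim \<Phi>);
          Mt = {z \<in> topspace X. P z \<in> emap \<Phi> ` topspace (source \<Phi>)};
          Nt = {z \<in> topspace X. P z \<in> tube \<Phi>};
          dNt = {z \<in> topspace X. P z \<in> tube_boundary \<Phi>};
          XN = subtopology X Nt;
          ut = Ind ct m XN dNt (subtopology (target \<Phi>) (tube \<Phi>)) (tube_boundary \<Phi>) P (thom \<Phi>);
          s_inv = inv_into (carrier (coh ct k XN)) (pull ct k Y XN \<psi>);
          i_inv = inv_into (carrier (Grp ct (k + m) X (topspace X - Mt)))
                    (Ind ct (k + m) XN dNt X (topspace X - Mt) id)
      in Ind ct (k + m) X {} X (topspace X - Mt) id (i_inv (Cup ct k m XN {} dNt (s_inv x) ut)))"

section \<open>Homotopy fibre products\<close>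

text \<open>
  The universe of points: it contains a copy of the arbitrary type \<open>'x\<close>, is closed under ordered
  pairs, and contains an element \<open>Arc a w b\<close> for each triple \<open>(a, w, b)\<close> where \<open>w\<close> is a real-indexed
  family of points.
\<close>

datatype 'x point =
    Atom 'x
  | Pair (left: "'x point") (right: "'x point")
  | Arc (start: "'x point") (track: "real \<Rightarrow> 'x point") (finish: "'x point")

definition prod_space :: "'x point topology \<Rightarrow> 'x point topology \<Rightarrow> 'x point topology" where
  "prod_space X Y =
     pullback_topology {Pair x y | x y. x \<in> topspace X \<and> y \<in> topspace Y}
       (\<lambda>z. (left z, right z)) (prod_topology X Y)"

text \<open>
  The space \<open>E\<^sup>I\<close> with the compact-open topology.  Paths are made extensional so that they are determined
  by their values on the unit interval.
\<close>

definition paths :: "'a topology \<Rightarrow> (real \<Rightarrow> 'a) set" where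
  "paths E = {w \<in> extensional {0..1}. pathin E w}"

definition path_space :: "'a topology \<Rightarrow> (real \<Rightarrow> 'a) topology" where
  "path_space E = topology_generated_by
     {{w \<in> paths E. w ` K \<subseteq> U} | K U. compact K \<and> K \<subseteq> {0..1} \<and> openin E U}"

definition hfp ::
    "'x point topology \<Rightarrow> ('x point \<Rightarrow> 'x point) \<Rightarrow> 'x point topology
     \<Rightarrow> ('x point \<Rightarrow> 'x point) \<Rightarrow> 'x point topology \<Rightarrow> 'x point topology" where
  "hfp F f E g G =
     pullback_topology
       {Arc a w b | a w b. a \<in> topspace F \<and> w \<in> paths E \<and> b \<in> topspace G \<and> f a = w 0 \<and> g b = w 1}
       (\<lambda>z. (start z, track z, finish z))
       (prod_topology F (prod_topology (path_space E) G))"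

definition const_arc :: "('x point \<Rightarrow> 'x point) \<Rightarrow> 'x point \<Rightarrow> 'x point" where
  "const_arc g b = Arc b (\<lambda>t\<in>{0..1}. g b) b"

definition composable :: "'x point topology \<Rightarrow> 'x point topology \<Rightarrow> 'x point topology" where
  "composable X Y = subtopology (prod_space X Y) {z. finish (left z) = start (right z)}"

definition concat_arc :: "'x point \<Rightarrow> 'x point" where
  "concat_arc z =
     Arc (start (left z))
       (\<lambda>t\<in>{0..1}. if t \<le> 1/2 then track (left z) (2 * t) else track (right z) (2 * t - 1))
       (finish (right z))"

definition cross ::
    "('x point, 'k) cohomology \<Rightarrow> int \<Rightarrow> int \<Rightarrow> 'x point topology \<Rightarrow> 'x point topology
     \<Rightarrow> 'k \<Rightarrow> 'k \<Rightarrow> 'k" where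
  "cross ct k l X Y a b =
     cup ct k l (prod_space X Y)
       (pull ct k (prod_space X Y) X left a) (pull ct l (prod_space X Y) Y right b)"

text \<open>
  The open string coproduct on \<open>h\<^sup>k \<times> h\<^sup>l\<close>, with values in \<open>h\<^sup>k\<^sup>+\<^sup>l\<^sup>+\<^sup>m\<close>; the inclusion of the space of
  composable pairs is \<^const>\<open>id\<close>.
\<close>

definition lcp ::
    "('x point, 'k) cohomology \<Rightarrow> ('x point, 'v, 'k) embedding_data \<Rightarrow> ('x point \<Rightarrow> 'x point)
     \<Rightarrow> 'x point topology \<Rightarrow> ('x point \<Rightarrow> 'x point) \<Rightarrow> 'x point topology
     \<Rightarrow> ('x point \<Rightarrow> 'x point) \<Rightarrow> 'x point topology \<Rightarrow> ('x point \<Rightarrow> 'x point) \<Rightarrow> 'x point topology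
     \<Rightarrow> int \<Rightarrow> int \<Rightarrow> 'k \<Rightarrow> 'k \<Rightarrow> 'k" where
  "lcp ct \<Phi> p F f E g G h H k l a b =
     (let X = hfp F f E g G; Y = hfp G g E h H
      in shriek ct \<Phi> (k + l) (composable X Y) (hfp F f E h H) concat_arc (\<lambda>z. p (track z (1/2)))
           (pull ct (k + l) (composable X Y) (prod_space X Y) id (cross ct k l X Y a b)))"

text \<open>The map \<open>G \<rightarrow> E \<times>\<^sub>B M\<close> is a homeomorphism, in particular \<open>p \<circ> g = \<phi> \<circ> q\<close>.\<close>

definition pullback_square ::
    "'a topology \<Rightarrow> ('a \<Rightarrow> 'e) \<Rightarrow> 'e topology \<Rightarrow> ('a \<Rightarrow> 'b) \<Rightarrow> 'b topology
     \<Rightarrow> ('e \<Rightarrow> 'c) \<Rightarrow> ('b \<Rightarrow> 'c) \<Rightarrow> bool" where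
  "pullback_square G g E q M p \<phi> \<longleftrightarrow>
     homeomorphic_map G (subtopology (prod_topology E M) {(e, x). p e = \<phi> x}) (\<lambda>b. (g b, q b))"

section \<open>Cohomology and path components\<close>

text \<open>
  The cohomology of each union of path components of \<open>X\<close> is the product of the cohomologies of these
  components.  In particular the cohomology of a union of path components is a factor of \<open>h\<^sup>*(X)\<close>, and
  restriction to the union is the projection onto this factor.
\<close>

definition respects_path_components :: "('u, 'k) cohomology \<Rightarrow> 'u topology \<Rightarrow> bool" where
  "respects_path_components ct X \<longleftrightarrow>
     (\<forall>\<C> n. \<C> \<subseteq> path_components_of X \<longrightarrow>
        bij_betw (\<lambda>a. \<lambda>C\<in>\<C>. pull ct n (subtopology X C) (subtopology X (\<Union>\<C>)) id a)
          (carrier (coh ct n (subtopology X (\<Union>\<C>))))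
          (\<Pi>\<^sub>E C\<in>\<C>. carrier (coh ct n (subtopology X C))))"

text \<open>
  The factor \<open>h\<^sup>n(S)\<close> of \<open>h\<^sup>n(X)\<close>, for \<open>S\<close> a union of path components: the classes whose components
  outside \<open>S\<close> vanish.
\<close>

definition factor :: "('u, 'k) cohomology \<Rightarrow> int \<Rightarrow> 'u topology \<Rightarrow> 'u set \<Rightarrow> 'k set" where
  "factor ct n X S =
     {a \<in> carrier (coh ct n X). \<forall>C\<in>path_components_of X. \<not> C \<subseteq> S \<longrightarrow>
        pull ct n (subtopology X C) X id a = \<one>\<^bsub>coh ct n (subtopology X C)\<^esub>}"

definition zero_component :: "('u, 'k) cohomology \<Rightarrow> int \<Rightarrow> 'u topology \<Rightarrow> 'u set \<Rightarrow> 'k \<Rightarrow> bool" where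
  "zero_component ct n X S a \<longleftrightarrow>
     pull ct n (subtopology X S) X id a = \<one>\<^bsub>coh ct n (subtopology X S)\<^esub>"

definition constant_part ::
    "'x point topology \<Rightarrow> ('x point \<Rightarrow> 'x point) \<Rightarrow> 'x point topology \<Rightarrow> 'x point set" where
  "constant_part G g E =
     (\<Union>\<alpha>\<in>topspace G. Collect (path_component_of (hfp G g E g G) (const_arc g \<alpha>)))"

end

theory Submission
  imports Defs
begin

text \<open>
  Let \<open>X\<close> be the space of arcs from \<open>f\<close> to \<open>h\<close> and \<open>\<mu> : Y \<rightarrow> X\<close> the concatenation of arcs that meet over
  \<open>g\<close>. Its shriek map satisfies the self-intersection formula \<open>\<mu>\<^sup>*(\<mu>\<^sup>! y) = y \<union> e\<close>, where \<open>e\<close> is pulled back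
  from the Euler class (lemma \<open>pull_shriek\<close>). If \<open>h = g\<close>, every arc is homotopic to its concatenation with
  the constant arc at its end, so \<open>\<mu>\<close> has a homotopy section \<open>\<Theta> : X \<rightarrow> Y\<close>. Classes on \<open>X\<close> are then
  determined by their restrictions along \<open>\<mu>\<close>, and \<open>\<mu>\<^sup>! y = \<Theta>\<^sup>* \<mu>\<^sup>* \<mu>\<^sup>! y = \<Theta>\<^sup>*(y \<union> e)\<close> (lemma
  \<open>lcp_along_section\<close>). For \<open>y\<close> the restriction of a cross product this is the formula for \<open>lcp\<^sub>f\<^sub>,\<^sub>g\<^sub>,\<^sub>g\<close>;
  a constant arc in front gives the formula for \<open>lcp\<^sub>g\<^sub>,\<^sub>g\<^sub>,\<^sub>h\<close>.

  The other assertions follow from these two formulas. The Euler class extends over \<open>B\<close> and the two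
  ends of an arc are joined by a path in \<open>B\<close>, so its pull-backs along the two ends agree. On
  \<open>\<^sup>gE\<^sup>g\<close> both formulas compute the coproduct of \<open>a\<close> and \<open>1\<close>, whence \<open>a \<union> e\<close> depends on the
  restriction of \<open>a\<close> to the constant arcs alone. The statements on path components and degrees
  are read off, except that the image of \<open>lcp\<^sub>g\<^sub>,\<^sub>g\<^sub>,\<^sub>g\<close> lies in the factor of the constant
  arcs: there a class is first replaced by one that vanishes on the other components. In a weakly
  invariant theory the decomposition along path components that this uses follows from additivity.

  The shriek map inverts two restriction maps, and the self-intersection formula only asks for
  preimages. For the Thom class the extension from the tube to \<open>B\<close> is made on the base (lemma
  \<open>thom_extends\<close>), and the extension of a product with its pull-back then follows by naturality and
  excision. To extend a class from \<open>Y\<close> to the arcs with midpoint over the tube, the radial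
  contraction of the tube is lifted along the fibration, and each arc is deformed by inserting at
  its midpoint a spike along the lift (lemma \<open>spike_compression\<close>). This gives a homotopy inverse of the
  inclusion for a Hurewicz fibration, and a weak equivalence for a Serre fibration.
\<close>

section \<open>Induced homomorphisms\<close>

context cohomology_theory
begin

lemma ind_closed:
  "pair_map X A Y B f \<Longrightarrow> a \<in> carrier (Grp ct n Y B) \<Longrightarrow> Ind ct n X A Y B f a \<in> carrier (Grp ct n X A)"
  using ind_hom by (fastforce simp: hom_def)

lemma ind_group_hom:
  assumes "pair_map X A Y B f"
  shows "group_hom (Grp ct n Y B) (Grp ct n X A) (Ind ct n X A Y B f)"
  using assms group[of A X n] group[of B Y n] ind_hom[OF assms, of n]
  by (auto simp: group_hom_def group_hom_axioms_def pair_map_def comm_group_def)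

text \<open>
  Cohomology acts on functions of the whole type of points. Two of them that agree on the points of
  \<open>X\<close> are homotopic, so the values elsewhere do not matter.
\<close>

lemma ind_cong:
  assumes f: "pair_map X A Y B f" and fg: "\<And>x. x \<in> topspace X \<Longrightarrow> f x = g x"
    and a: "a \<in> carrier (Grp ct n Y B)"
  shows "Ind ct n X A Y B f a = Ind ct n X A Y B g a"
proof -
  have img: "g ` A \<subseteq> B"
    using f fg by (fastforce simp: pair_map_def)
  then have g: "pair_map X A Y B g"
    using f fg continuous_map_eq unfolding pair_map_def by metis
  have "homotopic_with (\<lambda>k. k ` A \<subseteq> B) X Y f g"
    using f img fg by (intro homotopic_with_equal) (auto simp: pair_map_def)
  then show ?thesis
    by (rule homotopy[OF f g _ a])
qed

lemma ind_factor:
  assumes f: "pair_map X A Y B f" and g: "pair_map Y B Z C g"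
    and h: "\<And>x. x \<in> topspace X \<Longrightarrow> h x = g (f x)" and a: "a \<in> carrier (Grp ct n Z C)"
  shows "Ind ct n X A Z C h a = Ind ct n X A Y B f (Ind ct n Y B Z C g a)"
proof -
  have "pair_map X A Z C (g \<circ> f)"
    using f g unfolding pair_map_def by (force intro: continuous_map_compose)
  then have "Ind ct n X A Z C (g \<circ> f) a = Ind ct n X A Z C h a"
    using h a by (intro ind_cong) auto
  then show ?thesis
    using ind_comp[OF f g a] by simp
qed

lemma pair_map_empty [simp]: "pair_map X {} Y B f \<longleftrightarrow> continuous_map X Y f \<and> B \<subseteq> topspace Y"
  by (auto simp: pair_map_def)

lemma pull_closed:
  "continuous_map X Y f \<Longrightarrow> a \<in> carrier (coh ct n Y) \<Longrightarrow> pull ct n X Y f a \<in> carrier (coh ct n X)"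
  by (rule ind_closed) auto

lemma pull_factor:
  assumes "continuous_map X Y f" "continuous_map Y Z g" "\<And>x. x \<in> topspace X \<Longrightarrow> h x = g (f x)"
    and "a \<in> carrier (coh ct n Z)"
  shows "pull ct n X Z h a = pull ct n X Y f (pull ct n Y Z g a)"
  using assms by (intro ind_factor) auto

lemma pull_identity:
  assumes "\<And>x. x \<in> topspace X \<Longrightarrow> f x = x" and "a \<in> carrier (coh ct n X)"
  shows "pull ct n X X f a = a"
proof -
  have "pull ct n X X f a = pull ct n X X id a"
    using assms by (intro ind_cong[symmetric]) auto
  then show ?thesis
    using assms(2) by (simp add: ind_id)
qed

lemma pull_homotopic:
  assumes "homotopic_with (\<lambda>_. True) X Y f g" and "a \<in> carrier (coh ct n Y)"
  shows "pull ct n X Y f a = pull ct n X Y g a"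
  using assms homotopic_with_imp_continuous_maps[OF assms(1)] by (intro homotopy) auto

lemma pull_one:
  "continuous_map X Y f \<Longrightarrow> pull ct n X Y f \<one>\<^bsub>coh ct n Y\<^esub> = \<one>\<^bsub>coh ct n X\<^esub>"
  using ind_group_hom[of X "{}" Y "{}" f n] by (auto dest: group_hom.hom_one)

text \<open>
  A homotopy left inverse \<open>r\<close> of \<open>i\<close> supplies preimages: the class \<open>y\<close> is the restriction of \<open>r\<^sup>* y\<close>.
\<close>

lemma homotopy_retract_surj:
  assumes i: "continuous_map A X i" and r: "continuous_map X A r"
    and ri: "homotopic_with (\<lambda>_. True) A A (r \<circ> i) id"
  shows "pull ct n A X i ` carrier (coh ct n X) = carrier (coh ct n A)"
proof (intro equalityI subsetI)
  fix y assume y: "y \<in> carrier (coh ct n A)"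
  have "pull ct n A X i (pull ct n X A r y) = pull ct n A A (r \<circ> i) y"
    using i r y by (intro pull_factor[symmetric]) auto
  also have "\<dots> = y"
    using pull_homotopic[OF ri y] y by (simp add: ind_id)
  finally show "y \<in> pull ct n A X i ` carrier (coh ct n X)"
    using pull_closed[OF r y] by (metis image_eqI)
qed (use pull_closed[OF i] in auto)

lemma homotopy_section_inj:
  assumes i: "continuous_map A X i" and r: "continuous_map X A r"
    and ir: "homotopic_with (\<lambda>_. True) X X (i \<circ> r) id"
  shows "inj_on (pull ct n A X i) (carrier (coh ct n X))"
proof (rule inj_on_inverseI)
  fix x assume x: "x \<in> carrier (coh ct n X)"
  have "pull ct n X A r (pull ct n A X i x) = pull ct n X X (i \<circ> r) x"
    using i r x by (intro pull_factor[symmetric]) auto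
  also have "\<dots> = x"
    using pull_homotopic[OF ir x] x by (simp add: ind_id)
  finally show "pull ct n X A r (pull ct n A X i x) = x" .
qed

text \<open>
  One half of the five lemma for the long exact sequences of \<open>(X,A)\<close> and \<open>(X,A')\<close>. The image of \<open>x\<close>
  in \<open>h\<^sup>n(X)\<close> vanishes on \<open>A'\<close>, hence on \<open>A\<close> by injectivity, and so comes from a class \<open>z\<close> of \<open>(X,A)\<close>.
  The difference of \<open>x\<close> and the restriction of \<open>z\<close> is a coboundary from \<open>A'\<close>, and surjectivity turns
  it into the restriction of a coboundary from \<open>A\<close>.
\<close>

lemma relative_restriction_surj:
  assumes A: "A \<subseteq> topspace X" and A': "A' \<subseteq> A"
    and inj: "inj_on (pull ct n (subtopology X A') (subtopology X A) id) (carrier (coh ct n (subtopology X A)))"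
    and surj: "carrier (coh ct (n - 1) (subtopology X A'))
      \<subseteq> pull ct (n - 1) (subtopology X A') (subtopology X A) id ` carrier (coh ct (n - 1) (subtopology X A))"
    and x: "x \<in> carrier (Grp ct n X A')"
  shows "x \<in> Ind ct n X A' X A id ` carrier (Grp ct n X A)"
proof -
  let ?XA = "subtopology X A" and ?XA' = "subtopology X A'"
  have A'X: "A' \<subseteq> topspace X" using A A' by auto
  have cA: "continuous_map ?XA X id" and cA': "continuous_map ?XA' X id"
    by (simp_all add: continuous_map_from_subtopology)
  have cAA: "continuous_map ?XA' ?XA id"
    using A A' by (auto simp: continuous_map_in_subtopology continuous_map_from_subtopology)
  have pm: "pair_map X A' X A id"
    using A A' by (auto simp: pair_map_def)
  interpret R: group_hom "Grp ct n X A" "Grp ct n X A'" "Ind ct n X A' X A id"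
    by (rule ind_group_hom[OF pm])
  interpret J: group_hom "Grp ct n X A'" "coh ct n X" "Ind ct n X {} X A' id"
    using A'X by (intro ind_group_hom) auto
  interpret P: group_hom "coh ct n ?XA" "coh ct n ?XA'" "pull ct n ?XA' ?XA id"
    by (rule ind_group_hom) (use cAA in auto)
  interpret PA: group_hom "coh ct n X" "coh ct n ?XA" "pull ct n ?XA X id"
    by (rule ind_group_hom) (use cA in auto)
  let ?x0 = "Ind ct n X {} X A' id x"
  have x0: "?x0 \<in> carrier (coh ct n X)"
    using x by simp
  have "pull ct n ?XA' X id ?x0 = \<one>\<^bsub>coh ct n ?XA'\<^esub>"
    using exact_space[OF A'X, of n] x by (auto simp: kernel_def)
  moreover have "pull ct n ?XA' X id ?x0 = pull ct n ?XA' ?XA id (pull ct n ?XA X id ?x0)"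
    using cA cAA x0 by (intro pull_factor) auto
  ultimately have "pull ct n ?XA' ?XA id (pull ct n ?XA X id ?x0)
      = pull ct n ?XA' ?XA id \<one>\<^bsub>coh ct n ?XA\<^esub>"
    by (simp only: P.hom_one)
  then have "pull ct n ?XA X id ?x0 = \<one>\<^bsub>coh ct n ?XA\<^esub>"
    by (rule inj_onD[OF inj]) (use x0 in \<open>simp_all only: PA.hom_closed P.G.one_closed\<close>)
  then have "?x0 \<in> Ind ct n X {} X A id ` carrier (Grp ct n X A)"
    using exact_space[OF A, of n] x0 by (auto simp: kernel_def)
  then obtain z where z: "z \<in> carrier (Grp ct n X A)" and x0z: "?x0 = Ind ct n X {} X A id z"
    by blast
  have zx: "Ind ct n X {} X A' id (Ind ct n X A' X A id z) = ?x0"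
    unfolding x0z using pm A'X z by (intro ind_factor[symmetric]) auto
  let ?d = "x \<otimes>\<^bsub>Grp ct n X A'\<^esub> inv\<^bsub>Grp ct n X A'\<^esub> (Ind ct n X A' X A id z)"
  have d: "?d \<in> carrier (Grp ct n X A')"
    using x z by simp
  have "Ind ct n X {} X A' id ?d = \<one>\<^bsub>coh ct n X\<^esub>"
    using x z zx by (simp add: J.hom_mult J.hom_inv)
  then have "?d \<in> Bd ct (n - 1) X A' ` carrier (coh ct (n - 1) ?XA')"
    using exact_pair[OF A'X, of "n - 1"] d by (auto simp: kernel_def)
  then obtain a where a: "a \<in> carrier (coh ct (n - 1) ?XA)"
      and da: "?d = Bd ct (n - 1) X A' (pull ct (n - 1) ?XA' ?XA id a)"
    using surj by blast
  have Ba: "Bd ct (n - 1) X A a \<in> carrier (Grp ct n X A)"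
    using bd_hom[OF A, of "n - 1"] a by (auto simp: hom_def)
  have "Ind ct n X A' X A id (Bd ct (n - 1) X A a) = ?d"
    using bd_natural[OF pm a] da by simp
  then have "Ind ct n X A' X A id (Bd ct (n - 1) X A a \<otimes>\<^bsub>Grp ct n X A\<^esub> z) = x"
    using Ba z x by (simp add: R.hom_mult R.H.m_assoc)
  then show ?thesis
    using Ba z by (metis image_eqI R.G.m_closed)
qed

text \<open>
  What is excised is the complement of \<open>N\<close>: its closure misses \<open>V\<close> and therefore \<open>M\<close>.
\<close>

lemma excision_of_neighbourhood:
  assumes M: "closedin X M" and N: "N \<subseteq> topspace X" and V: "openin X V" "M \<subseteq> V" "V \<subseteq> N"
  shows "bij_betw (Ind ct n (subtopology X N) (N - M) X (topspace X - M) id)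
    (carrier (Grp ct n X (topspace X - M))) (carrier (Grp ct n (subtopology X N) (N - M)))"
proof -
  let ?W = "topspace X - N"
  have "X closure_of ?W \<subseteq> topspace X - V"
    using V by (intro closure_of_minimal) auto
  also have "\<dots> \<subseteq> X interior_of (topspace X - M)"
    using M V by (auto simp: interior_of_openin openin_diff)
  finally have "X closure_of ?W \<subseteq> X interior_of (topspace X - M)" .
  moreover have "topspace X - ?W = N" "topspace X - M - ?W = N - M"
    using N by auto
  ultimately show ?thesis
    using excision[of "topspace X - M" X ?W n] V by (metis Diff_mono Diff_subset order_refl order_trans)
qed

end

section \<open>Cup products\<close>

lemma excisive_empty_left [simp]: "excisive X {} A \<longleftrightarrow> A \<subseteq> topspace X"
  unfolding excisive_def using interior_of_topspace[of "subtopology X A"]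
  by (auto simp: topspace_subtopology Int_absorb1)

lemma excisive_empty_right [simp]: "excisive X A {} \<longleftrightarrow> A \<subseteq> topspace X"
  unfolding excisive_def using interior_of_topspace[of "subtopology X A"]
  by (auto simp: topspace_subtopology Int_absorb1)

context multiplicative_cohomology_theory
begin

lemma cup_in_carrier:
  "a \<in> carrier (coh ct k X) \<Longrightarrow> b \<in> carrier (coh ct l X) \<Longrightarrow> cup ct k l X a b \<in> carrier (coh ct (k + l) X)"
  using cup_closed[of X "{}" "{}"] by simp

lemma pull_cup:
  assumes "continuous_map X Y f" "a \<in> carrier (coh ct k Y)" "b \<in> carrier (coh ct l Y)"
  shows "pull ct (k + l) X Y f (cup ct k l Y a b) = cup ct k l X (pull ct k X Y f a) (pull ct l X Y f b)"
  using cup_natural[of X "{}" "{}" Y "{}" "{}" f a k b l] assms by simp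

lemma cup_absolute_assoc:
  assumes "a \<in> carrier (coh ct k X)" "b \<in> carrier (coh ct l X)" "c \<in> carrier (coh ct r X)"
  shows "cup ct (k + l) r X (cup ct k l X a b) c = cup ct k (l + r) X a (cup ct l r X b c)"
  using cup_assoc[of X "{}" "{}" "{}" a k b l c r] assms by simp

lemma cup_zero_right:
  assumes a: "a \<in> carrier (coh ct k X)"
  shows "cup ct k l X a \<one>\<^bsub>coh ct l X\<^esub> = \<one>\<^bsub>coh ct (k + l) X\<^esub>"
proof -
  interpret L: comm_group "coh ct l X" by (rule group) simp
  interpret KL: comm_group "coh ct (k + l) X" by (rule group) simp
  let ?z = "cup ct k l X a \<one>\<^bsub>coh ct l X\<^esub>"
  have "?z = ?z \<otimes>\<^bsub>coh ct (k + l) X\<^esub> ?z"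
    using cup_add_right[of X "{}" "{}" a k "\<one>\<^bsub>coh ct l X\<^esub>" l "\<one>\<^bsub>coh ct l X\<^esub>"] a by simp
  then show ?thesis
    using cup_in_carrier[OF a L.one_closed] KL.r_cancel_one' by metis
qed

lemma cup_zero_left:
  assumes b: "b \<in> carrier (coh ct l X)"
  shows "cup ct k l X \<one>\<^bsub>coh ct k X\<^esub> b = \<one>\<^bsub>coh ct (k + l) X\<^esub>"
proof -
  interpret K: comm_group "coh ct k X" by (rule group) simp
  interpret KL: comm_group "coh ct (k + l) X" by (rule group) simp
  let ?z = "cup ct k l X \<one>\<^bsub>coh ct k X\<^esub> b"
  have "?z = ?z \<otimes>\<^bsub>coh ct (k + l) X\<^esub> ?z"
    using cup_add_left[of X "{}" "{}" "\<one>\<^bsub>coh ct k X\<^esub>" k "\<one>\<^bsub>coh ct k X\<^esub>" b l] b by simp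
  then show ?thesis
    using cup_in_carrier[OF K.one_closed b] KL.r_cancel_one' by metis
qed

end

section \<open>Vector bundles with a metric\<close>

lemma continuous_map_compose2:
  "continuous_map Y Z g \<Longrightarrow> continuous_map X Y f \<Longrightarrow> continuous_map X Z (\<lambda>x. g (f x))"
  using continuous_map_compose[of X Y f Z g] by (simp add: o_def)

locale metric_vector_bundle =
  fixes k :: nat and M :: "'a topology" and \<A> :: "'a atlas" and m :: nat and V :: "'v topology"
    and \<pi> :: "'v \<Rightarrow> 'a" and \<T> :: "('a set \<times> ('v \<Rightarrow> nat \<Rightarrow> real)) set" and Q :: "'v \<Rightarrow> real"
  assumes atlas: "smooth_atlas k M \<A>" and vector_bundle: "smooth_vector_bundle k M \<A> m V \<pi> \<T>"
    and metric: "euclidean_metric k \<A> m V \<pi> \<T> Q"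
begin

lemma projection: "continuous_map V M \<pi>"
  using vector_bundle by (simp add: smooth_vector_bundle_def)

lemma projection_in_base: "v \<in> topspace V \<Longrightarrow> \<pi> v \<in> topspace M"
  using projection by (auto simp: continuous_map_def)

lemma trivialization:
  assumes "(L, \<tau>) \<in> \<T>"
  shows "openin M L" "homeomorphic_map (subtopology V {v \<in> topspace V. \<pi> v \<in> L})
          (prod_topology (subtopology M L) (Euclidean_space m)) (\<lambda>v. (\<pi> v, \<tau> v))"
  using assms vector_bundle by (auto simp: smooth_vector_bundle_def)

lemma open_over: "openin M L \<Longrightarrow> openin V {v \<in> topspace V. \<pi> v \<in> L}"
  using openin_continuous_map_preimage[OF projection] .

lemma trivialization_exists:
  assumes "x \<in> topspace M" obtains L \<tau> where "(L, \<tau>) \<in> \<T>" "x \<in> L"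
  using assms vector_bundle unfolding smooth_vector_bundle_def by blast

lemma fibre_coordinate:
  assumes "(L, \<tau>) \<in> \<T>"
  shows "continuous_map (subtopology V {v \<in> topspace V. \<pi> v \<in> L}) (Euclidean_space m) \<tau>"
    and "v \<in> topspace V \<Longrightarrow> \<pi> v \<in> L \<Longrightarrow> i \<ge> m \<Longrightarrow> \<tau> v i = 0"
proof -
  show c: "continuous_map (subtopology V {v \<in> topspace V. \<pi> v \<in> L}) (Euclidean_space m) \<tau>"
    using homeomorphic_imp_continuous_map[OF trivialization(2)[OF assms]]
    by (simp add: continuous_map_paired)
  show "\<tau> v i = 0" if "v \<in> topspace V" "\<pi> v \<in> L" "i \<ge> m"
    using that continuous_map_image_subset_topspace[OF c] by (auto simp: topspace_Euclidean_space)
qed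

lemma fibre_coordinate_component:
  "(L, \<tau>) \<in> \<T> \<Longrightarrow> continuous_map (subtopology V {v \<in> topspace V. \<pi> v \<in> L}) euclideanreal (\<lambda>v. \<tau> v i)"
  using fibre_coordinate(1)[of L \<tau>]
  by (simp add: Euclidean_space_def continuous_map_in_subtopology continuous_map_componentwise_UNIV)

text \<open>
  Since the transition maps are linear on the fibres, multiplication by a scalar means the same in
  all trivializations.
\<close>

lemma transition_linear:
  assumes "(L, \<tau>) \<in> \<T>" "(L', \<tau>') \<in> \<T>" "v \<in> topspace V" "v' \<in> topspace V" "\<pi> v' = \<pi> v" "\<pi> v \<in> L" "\<pi> v \<in> L'"
    and "\<tau> v' = (\<lambda>i. c * \<tau> v i)"
  shows "\<tau>' v' = (\<lambda>i. c * \<tau>' v i)"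
proof
  fix j
  have all: "\<forall>(L, \<tau>)\<in>\<T>. \<forall>(L', \<tau>')\<in>\<T>. \<exists>a :: 'a \<Rightarrow> nat \<Rightarrow> nat \<Rightarrow> real.
        (\<forall>j<m. \<forall>i<m. smooth_scalar k \<A> (L \<inter> L') (\<lambda>x. a x j i)) \<and>
        (\<forall>v\<in>topspace V. \<pi> v \<in> L \<inter> L' \<longrightarrow> (\<forall>j<m. \<tau>' v j = (\<Sum>i<m. a (\<pi> v) j i * \<tau> v i)))"
    using vector_bundle unfolding smooth_vector_bundle_def by (elim conjE)
  obtain a where a: "\<forall>v\<in>topspace V. \<pi> v \<in> L \<inter> L' \<longrightarrow> (\<forall>j<m. \<tau>' v j = (\<Sum>i<m. a (\<pi> v) j i * \<tau> v i))"
    using bspec[OF bspec[OF all assms(1), unfolded prod.case] assms(2), unfolded prod.case] by (elim exE conjE)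
  show "\<tau>' v' j = c * \<tau>' v j"
  proof (cases "j < m")
    case True
    then show ?thesis
      using assms(3-8) a[rule_format, of v j] a[rule_format, of v' j] by (simp add: sum_distrib_left algebra_simps)
  next
    case False
    then show ?thesis
      using fibre_coordinate(2)[OF assms(2)] assms by simp
  qed
qed

text \<open>
  A bundle is given by its trivializations alone, so the scalar multiple of \<open>v\<close> is described as the
  vector over the same point with the scaled coordinates in all trivializations at once.
\<close>

definition scale :: "real \<Rightarrow> 'v \<Rightarrow> 'v" where
  "scale c v = (SOME v'. v' \<in> topspace V \<and> \<pi> v' = \<pi> v \<and>
     (\<forall>(L, \<tau>)\<in>\<T>. \<pi> v \<in> L \<longrightarrow> \<tau> v' = (\<lambda>i. c * \<tau> v i)))"

lemma fibre_coordinate_inject: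
  assumes "(L, \<tau>) \<in> \<T>" "v \<in> topspace V" "v' \<in> topspace V" "\<pi> v \<in> L" "\<pi> v' = \<pi> v" "\<tau> v' = \<tau> v"
  shows "v' = v"
proof -
  have "inj_on (\<lambda>v. (\<pi> v, \<tau> v)) {v \<in> topspace V. \<pi> v \<in> L}"
    using homeomorphic_imp_injective_map[OF trivialization(2)[OF assms(1)]] by (simp add: Int_absorb1 Collect_mono_iff)
  then show ?thesis
    using assms by (auto dest: inj_onD)
qed

lemma scale:
  assumes v: "v \<in> topspace V"
  shows "scale c v \<in> topspace V" "\<pi> (scale c v) = \<pi> v"
    "(L, \<tau>) \<in> \<T> \<Longrightarrow> \<pi> v \<in> L \<Longrightarrow> \<tau> (scale c v) = (\<lambda>i. c * \<tau> v i)"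
proof -
  obtain L0 \<tau>0 where L0: "(L0, \<tau>0) \<in> \<T>" "\<pi> v \<in> L0"
    using trivialization_exists[OF projection_in_base[OF v]] .
  have "(\<pi> v, \<lambda>i. c * \<tau>0 v i) \<in> topspace (prod_topology (subtopology M L0) (Euclidean_space m))"
    using v L0 fibre_coordinate(2)[OF L0(1)] by (auto simp: projection_in_base topspace_Euclidean_space)
  then have "(\<pi> v, \<lambda>i. c * \<tau>0 v i) \<in> (\<lambda>v. (\<pi> v, \<tau>0 v)) ` topspace (subtopology V {v \<in> topspace V. \<pi> v \<in> L0})"
    using homeomorphic_imp_surjective_map[OF trivialization(2)[OF L0(1)]] by simp
  then obtain v' where v': "v' \<in> topspace V" "\<pi> v' = \<pi> v" "\<tau>0 v' = (\<lambda>i. c * \<tau>0 v i)"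
    by auto
  have "\<exists>v'. v' \<in> topspace V \<and> \<pi> v' = \<pi> v \<and> (\<forall>(L, \<tau>)\<in>\<T>. \<pi> v \<in> L \<longrightarrow> \<tau> v' = (\<lambda>i. c * \<tau> v i))"
  proof (intro exI conjI ballI)
    fix i assume i: "i \<in> \<T>"
    obtain L \<tau> where "i = (L, \<tau>)" by (cases i)
    then show "case i of (L, \<tau>) \<Rightarrow> \<pi> v \<in> L \<longrightarrow> \<tau> v' = (\<lambda>i. c * \<tau> v i)"
      using transition_linear[OF L0(1) _ v v'(1,2) L0(2) _ v'(3), of L \<tau>] i by simp
  qed (use v' in simp_all)
  from someI_ex[OF this] have *: "scale c v \<in> topspace V \<and> \<pi> (scale c v) = \<pi> v \<and>
     (\<forall>(L, \<tau>)\<in>\<T>. \<pi> v \<in> L \<longrightarrow> \<tau> (scale c v) = (\<lambda>i. c * \<tau> v i))"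
    unfolding scale_def .
  show "scale c v \<in> topspace V"
    using * by (rule conjunct1)
  show "\<pi> (scale c v) = \<pi> v"
    using conjunct2[OF *] by (rule conjunct1)
  have all: "\<forall>(L, \<tau>)\<in>\<T>. \<pi> v \<in> L \<longrightarrow> \<tau> (scale c v) = (\<lambda>i. c * \<tau> v i)"
    using conjunct2[OF *] by (rule conjunct2)
  show "\<tau> (scale c v) = (\<lambda>i. c * \<tau> v i)" if "(L, \<tau>) \<in> \<T>" "\<pi> v \<in> L"
    using bspec[OF all that(1), unfolded prod.case] that(2) by (rule mp)
qed

lemma scale_continuous: "continuous_map (prod_topology euclideanreal V) V (\<lambda>(c, v). scale c v)"
proof (rule pasting_lemma[where I = \<T> and T = "\<lambda>(L, \<tau>). UNIV \<times> {v \<in> topspace V. \<pi> v \<in> L}"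
      and f = "\<lambda>_ (c, v). scale c v"])
  fix i assume i: "i \<in> \<T>"
  obtain L \<tau> where i': "i = (L, \<tau>)" by (cases i)
  with i have L: "(L, \<tau>) \<in> \<T>" by simp
  let ?VL = "{v \<in> topspace V. \<pi> v \<in> L}"
  show "openin (prod_topology euclideanreal V) ((\<lambda>(L, \<tau>). UNIV \<times> {v \<in> topspace V. \<pi> v \<in> L}) i)"
    using open_over[OF trivialization(1)[OF L]] by (simp add: i' openin_prod_Times_iff)
  obtain h where h: "homeomorphic_maps (subtopology V ?VL)
          (prod_topology (subtopology M L) (Euclidean_space m)) (\<lambda>v. (\<pi> v, \<tau> v)) h"
    using trivialization(2)[OF L] by (auto simp: homeomorphic_map_maps)
  then have hh: "\<forall>v\<in>topspace V \<inter> ?VL. h (\<pi> v, \<tau> v) = v"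
    by (simp add: homeomorphic_maps_def)
  let ?S = "prod_topology euclideanreal (subtopology V ?VL)"
  have sub: "subtopology (prod_topology euclideanreal V) (UNIV \<times> ?VL) = ?S"
    by (simp add: subtopology_Times)
  have \<pi>c: "continuous_map (subtopology V ?VL) (subtopology M L) \<pi>"
    using projection by (auto simp: continuous_map_in_subtopology continuous_map_from_subtopology)
  have \<tau>c: "continuous_map ?S (Euclidean_space m) (\<lambda>(c, v) i. c * \<tau> v i)"
  proof -
    have "continuous_map ?S euclideanreal (\<lambda>z. fst z * \<tau> (snd z) i)" for i
      by (intro continuous_intros continuous_map_compose2[OF fibre_coordinate_component[OF L]])
    then show ?thesis
      using fibre_coordinate(2)[OF L]
      by (auto simp: Euclidean_space_def continuous_map_in_subtopology continuous_map_componentwise_UNIV case_prod_unfold)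
  qed
  have "continuous_map ?S (prod_topology (subtopology M L) (Euclidean_space m))
      (\<lambda>z. (\<pi> (snd z), (\<lambda>(c, v) i. c * \<tau> v i) z))"
    by (intro continuous_map_pairedI \<tau>c continuous_map_compose2[OF \<pi>c] continuous_map_snd)
  then have "continuous_map ?S (subtopology V ?VL) (\<lambda>z. h (\<pi> (snd z), (\<lambda>(c, v) i. c * \<tau> v i) z))"
    by (rule continuous_map_compose2[rotated]) (use h in \<open>simp add: homeomorphic_maps_def\<close>)
  then have "continuous_map ?S (subtopology V ?VL) (\<lambda>(c, v). scale c v)"
  proof (rule continuous_map_eq)
    fix z assume z: "z \<in> topspace ?S"
    then obtain c v where cv: "z = (c, v)" "v \<in> topspace V" "\<pi> v \<in> L" by auto
    have "h (\<pi> (scale c v), \<tau> (scale c v)) = scale c v"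
      using hh[rule_format, of "scale c v"] scale(1,2)[OF cv(2)] cv(3) by simp
    then show "h (\<pi> (snd z), (\<lambda>(c, v) i. c * \<tau> v i) z) = (\<lambda>(c, v). scale c v) z"
      using scale(2)[OF cv(2)] scale(3)[OF cv(2) L cv(3)] cv(1) by simp
  qed
  then show "continuous_map (subtopology (prod_topology euclideanreal V)
      ((\<lambda>(L, \<tau>). UNIV \<times> {v \<in> topspace V. \<pi> v \<in> L}) i)) V (\<lambda>(c, v). scale c v)"
    by (simp add: i' sub continuous_map_in_subtopology)
next
  fix z assume "z \<in> topspace (prod_topology euclideanreal V)"
  then have "snd z \<in> topspace V" by auto
  then obtain L \<tau> where "(L, \<tau>) \<in> \<T>" "\<pi> (snd z) \<in> L"
    using trivialization_exists[OF projection_in_base] by metis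
  then have "(L, \<tau>) \<in> \<T> \<and> z \<in> (\<lambda>(L, \<tau>). UNIV \<times> {v \<in> topspace V. \<pi> v \<in> L}) (L, \<tau>) \<and>
      (\<lambda>(c, v). scale c v) z = (\<lambda>(c, v). scale c v) z"
    using \<open>snd z \<in> topspace V\<close> by (simp add: mem_Times_iff)
  then show "\<exists>j. j \<in> \<T> \<and> z \<in> (\<lambda>(L, \<tau>). UNIV \<times> {v \<in> topspace V. \<pi> v \<in> L}) j \<and>
      (\<lambda>(c, v). scale c v) z = (\<lambda>(c, v). scale c v) z"
    by (rule exI[where x = "(L, \<tau>)"])
qed (rule refl)

lemma smooth_scalar_continuous:
  assumes "(U, c) \<in> \<A>" "smooth_scalar k \<A> L s" 
  shows "continuous_map (subtopology M (U \<inter> L)) euclideanreal s"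
proof -
  have c: "homeomorphic_map (subtopology M U) (subtopology (Euclidean_space k) (c ` U)) c" and U: "openin M U"
    using atlas assms(1) by (auto simp: smooth_atlas_def)
  have "smooth_on k (c ` (U \<inter> L)) (s \<circ> inv_into U c)"
    using assms by (auto simp: smooth_scalar_def)
  then have "Ck_on 0 k (c ` (U \<inter> L)) (s \<circ> inv_into U c)"
    unfolding smooth_on_def by blast
  then have s: "continuous_map (subtopology (Euclidean_space k) (c ` (U \<inter> L))) euclideanreal (s \<circ> inv_into U c)"
    by simp
  have inj: "inj_on c U"
    using homeomorphic_imp_injective_map[OF c] openin_subset[OF U] by (simp add: Int_absorb1)
  have "continuous_map (subtopology M (U \<inter> L)) (subtopology (Euclidean_space k) (c ` (U \<inter> L))) c"
    using continuous_map_from_subtopology_mono[of M U _ c "U \<inter> L"] homeomorphic_imp_continuous_map[OF c]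
    by (auto simp: continuous_map_in_subtopology)
  then have "continuous_map (subtopology M (U \<inter> L)) euclideanreal (\<lambda>x. (s \<circ> inv_into U c) (c x))"
    by (rule continuous_map_compose2[OF s])
  then show ?thesis
    by (rule continuous_map_eq) (use inj in auto)
qed

lemma metric_in_trivialization:
  assumes "(L, \<tau>) \<in> \<T>"
  obtains s where "\<forall>i<m. \<forall>j<m. smooth_scalar k \<A> L (\<lambda>x. s x i j)"
    "\<forall>v\<in>topspace V. \<pi> v \<in> L \<longrightarrow> Q v = (\<Sum>i<m. \<Sum>j<m. s (\<pi> v) i j * \<tau> v i * \<tau> v j)"
    "\<forall>v\<in>topspace V. \<pi> v \<in> L \<longrightarrow> \<tau> v \<noteq> (\<lambda>_. 0) \<longrightarrow> 0 < Q v"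
proof -
  obtain s :: "'a \<Rightarrow> nat \<Rightarrow> nat \<Rightarrow> real" where
    "(\<forall>i<m. \<forall>j<m. smooth_scalar k \<A> L (\<lambda>x. s x i j) \<and> (\<forall>x\<in>L. s x i j = s x j i)) \<and>
        (\<forall>v\<in>topspace V. \<pi> v \<in> L \<longrightarrow>
           Q v = (\<Sum>i<m. \<Sum>j<m. s (\<pi> v) i j * \<tau> v i * \<tau> v j) \<and>
           (\<tau> v \<noteq> (\<lambda>_. 0) \<longrightarrow> 0 < Q v))"
    using metric assms unfolding euclidean_metric_def by blast
  then show ?thesis using that by blast
qed

text \<open>
  Over the intersection of a chart and a trivialization, \<open>Q\<close> is a quadratic form in the fibre
  coordinates whose coefficients are smooth functions of the chart coordinates.
\<close>

lemma norm_continuous: "continuous_map V euclideanreal Q"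
proof (rule pasting_lemma[where I = "\<A> \<times> \<T>" and f = "\<lambda>_. Q"
      and T = "\<lambda>((U, c), (L, \<tau>)). {v \<in> topspace V. \<pi> v \<in> U \<inter> L}"])
  fix i assume i: "i \<in> \<A> \<times> \<T>"
  obtain U c L \<tau> where i': "i = ((U, c), (L, \<tau>))" by (metis surj_pair)
  with i have U: "(U, c) \<in> \<A>" and L: "(L, \<tau>) \<in> \<T>" by auto
  have "openin M U" using atlas U by (auto simp: smooth_atlas_def)
  then have "openin M (U \<inter> L)" using trivialization(1)[OF L] by blast
  then show "openin V ((\<lambda>((U, c), (L, \<tau>)). {v \<in> topspace V. \<pi> v \<in> U \<inter> L}) i)"
    unfolding i' prod.case by (rule open_over)
  let ?S = "subtopology V {v \<in> topspace V. \<pi> v \<in> U \<inter> L}"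
  obtain s where s: "\<forall>i<m. \<forall>j<m. smooth_scalar k \<A> L (\<lambda>x. s x i j)"
    "\<forall>v\<in>topspace V. \<pi> v \<in> L \<longrightarrow> Q v = (\<Sum>i<m. \<Sum>j<m. s (\<pi> v) i j * \<tau> v i * \<tau> v j)"
    "\<forall>v\<in>topspace V. \<pi> v \<in> L \<longrightarrow> \<tau> v \<noteq> (\<lambda>_. 0) \<longrightarrow> 0 < Q v"
    using metric_in_trivialization[OF L] .
  have "continuous_map ?S (subtopology M (U \<inter> L)) \<pi>"
    using projection by (auto simp: continuous_map_in_subtopology continuous_map_from_subtopology)
  then have "continuous_map ?S euclideanreal (\<lambda>v. s (\<pi> v) i j)" if "i < m" "j < m" for i j
    using continuous_map_compose2[OF smooth_scalar_continuous[OF U s(1)[rule_format, OF that]]] by blast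
  moreover have "continuous_map ?S euclideanreal (\<lambda>v. \<tau> v i)" for i
    by (rule continuous_map_from_subtopology_mono[OF fibre_coordinate_component[OF L]]) auto
  ultimately have "continuous_map ?S euclideanreal (\<lambda>v. \<Sum>i<m. \<Sum>j<m. s (\<pi> v) i j * \<tau> v i * \<tau> v j)"
    by (intro continuous_intros) auto
  then have "continuous_map ?S euclideanreal Q"
    by (rule continuous_map_eq) (use s(2) in auto)
  then show "continuous_map (subtopology V ((\<lambda>((U, c), (L, \<tau>)). {v \<in> topspace V. \<pi> v \<in> U \<inter> L}) i)) euclideanreal Q"
    by (simp add: i')
next
  fix v assume v: "v \<in> topspace V"
  obtain L \<tau> where L: "(L, \<tau>) \<in> \<T>" "\<pi> v \<in> L"
    using trivialization_exists[OF projection_in_base[OF v]] .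
  obtain U c where U: "(U, c) \<in> \<A>" "\<pi> v \<in> U"
    using atlas projection_in_base[OF v] unfolding smooth_atlas_def by blast
  have "((U, c), (L, \<tau>)) \<in> \<A> \<times> \<T> \<and> v \<in> (\<lambda>((U, c), (L, \<tau>)). {v \<in> topspace V. \<pi> v \<in> U \<inter> L}) ((U, c), (L, \<tau>)) \<and> Q v = Q v"
    using L U v by simp
  then show "\<exists>j. j \<in> \<A> \<times> \<T> \<and> v \<in> (\<lambda>((U, c), (L, \<tau>)). {v \<in> topspace V. \<pi> v \<in> U \<inter> L}) j \<and> Q v = Q v"
    by (rule exI[where x = "((U, c), (L, \<tau>))"])
qed (rule refl)

lemma norm_scale: "v \<in> topspace V \<Longrightarrow> Q (scale c v) = c\<^sup>2 * Q v"
proof -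
  assume v: "v \<in> topspace V"
  obtain L \<tau> where L: "(L, \<tau>) \<in> \<T>" "\<pi> v \<in> L"
    using trivialization_exists[OF projection_in_base[OF v]] .
  obtain s where s: "\<forall>i<m. \<forall>j<m. smooth_scalar k \<A> L (\<lambda>x. s x i j)"
    "\<forall>v\<in>topspace V. \<pi> v \<in> L \<longrightarrow> Q v = (\<Sum>i<m. \<Sum>j<m. s (\<pi> v) i j * \<tau> v i * \<tau> v j)"
    "\<forall>v\<in>topspace V. \<pi> v \<in> L \<longrightarrow> \<tau> v \<noteq> (\<lambda>_. 0) \<longrightarrow> 0 < Q v"
    using metric_in_trivialization[OF L(1)] .
  then show ?thesis
    using s(2)[rule_format, of v] s(2)[rule_format, of "scale c v"] scale(1,2)[OF v] scale(3)[OF v L] L v by (simp add: sum_distrib_left power2_eq_square algebra_simps)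
qed

lemma norm_nonneg: "v \<in> topspace V \<Longrightarrow> 0 \<le> Q v"
  and norm_eq_0_iff: "v \<in> topspace V \<Longrightarrow> Q v = 0 \<longleftrightarrow> v \<in> bundle_zeros V \<pi> \<T>"
proof -
  assume v: "v \<in> topspace V"
  obtain L \<tau> where L: "(L, \<tau>) \<in> \<T>" "\<pi> v \<in> L"
    using trivialization_exists[OF projection_in_base[OF v]] .
  obtain s where s: "\<forall>i<m. \<forall>j<m. smooth_scalar k \<A> L (\<lambda>x. s x i j)"
    "\<forall>v\<in>topspace V. \<pi> v \<in> L \<longrightarrow> Q v = (\<Sum>i<m. \<Sum>j<m. s (\<pi> v) i j * \<tau> v i * \<tau> v j)"
    "\<forall>v\<in>topspace V. \<pi> v \<in> L \<longrightarrow> \<tau> v \<noteq> (\<lambda>_. 0) \<longrightarrow> 0 < Q v"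
    using metric_in_trivialization[OF L(1)] .
  have 0: "Q v = 0" if "\<tau> v = (\<lambda>_. 0)"
    using s(2)[rule_format, OF v L(2)] that by simp
  show "0 \<le> Q v"
    using s(3)[rule_format, OF v L(2)] 0 by (cases "\<tau> v = (\<lambda>_. 0)") simp_all
  show "Q v = 0 \<longleftrightarrow> v \<in> bundle_zeros V \<pi> \<T>"
  proof
    assume "Q v = 0"
    have "\<tau>' v = (\<lambda>_. 0)" if L': "(L', \<tau>') \<in> \<T>" "\<pi> v \<in> L'" for L' \<tau>'
    proof -
      have "\<tau>' v \<noteq> (\<lambda>_. 0) \<Longrightarrow> 0 < Q v"
        by (rule metric_in_trivialization[OF L'(1)]) (use v L' in blast)
      then show ?thesis
        using \<open>Q v = 0\<close> by auto
    qed
    then show "v \<in> bundle_zeros V \<pi> \<T>"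
      unfolding bundle_zeros_def using v by blast
  next
    assume "v \<in> bundle_zeros V \<pi> \<T>"
    then have "\<tau> v = (\<lambda>_. 0)"
      using L unfolding bundle_zeros_def by blast
    then show "Q v = 0" by (rule 0)
  qed
qed

lemma scale_1: "v \<in> topspace V \<Longrightarrow> scale 1 v = v"
proof -
  assume v: "v \<in> topspace V"
  obtain L \<tau> where L: "(L, \<tau>) \<in> \<T>" "\<pi> v \<in> L"
    using trivialization_exists[OF projection_in_base[OF v]] .
  show ?thesis
    using fibre_coordinate_inject[OF L(1) v] scale(1,2)[OF v, of 1] scale(3)[OF v L, of 1] L by simp
qed

lemma scale_zero_vector: "v \<in> bundle_zeros V \<pi> \<T> \<Longrightarrow> scale c v = v"
proof -
  assume v0: "v \<in> bundle_zeros V \<pi> \<T>"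
  then have v: "v \<in> topspace V" by (simp add: bundle_zeros_def)
  obtain L \<tau> where L: "(L, \<tau>) \<in> \<T>" "\<pi> v \<in> L"
    using trivialization_exists[OF projection_in_base[OF v]] .
  then have "\<tau> v = (\<lambda>_. 0)"
    using v0 unfolding bundle_zeros_def by blast
  then show ?thesis
    using fibre_coordinate_inject[OF L(1) v] scale(1,2)[OF v, of c] scale(3)[OF v L, of c] L by simp
qed

lemma zero_vector_exists:
  assumes x: "x \<in> topspace M" obtains v where "v \<in> bundle_zeros V \<pi> \<T>" "\<pi> v = x"
proof -
  obtain L \<tau> where L: "(L, \<tau>) \<in> \<T>" "x \<in> L"
    using trivialization_exists[OF x] .
  have "(x, \<lambda>_. 0) \<in> topspace (prod_topology (subtopology M L) (Euclidean_space m))"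
    using x L by (simp add: topspace_Euclidean_space)
  then have "(x, \<lambda>_. 0) \<in> (\<lambda>v. (\<pi> v, \<tau> v)) ` topspace (subtopology V {v \<in> topspace V. \<pi> v \<in> L})"
    using homeomorphic_imp_surjective_map[OF trivialization(2)[OF L(1)]] by simp
  then obtain v where v: "v \<in> topspace V" "\<pi> v = x"
    by auto
  have "Q (scale 0 v) = 0" "scale 0 v \<in> topspace V" "\<pi> (scale 0 v) = x"
    using v norm_scale[OF v(1), of 0] scale(1,2)[OF v(1), of 0] by auto
  then show thesis
    using that norm_eq_0_iff by metis
qed

end

section \<open>Radial deformations of the tubular neighbourhood\<close>

abbreviation unit_interval :: "real topology" where "unit_interval \<equiv> top_of_set {0..1}"

definition core :: "('u, 'v, 'k) embedding_data \<Rightarrow> 'u set" where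
  "core \<Phi> = emap \<Phi> ` topspace (source \<Phi>)"

locale tubular_embedding =
  fixes ct :: "('u, 'k) cohomology" and \<Phi> :: "('u, 'v, 'k) embedding_data"
  assumes oriented: "oriented_proper_embedding ct \<Phi>"
begin

sublocale metric_vector_bundle "source_dim \<Phi>" "source \<Phi>" "source_atlas \<Phi>" "codim \<Phi>" "total \<Phi>"
    "bproj \<Phi>" "triv \<Phi>" "sqnorm \<Phi>"
  using oriented by unfold_locales (auto simp: oriented_proper_embedding_def Let_def smooth_manifold_def)

lemma core_embedding: "homeomorphic_map (source \<Phi>) (subtopology (target \<Phi>) (core \<Phi>)) (emap \<Phi>)"
  using oriented
  by (simp add: oriented_proper_embedding_def Let_def smooth_embedding_def embedding_map_def core_def)

lemma emap_continuous: "continuous_map (source \<Phi>) (target \<Phi>) (emap \<Phi>)"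
  using homeomorphic_imp_continuous_map[OF core_embedding] by (simp add: continuous_map_in_subtopology)

lemma core_closed: "closedin (target \<Phi>) (core \<Phi>)"
proof -
  have "proper_map (source \<Phi>) (target \<Phi>) (emap \<Phi>)"
    using oriented by (simp add: oriented_proper_embedding_def Let_def)
  then show ?thesis
    using proper_imp_closed_map by (fastforce simp: closed_map_def core_def)
qed

lemma tubular_homeomorphism:
  "homeomorphic_map (total \<Phi>) (subtopology (target \<Phi>) (tubular \<Phi> ` topspace (total \<Phi>))) (tubular \<Phi>)"
  and tubular_open: "openin (target \<Phi>) (tubular \<Phi> ` topspace (total \<Phi>))"
  and tubular_zero: "v \<in> bundle_zeros (total \<Phi>) (bproj \<Phi>) (triv \<Phi>) \<Longrightarrow> tubular \<Phi> v = emap \<Phi> (bproj \<Phi> v)"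
  using oriented
  by (simp_all add: oriented_proper_embedding_def Let_def smooth_embedding_def embedding_map_def)

lemma thom_in_carrier:
  "thom \<Phi> \<in> carrier (Grp ct (int (codim \<Phi>)) (subtopology (target \<Phi>) (tube \<Phi>)) (tube_boundary \<Phi>))"
  using oriented by (simp add: oriented_proper_embedding_def Let_def Thom_class_def)

lemma core_eq: "core \<Phi> = tubular \<Phi> ` {v \<in> topspace (total \<Phi>). sqnorm \<Phi> v = 0}" (is "_ = ?R")
proof
  show "core \<Phi> \<subseteq> ?R"
  proof
    fix y assume "y \<in> core \<Phi>"
    then obtain x where x: "x \<in> topspace (source \<Phi>)" "y = emap \<Phi> x" by (auto simp: core_def)
    obtain v where v: "v \<in> bundle_zeros (total \<Phi>) (bproj \<Phi>) (triv \<Phi>)" "bproj \<Phi> v = x"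
      using zero_vector_exists[OF x(1)] .
    then have "y = tubular \<Phi> v" "v \<in> topspace (total \<Phi>)"
      using tubular_zero x by (auto simp: bundle_zeros_def)
    then show "y \<in> ?R"
      using v norm_eq_0_iff by blast
  qed
  show "?R \<subseteq> core \<Phi>"
    using norm_eq_0_iff tubular_zero projection_in_base by (auto simp: core_def)
qed

definition coord :: "'u \<Rightarrow> 'v" where
  "coord = (SOME c. homeomorphic_maps (total \<Phi>)
     (subtopology (target \<Phi>) (tubular \<Phi> ` topspace (total \<Phi>))) (tubular \<Phi>) c)"

lemma coord: "homeomorphic_maps (total \<Phi>)
     (subtopology (target \<Phi>) (tubular \<Phi> ` topspace (total \<Phi>))) (tubular \<Phi>) coord"
  unfolding coord_def using tubular_homeomorphism by (rule someI_ex[OF iffD1[OF homeomorphic_map_maps]])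

lemma coord_tubular [simp]: "v \<in> topspace (total \<Phi>) \<Longrightarrow> coord (tubular \<Phi> v) = v"
  using coord by (simp add: homeomorphic_maps_def)

lemma tubular_continuous: "continuous_map (total \<Phi>) (target \<Phi>) (tubular \<Phi>)"
  using homeomorphic_imp_continuous_map[OF tubular_homeomorphism] by (simp add: continuous_map_in_subtopology)

lemma coord_continuous:
  "A \<subseteq> tubular \<Phi> ` topspace (total \<Phi>) \<Longrightarrow> continuous_map (subtopology (target \<Phi>) A) (total \<Phi>) coord"
  using coord continuous_map_from_subtopology_mono unfolding homeomorphic_maps_def by blast

lemma tubular_in_target: "v \<in> topspace (total \<Phi>) \<Longrightarrow> tubular \<Phi> v \<in> topspace (target \<Phi>)"
  using tubular_continuous by (auto simp: continuous_map_def)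

lemma tubular_eq_iff:
  "v \<in> topspace (total \<Phi>) \<Longrightarrow> w \<in> topspace (total \<Phi>) \<Longrightarrow> tubular \<Phi> v = tubular \<Phi> w \<longleftrightarrow> v = w"
  by (metis coord_tubular)

text \<open>
  Scaling is easy to follow on norms, so membership in the core, the tube and its boundary is
  expressed through the norm of the coordinate.
\<close>

lemma tubular_membership:
  assumes "v \<in> topspace (total \<Phi>)"
  shows "tubular \<Phi> v \<in> core \<Phi> \<longleftrightarrow> sqnorm \<Phi> v = 0" "tubular \<Phi> v \<in> tube \<Phi> \<longleftrightarrow> sqnorm \<Phi> v \<le> 1"
    "tubular \<Phi> v \<in> tube_boundary \<Phi> \<longleftrightarrow> sqnorm \<Phi> v = 1"
  using assms tubular_eq_iff
  by (auto simp: core_eq tube_def tube_boundary_def disk_bundle_def sphere_bundle_def image_iff)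

lemma tube_point:
  assumes "x \<in> tube \<Phi>" obtains v where "v \<in> topspace (total \<Phi>)" "x = tubular \<Phi> v" "sqnorm \<Phi> v \<le> 1"
  using assms by (auto simp: tube_def disk_bundle_def)

lemma tube_subset: "tube \<Phi> \<subseteq> topspace (target \<Phi>)" "tube \<Phi> \<subseteq> tubular \<Phi> ` topspace (total \<Phi>)"
  using tubular_in_target by (auto elim!: tube_point)

lemma boundary_subset: "tube_boundary \<Phi> \<subseteq> tube \<Phi> - core \<Phi>"
proof
  fix x assume "x \<in> tube_boundary \<Phi>"
  then obtain v where "v \<in> topspace (total \<Phi>)" "x = tubular \<Phi> v" "sqnorm \<Phi> v = 1"
    by (auto simp: tube_boundary_def sphere_bundle_def)
  then show "x \<in> tube \<Phi> - core \<Phi>"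
    using tubular_membership by auto
qed

lemma core_neighbourhood: obtains W where "openin (target \<Phi>) W" "core \<Phi> \<subseteq> W" "W \<subseteq> tube \<Phi>"
proof
  let ?V = "{v \<in> topspace (total \<Phi>). sqnorm \<Phi> v \<in> {..<1}}"
  let ?T = "tubular \<Phi> ` topspace (total \<Phi>)"
  have "openin (total \<Phi>) ?V"
    by (rule openin_continuous_map_preimage[OF norm_continuous]) simp
  then have "openin (subtopology (target \<Phi>) ?T) (tubular \<Phi> ` ?V)"
    using homeomorphic_imp_open_map[OF tubular_homeomorphism] by (simp add: open_map_def)
  then show "openin (target \<Phi>) (tubular \<Phi> ` ?V)"
    using tubular_open by (simp add: openin_open_subtopology)
  show "core \<Phi> \<subseteq> tubular \<Phi> ` ?V" "tubular \<Phi> ` ?V \<subseteq> tube \<Phi>"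
    by (auto simp: core_eq tube_def disk_bundle_def)
qed

lemma scaling_continuous:
  assumes A: "A \<subseteq> tubular \<Phi> ` topspace (total \<Phi>)" and c: "continuous_map X euclideanreal c"
    and f: "continuous_map X (subtopology (target \<Phi>) A) f"
  shows "continuous_map X (target \<Phi>) (\<lambda>x. tubular \<Phi> (scale (c x) (coord (f x))))"
proof -
  have "continuous_map X (prod_topology euclideanreal (total \<Phi>)) (\<lambda>x. (c x, coord (f x)))"
    using c continuous_map_compose2[OF coord_continuous[OF A] f] by (rule continuous_map_pairedI)
  then have "continuous_map X (total \<Phi>) (\<lambda>x. (\<lambda>(c, v). scale c v) (c x, coord (f x)))"
    by (rule continuous_map_compose2[OF scale_continuous])
  then show ?thesis
    using continuous_map_compose2[OF tubular_continuous] by simp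
qed

text \<open>
  The contraction of the disks to their centres. It is stationary on the core, which lets it be
  lifted below without moving arcs away from the preimage of the core.
\<close>

definition contraction :: "real \<times> 'u \<Rightarrow> 'u" where
  "contraction = (\<lambda>(t, x). tubular \<Phi> (scale (1 - t) (coord x)))"

lemma contraction_continuous:
  "continuous_map (prod_topology unit_interval (subtopology (target \<Phi>) (tube \<Phi>)))
     (subtopology (target \<Phi>) (tube \<Phi>)) contraction"
proof (rule continuous_map_into_subtopology)
  let ?X = "prod_topology unit_interval (subtopology (target \<Phi>) (tube \<Phi>))"
  have fst: "continuous_map ?X euclideanreal fst"
    using continuous_map_fst[of unit_interval] by (rule continuous_map_into_fulltopology)
  have "continuous_map ?X (target \<Phi>) (\<lambda>z. tubular \<Phi> (scale (1 - fst z) (coord (snd z))))"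
    by (rule scaling_continuous[OF tube_subset(2)]) (intro continuous_intros fst)+
  then show "continuous_map ?X (target \<Phi>) contraction"
    by (simp add: contraction_def case_prod_unfold)
  show "contraction \<in> topspace ?X \<rightarrow> tube \<Phi>"
  proof
    fix z assume z: "z \<in> topspace ?X"
    obtain t x where tx: "z = (t, x)" "0 \<le> t" "t \<le> 1" "x \<in> tube \<Phi>"
      using z by auto
    obtain v where v: "v \<in> topspace (total \<Phi>)" "x = tubular \<Phi> v" "sqnorm \<Phi> v \<le> 1"
      using tube_point[OF tx(4)] .
    have "(1 - t)\<^sup>2 * sqnorm \<Phi> v \<le> 1"
      using tx v norm_nonneg[OF v(1)] by (intro mult_le_one) (auto simp: power_le_one)
    then show "contraction z \<in> tube \<Phi>"
      using tx v scale(1)[OF v(1)] by (simp add: contraction_def tubular_membership norm_scale)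
  qed
qed

lemma contraction_start: "x \<in> tube \<Phi> \<Longrightarrow> contraction (0, x) = x"
  by (auto elim!: tube_point simp: contraction_def scale_1)

lemma contraction_end: "x \<in> tube \<Phi> \<Longrightarrow> contraction (1, x) \<in> core \<Phi>"
  by (auto elim!: tube_point simp: contraction_def tubular_membership norm_scale scale(1))

lemma contraction_core: "x \<in> core \<Phi> \<Longrightarrow> contraction (t, x) = x"
  by (auto simp: core_eq contraction_def norm_eq_0_iff scale_zero_vector)

definition radial :: "'u \<Rightarrow> 'u" where
  "radial x = tubular \<Phi> (scale (1 / sqrt (sqnorm \<Phi> (coord x))) (coord x))"

lemma punctured_point:
  assumes "x \<in> tube \<Phi> - core \<Phi>"
  obtains v where "v \<in> topspace (total \<Phi>)" "x = tubular \<Phi> v" "0 < sqnorm \<Phi> v" "sqnorm \<Phi> v \<le> 1"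
proof -
  obtain v where v: "v \<in> topspace (total \<Phi>)" "x = tubular \<Phi> v" "sqnorm \<Phi> v \<le> 1"
    using tube_point assms by blast
  then have "0 < sqnorm \<Phi> v"
    using assms norm_nonneg[OF v(1)] tubular_membership(1)[OF v(1)] by (auto simp: less_le)
  then show ?thesis using that v by blast
qed

lemma radial_homotopy:
  "homotopic_with (\<lambda>_. True) (subtopology (target \<Phi>) (tube \<Phi> - core \<Phi>))
     (subtopology (target \<Phi>) (tube \<Phi> - core \<Phi>)) radial id"
  and radial_continuous:
  "continuous_map (subtopology (target \<Phi>) (tube \<Phi> - core \<Phi>)) (subtopology (target \<Phi>) (tube_boundary \<Phi>)) radial"
proof -
  let ?A = "subtopology (target \<Phi>) (tube \<Phi> - core \<Phi>)"
  let ?X = "prod_topology unit_interval ?A"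
  let ?c = "\<lambda>z. (1 - fst z) / sqrt (sqnorm \<Phi> (coord (snd z))) + fst z"
  let ?h = "\<lambda>z. tubular \<Phi> (scale (?c z) (coord (snd z)))"
  have A: "tube \<Phi> - core \<Phi> \<subseteq> tubular \<Phi> ` topspace (total \<Phi>)"
    using tube_subset by auto
  have tA: "topspace ?A = tube \<Phi> - core \<Phi>"
    using tube_subset by auto
  have fst: "continuous_map ?X euclideanreal fst"
    using continuous_map_fst[of unit_interval] by (rule continuous_map_into_fulltopology)
  have norm: "continuous_map ?A euclideanreal (\<lambda>x. sqnorm \<Phi> (coord x))"
    by (rule continuous_map_compose2[OF norm_continuous coord_continuous[OF A]])
  have pos: "sqrt (sqnorm \<Phi> (coord x)) \<noteq> 0" if "x \<in> tube \<Phi> - core \<Phi>" for x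
    using punctured_point[OF that] by (metis coord_tubular less_irrefl real_sqrt_eq_0_iff)
  have c: "continuous_map ?X euclideanreal ?c"
    by (intro continuous_intros fst continuous_map_compose2[OF norm]) (use tA pos in auto)
  have h: "continuous_map ?X (target \<Phi>) ?h"
    by (rule scaling_continuous[OF A c continuous_map_snd])
  have in_A: "?h z \<in> tube \<Phi> - core \<Phi>" if z: "z \<in> topspace ?X" for z
  proof -
    obtain t x where tx: "z = (t, x)" "0 \<le> t" "t \<le> 1" "x \<in> tube \<Phi> - core \<Phi>"
      using z by auto
    obtain v where v: "v \<in> topspace (total \<Phi>)" "x = tubular \<Phi> v" "0 < sqnorm \<Phi> v" "sqnorm \<Phi> v \<le> 1"
      using punctured_point[OF tx(4)] .
    define s where "s = sqrt (sqnorm \<Phi> v)"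
    have s: "0 < s" "s \<le> 1" "sqnorm \<Phi> v = s\<^sup>2"
      using v by (auto simp: s_def)
    \<comment> \<open>The norm of the moving vector is a convex combination of \<open>1\<close> and \<open>s\<close>, so it stays in \<open>(0, 1]\<close>.\<close>
    have cs: "?c z * s = (1 - t) + t * s"
      using s v tx by (simp add: s_def[symmetric] field_simps)
    have "0 < (1 - t) + t * s"
      using tx s by (cases "t = 0") (auto intro: add_nonneg_pos)
    moreover have "(1 - t) + t * s \<le> 1"
      using tx s mult_left_le[of s t] by simp
    ultimately have "0 < (?c z * s)\<^sup>2" "(?c z * s)\<^sup>2 \<le> 1"
      unfolding cs by (auto simp: power_le_one)
    moreover have "sqnorm \<Phi> (scale (?c z) v) = (?c z * s)\<^sup>2"
      using norm_scale[OF v(1)] s by (simp add: power_mult_distrib)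
    ultimately show ?thesis
      using tx v scale(1)[OF v(1)] by (simp add: tubular_membership)
  qed
  have "homotopic_with (\<lambda>_. True) ?A ?A (\<lambda>x. ?h (0, x)) (\<lambda>x. ?h (1, x))"
    unfolding homotopic_with_def using continuous_map_into_subtopology[OF h] in_A by blast
  moreover have "?h (1, x) = id x" if "x \<in> topspace ?A" for x
    using that unfolding tA by (auto elim!: tube_point simp: scale_1)
  ultimately show "homotopic_with (\<lambda>_. True) ?A ?A radial id"
    by (elim homotopic_with_eq) (auto simp: radial_def)
  show "continuous_map ?A (subtopology (target \<Phi>) (tube_boundary \<Phi>)) radial"
  proof (rule continuous_map_into_subtopology)
    show "continuous_map ?A (target \<Phi>) radial"
      unfolding radial_def
      by (intro scaling_continuous[OF A] continuous_intros norm) (use tA pos in auto)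
    show "radial \<in> topspace ?A \<rightarrow> tube_boundary \<Phi>"
    proof
      fix x assume "x \<in> topspace ?A"
      then obtain v where v: "v \<in> topspace (total \<Phi>)" "x = tubular \<Phi> v" "0 < sqnorm \<Phi> v"
        using punctured_point tA by metis
      then show "radial x \<in> tube_boundary \<Phi>"
        using scale(1)[OF v(1)]
        by (simp add: radial_def tubular_membership norm_scale power_divide)
    qed
  qed
qed

lemma radial_boundary: "x \<in> tube_boundary \<Phi> \<Longrightarrow> radial x = x"
  by (auto simp: tube_boundary_def sphere_bundle_def radial_def scale_1)

end

locale multiplicative_tubular_embedding =
  tubular_embedding ct \<Phi> + multiplicative_cohomology_theory ct
  for ct :: "('u, 'k) cohomology" and \<Phi> :: "('u, 'v, 'k) embedding_data"
begin

text \<open>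
  The boundary of the tube is a deformation retract of the punctured tube, so
  \<open>relative_restriction_surj\<close> replaces the boundary by the punctured tube, and excision passes from the
  tube to all of \<open>B\<close>. Products with pull-backs of the Thom class extend through pull-backs of this
  extension.
\<close>

lemma thom_extends:
  obtains u' where "u' \<in> carrier (Grp ct (int (codim \<Phi>)) (target \<Phi>) (topspace (target \<Phi>) - core \<Phi>))"
    "Ind ct (int (codim \<Phi>)) (subtopology (target \<Phi>) (tube \<Phi>)) (tube_boundary \<Phi>)
       (target \<Phi>) (topspace (target \<Phi>) - core \<Phi>) id u' = thom \<Phi>"
proof -
  let ?m = "int (codim \<Phi>)" and ?B = "target \<Phi>" and ?N = "tube \<Phi>" and ?dN = "tube_boundary \<Phi>"
  let ?BN = "subtopology ?B ?N" and ?A = "tube \<Phi> - core \<Phi>"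
  have subA: "subtopology ?BN ?A = subtopology ?B ?A" and subd: "subtopology ?BN ?dN = subtopology ?B ?dN"
    using boundary_subset by (auto simp: subtopology_subtopology intro!: arg_cong[where f = "subtopology ?B"])
  have tBN: "topspace ?BN = ?N" using tube_subset by auto
  have i: "continuous_map (subtopology ?B ?dN) (subtopology ?B ?A) id"
    using boundary_subset by (auto simp: continuous_map_in_subtopology continuous_map_from_subtopology)
  have "homotopic_with (\<lambda>_. True) (subtopology ?B ?dN) (subtopology ?B ?dN) (radial \<circ> id) id"
    using radial_boundary continuous_map_compose[OF i radial_continuous]
    by (intro homotopic_with_equal) auto
  then have surj: "pull ct n (subtopology ?B ?dN) (subtopology ?B ?A) id ` carrier (coh ct n (subtopology ?B ?A))
      = carrier (coh ct n (subtopology ?B ?dN))" for n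
    by (rule homotopy_retract_surj[OF i radial_continuous])
  have inj: "inj_on (pull ct n (subtopology ?B ?dN) (subtopology ?B ?A) id) (carrier (coh ct n (subtopology ?B ?A)))" for n
    by (rule homotopy_section_inj[OF i radial_continuous]) (use radial_homotopy in simp)
  have "thom \<Phi> \<in> Ind ct ?m ?BN ?dN ?BN ?A id ` carrier (Grp ct ?m ?BN ?A)"
    by (rule relative_restriction_surj)
      (use boundary_subset thom_in_carrier inj surj tBN subA subd in auto)
  then obtain w where w: "w \<in> carrier (Grp ct ?m ?BN ?A)" "thom \<Phi> = Ind ct ?m ?BN ?dN ?BN ?A id w"
    by blast
  obtain W where W: "openin ?B W" "core \<Phi> \<subseteq> W" "W \<subseteq> ?N"
    using core_neighbourhood .
  have "bij_betw (Ind ct ?m ?BN ?A ?B (topspace ?B - core \<Phi>) id)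
      (carrier (Grp ct ?m ?B (topspace ?B - core \<Phi>))) (carrier (Grp ct ?m ?BN ?A))"
    by (rule excision_of_neighbourhood[OF core_closed tube_subset(1) W])
  then obtain u' where u': "u' \<in> carrier (Grp ct ?m ?B (topspace ?B - core \<Phi>))"
      "w = Ind ct ?m ?BN ?A ?B (topspace ?B - core \<Phi>) id u'"
    using w(1) unfolding bij_betw_def by blast
  have pm: "pair_map ?BN ?dN ?BN ?A id" "pair_map ?BN ?A ?B (topspace ?B - core \<Phi>) id"
    using boundary_subset tBN tube_subset by (auto simp: pair_map_def continuous_map_from_subtopology)
  have "Ind ct ?m ?BN ?dN ?B (topspace ?B - core \<Phi>) id u' = thom \<Phi>"
    unfolding w(2) u'(2) by (rule ind_factor[OF pm _ u'(1)]) simp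
  with u'(1) show thesis by (rule that)
qed

text \<open>
  Being defined on all of \<open>B\<close>, the extension can be compared along homotopies that leave the core.
\<close>

lemma euler_extends:
  obtains t where "t \<in> carrier (coh ct (int (codim \<Phi>)) (target \<Phi>))"
    "Euler_class ct \<Phi> = pull ct (int (codim \<Phi>)) (source \<Phi>) (target \<Phi>) (emap \<Phi>) t"
proof -
  let ?m = "int (codim \<Phi>)" and ?B = "target \<Phi>" and ?N = "tube \<Phi>" and ?dN = "tube_boundary \<Phi>"
  let ?BM = "topspace ?B - core \<Phi>" and ?BN = "subtopology ?B ?N"
  obtain u' where u': "u' \<in> carrier (Grp ct ?m ?B ?BM)" "Ind ct ?m ?BN ?dN ?B ?BM id u' = thom \<Phi>"
    using thom_extends .
  obtain W where W: "openin ?B W" "core \<Phi> \<subseteq> W" "W \<subseteq> ?N"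
    using core_neighbourhood .
  have p0: "pair_map ?B {} ?B ?BM id" by auto
  have p1: "pair_map (source \<Phi>) {} ?B {} (emap \<Phi>)" using emap_continuous by auto
  have p2: "pair_map (source \<Phi>) {} ?BN ?dN (emap \<Phi>)"
    using emap_continuous W boundary_subset tube_subset by (auto simp: continuous_map_in_subtopology core_def)
  have p3: "pair_map ?BN ?dN ?B ?BM id"
    using boundary_subset tube_subset by (auto simp: pair_map_def continuous_map_from_subtopology)
  have "Euler_class ct \<Phi> = Ind ct ?m (source \<Phi>) {} ?B ?BM (emap \<Phi>) u'"
    unfolding Euler_class_def u'(2)[symmetric] by (rule ind_factor[symmetric, OF p2 p3 _ u'(1)]) simp
  also have "\<dots> = pull ct ?m (source \<Phi>) ?B (emap \<Phi>) (Ind ct ?m ?B {} ?B ?BM id u')"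
    by (rule ind_factor[OF p1 p0 _ u'(1)]) simp
  finally show thesis
    using that ind_closed[OF p0 u'(1)] by blast
qed

lemma euler_in_carrier: "Euler_class ct \<Phi> \<in> carrier (coh ct (int (codim \<Phi>)) (source \<Phi>))"
  using euler_extends pull_closed[OF emap_continuous] by metis

text \<open>
  The self-intersection formula: restricting the shriek of \<open>y\<close> back along \<open>\<psi>\<close> multiplies \<open>y\<close> by the
  Euler class. The two inverses in the definition of the shriek map return some class \<open>v\<close> restricting
  to \<open>y\<close>, and some class of \<open>(X, X - Mt)\<close> restricting to \<open>v \<union> ut\<close>. Once such classes exist the choice
  is irrelevant, because the restriction to \<open>Y\<close> factors through \<open>y\<close> and the restriction of the Thom class.
\<close>

lemma pull_shriek:
  assumes P: "continuous_map X (target \<Phi>) P"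
    and \<psi>: "continuous_map Y (subtopology X {z \<in> topspace X. P z \<in> tube \<Phi>}) \<psi>"
    and r: "continuous_map Y (source \<Phi>) r" and Pr: "\<And>z. z \<in> topspace Y \<Longrightarrow> P (\<psi> z) = emap \<Phi> (r z)"
    and y: "y \<in> pull ct k Y (subtopology X {z \<in> topspace X. P z \<in> tube \<Phi>}) \<psi>
      ` carrier (coh ct k (subtopology X {z \<in> topspace X. P z \<in> tube \<Phi>}))"
  shows "shriek ct \<Phi> k Y X \<psi> P y \<in> carrier (coh ct (k + int (codim \<Phi>)) X)"
    and "pull ct (k + int (codim \<Phi>)) Y X \<psi> (shriek ct \<Phi> k Y X \<psi> P y)
      = cup ct k (int (codim \<Phi>)) Y y (pull ct (int (codim \<Phi>)) Y (source \<Phi>) r (Euler_class ct \<Phi>))"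
proof -
  let ?m = "int (codim \<Phi>)"
  define B N dN M where "B = target \<Phi>" and "N = tube \<Phi>" and "dN = tube_boundary \<Phi>" and "M = core \<Phi>"
  note defs = B_def N_def dN_def M_def
  obtain u' where u': "u' \<in> carrier (Grp ct ?m B (topspace B - M))"
      "Ind ct ?m (subtopology B N) dN B (topspace B - M) id u' = thom \<Phi>"
    using thom_extends unfolding defs .
  obtain V where V: "openin B V" "M \<subseteq> V" "V \<subseteq> N"
    using core_neighbourhood unfolding defs .
  have M: "closedin B M" and N: "N \<subseteq> topspace B" and dN: "dN \<subseteq> N - M"
    and thom: "thom \<Phi> \<in> carrier (Grp ct ?m (subtopology B N) dN)"
    and emap: "continuous_map (source \<Phi>) B (emap \<Phi>)"
    unfolding defs by (rule core_closed tube_subset boundary_subset thom_in_carrier emap_continuous)+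
  note P = P[folded defs] and \<psi> = \<psi>[folded defs] and y = y[folded defs]
  define Mt where "Mt = {z \<in> topspace X. P z \<in> M}"
  define Nt where "Nt = {z \<in> topspace X. P z \<in> N}"
  define dNt where "dNt = {z \<in> topspace X. P z \<in> dN}"
  let ?XN = "subtopology X Nt" and ?BN = "subtopology B N"
  let ?rel = "Ind ct (k + ?m) ?XN dNt X (topspace X - Mt) id"
  define ut where "ut = Ind ct ?m ?XN dNt ?BN dN P (thom \<Phi>)"
  define v where "v = inv_into (carrier (coh ct k ?XN)) (pull ct k Y ?XN \<psi>) y"
  define c where "c = Cup ct k ?m ?XN {} dNt v ut"
  define z where "z = inv_into (carrier (Grp ct (k + ?m) X (topspace X - Mt))) ?rel c"
  have shriek: "shriek ct \<Phi> k Y X \<psi> P y = Ind ct (k + ?m) X {} X (topspace X - Mt) id z"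
    by (simp add: shriek_def Let_def z_def c_def v_def ut_def Mt_def Nt_def dNt_def defs core_def)
  have v: "v \<in> carrier (coh ct k ?XN)" and vy: "pull ct k Y ?XN \<psi> v = y"
    using y unfolding v_def Nt_def by (auto intro: inv_into_into f_inv_into_f)
  have tNt: "topspace ?XN = Nt" and tBN: "topspace ?BN = N"
    using N by (auto simp: Nt_def)
  have PNB: "continuous_map ?XN ?BN P"
    using P by (auto simp: Nt_def continuous_map_in_subtopology continuous_map_from_subtopology)
  have pmN: "pair_map ?XN dNt ?BN dN P"
    using PNB dN tNt tBN by (auto simp: pair_map_def dNt_def Nt_def)
  have pmB: "pair_map ?BN dN B (topspace B - M) id"
    using dN N tBN by (auto simp: pair_map_def continuous_map_from_subtopology)
  have pmI: "pair_map ?XN dNt ?XN (Nt - Mt) id"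
    using dN tNt by (auto simp: pair_map_def dNt_def Nt_def Mt_def)
  have pmX: "pair_map ?XN (Nt - Mt) X (topspace X - Mt) id"
    using tNt by (auto simp: pair_map_def Nt_def continuous_map_from_subtopology)
  have pmXd: "pair_map ?XN dNt X (topspace X - Mt) id"
    using dN tNt by (auto simp: pair_map_def Nt_def dNt_def Mt_def continuous_map_from_subtopology)
  have pmNB: "pair_map ?XN (Nt - Mt) B (topspace B - M) P"
    using P tNt N by (auto simp: pair_map_def Nt_def Mt_def continuous_map_from_subtopology)
  have dNt: "dNt \<subseteq> Nt" and ut: "ut \<in> carrier (Grp ct ?m ?XN dNt)"
    using pmI tNt ind_closed[OF pmN thom] by (auto simp: pair_map_def ut_def)
  have "dNt \<subseteq> topspace ?XN" using dNt tNt by simp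
  then have c: "c \<in> carrier (Grp ct (k + ?m) ?XN dNt)"
    using cup_closed[of ?XN "{}" dNt v k ut ?m] v ut by (simp add: c_def)
  \<comment> \<open>The class \<open>c\<close> is the restriction of the product of \<open>v\<close> with the pull-back of \<open>u'\<close>, and that product
    extends to \<open>(X, X - Mt)\<close> by excision.\<close>
  have "c \<in> ?rel ` carrier (Grp ct (k + ?m) X (topspace X - Mt))"
  proof -
    define w where "w = Ind ct ?m ?XN (Nt - Mt) B (topspace B - M) P u'"
    have w: "w \<in> carrier (Grp ct ?m ?XN (Nt - Mt))"
      unfolding w_def by (rule ind_closed[OF pmNB u'(1)])
    have "ut = Ind ct ?m ?XN dNt B (topspace B - M) P u'"
      unfolding ut_def u'(2)[symmetric] by (rule ind_factor[symmetric, OF pmN pmB _ u'(1)]) simp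
    also have "\<dots> = Ind ct ?m ?XN dNt ?XN (Nt - Mt) id w"
      unfolding w_def by (rule ind_factor[OF pmI pmNB _ u'(1)]) simp
    finally have utw: "ut = Ind ct ?m ?XN dNt ?XN (Nt - Mt) id w" .
    define d where "d = Cup ct k ?m ?XN {} (Nt - Mt) v w"
    have d: "d \<in> carrier (Grp ct (k + ?m) ?XN (Nt - Mt))"
      using cup_closed[of ?XN "{}" "Nt - Mt" v k w ?m] v w tNt by (auto simp: d_def)
    have "Ind ct (k + ?m) ?XN ({} \<union> dNt) ?XN ({} \<union> (Nt - Mt)) id d
        = Cup ct k ?m ?XN {} dNt (pull ct k ?XN ?XN id v) (Ind ct ?m ?XN dNt ?XN (Nt - Mt) id w)"
      unfolding d_def by (rule cup_natural) (use dNt pmI v w tNt in auto)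
    then have cd: "Ind ct (k + ?m) ?XN dNt ?XN (Nt - Mt) id d = c"
      using v by (simp add: c_def utw ind_id)
    have "bij_betw (Ind ct (k + ?m) ?XN (Nt - Mt) X (topspace X - Mt) id)
        (carrier (Grp ct (k + ?m) X (topspace X - Mt))) (carrier (Grp ct (k + ?m) ?XN (Nt - Mt)))"
    proof (rule excision_of_neighbourhood)
      show "closedin X Mt"
        using closedin_continuous_map_preimage[OF P M] by (simp add: Mt_def)
      show "openin X {z \<in> topspace X. P z \<in> V}"
        using openin_continuous_map_preimage[OF P V(1)] .
    qed (use V in \<open>auto simp: Mt_def Nt_def\<close>)
    then obtain z' where z': "z' \<in> carrier (Grp ct (k + ?m) X (topspace X - Mt))"
        and dz': "d = Ind ct (k + ?m) ?XN (Nt - Mt) X (topspace X - Mt) id z'"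
      using d unfolding bij_betw_def by blast
    have "c = ?rel z'"
      unfolding cd[symmetric] dz' by (rule ind_factor[symmetric, OF pmI pmX _ z']) simp
    then show ?thesis
      using z' by blast
  qed
  then have z: "z \<in> carrier (Grp ct (k + ?m) X (topspace X - Mt))" and zc: "?rel z = c"
    unfolding z_def by (auto intro: inv_into_into f_inv_into_f)
  have pm0: "pair_map X {} X (topspace X - Mt) id"
    by auto
  show "shriek ct \<Phi> k Y X \<psi> P y \<in> carrier (coh ct (k + ?m) X)"
    unfolding shriek by (rule ind_closed[OF pm0 z])
  have \<psi>': "pair_map Y {} ?XN dNt \<psi>" "pair_map Y {} ?XN {} \<psi>"
    using \<psi> dNt tNt by (auto simp: Nt_def)
  have \<psi>X: "pair_map Y {} X {} \<psi>"
    using \<psi> by (auto simp: continuous_map_in_subtopology)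
  have \<psi>d: "pair_map Y {} X (topspace X - Mt) \<psi>"
    using \<psi>X by auto
  have eM: "pair_map (source \<Phi>) {} ?BN dN (emap \<Phi>)"
    using emap dN V tBN by (auto simp: continuous_map_in_subtopology M_def core_def)
  have e: "Euler_class ct \<Phi> = Ind ct ?m (source \<Phi>) {} ?BN dN (emap \<Phi>) (thom \<Phi>)"
    by (simp add: Euler_class_def defs)
  have "pull ct (k + ?m) Y X \<psi> (shriek ct \<Phi> k Y X \<psi> P y) = Ind ct (k + ?m) Y {} X (topspace X - Mt) \<psi> z"
    unfolding shriek by (rule ind_factor[symmetric, OF \<psi>X pm0 _ z]) simp
  also have "\<dots> = Ind ct (k + ?m) Y {} ?XN dNt \<psi> c"
    unfolding zc[symmetric] by (rule ind_factor[OF \<psi>'(1) pmXd _ z]) simp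
  also have "\<dots> = cup ct k ?m Y (pull ct k Y ?XN \<psi> v) (Ind ct ?m Y {} ?XN dNt \<psi> ut)"
    using cup_natural[of Y "{}" "{}" ?XN "{}" dNt \<psi> v k ut ?m] v ut \<psi>' dNt tNt
    by (auto simp: c_def)
  also have "Ind ct ?m Y {} ?XN dNt \<psi> ut = Ind ct ?m Y {} ?BN dN (emap \<Phi> \<circ> r) (thom \<Phi>)"
    unfolding ut_def using Pr by (intro ind_factor[symmetric, OF \<psi>'(1) pmN _ thom]) auto
  also have "\<dots> = pull ct ?m Y (source \<Phi>) r (Euler_class ct \<Phi>)"
    unfolding e using r by (intro ind_factor[OF _ eM _ thom]) auto
  finally show "pull ct (k + ?m) Y X \<psi> (shriek ct \<Phi> k Y X \<psi> P y)
      = cup ct k ?m Y y (pull ct ?m Y (source \<Phi>) r (Euler_class ct \<Phi>))"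
    by (simp only: vy)
qed

end

section \<open>Path spaces and homotopy fibre products\<close>

lemma topspace_path_space [simp]: "topspace (path_space E) = paths E"
proof -
  have "paths E \<in> {{w \<in> paths E. w ` K \<subseteq> U} | K U. compact K \<and> K \<subseteq> {0..1} \<and> openin E U}"
    by (rule CollectI, rule exI[where x = "{}"], rule exI[where x = "{}"]) auto
  then show ?thesis
    unfolding path_space_def topology_generated_by_topspace by blast
qed

lemma path_space_subbasic:
  "compact K \<Longrightarrow> K \<subseteq> {0..1} \<Longrightarrow> openin E U \<Longrightarrow> openin (path_space E) {w \<in> paths E. w ` K \<subseteq> U}"
  unfolding path_space_def by (rule topology_generated_by_Basis) blast

text \<open>
  The interval is locally compact: a path that maps \<open>t\<close> into \<open>U\<close> maps a small closed interval around \<open>t\<close>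
  into \<open>U\<close>, which is a subbasic open condition on paths.
\<close>

lemma path_evaluation_continuous:
  "continuous_map (prod_topology (path_space E) unit_interval) E (\<lambda>(w, t). w t)"
  unfolding continuous_map_def
proof (intro conjI allI impI)
  show "(\<lambda>(w, t). w t) \<in> topspace (prod_topology (path_space E) unit_interval) \<rightarrow> topspace E"
    by (auto simp: paths_def pathin_def continuous_map_def)
  fix U assume U: "openin E U"
  show "openin (prod_topology (path_space E) unit_interval)
      {x \<in> topspace (prod_topology (path_space E) unit_interval). (\<lambda>(w, t). w t) x \<in> U}" (is "openin ?P ?S")
  proof (subst openin_subopen, clarify)
    fix w t assume "(w, t) \<in> topspace ?P" and wt: "w t \<in> U"
    then have w: "w \<in> paths E" and t: "t \<in> {0..1}" by auto
    have "openin unit_interval {s \<in> topspace unit_interval. w s \<in> U}"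
      using w U by (intro openin_continuous_map_preimage) (auto simp: paths_def pathin_def)
    then obtain e where e: "e > 0" "\<And>s. s \<in> {0..1} \<Longrightarrow> dist s t < e \<Longrightarrow> w s \<in> U"
      using t wt unfolding openin_euclidean_subtopology_iff by (auto simp: dist_commute)
    let ?K = "cball t (e/2) \<inter> {0..1}" and ?J = "ball t (e/2) \<inter> {0..1}"
    let ?W = "{w \<in> paths E. w ` ?K \<subseteq> U}"
    have W: "openin (path_space E) ?W"
      by (rule path_space_subbasic[OF _ _ U]) (auto intro: compact_Int)
    have J: "openin unit_interval ?J"
      by (auto simp: openin_open)
    have "w s \<in> U" if "s \<in> ?K" for s
      using e(1) that by (intro e(2)) (simp_all add: dist_commute)
    then have "(w, t) \<in> ?W \<times> ?J"
      using w t e(1) by (simp add: image_subset_iff)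
    moreover have "v s \<in> U" if "v \<in> ?W" "s \<in> ?J" for v s
    proof -
      have "s \<in> ?K" using that(2) by simp
      then show ?thesis using that(1) by blast
    qed
    then have "?W \<times> ?J \<subseteq> ?S"
      by auto
    ultimately show "\<exists>T. openin ?P T \<and> (w, t) \<in> T \<and> T \<subseteq> ?S"
      using W J by (intro exI[where x = "?W \<times> ?J"]) (simp add: openin_prod_Times_iff)
  qed
qed

text \<open>
  If all of \<open>{z} \<times> K\<close> is mapped into \<open>U\<close>, the tube lemma for the compact set \<open>K\<close> extends this to the
  points near \<open>z\<close>.
\<close>

lemma adjoint_path_continuous:
  assumes h: "continuous_map (prod_topology Z unit_interval) E h"
  shows "continuous_map Z (path_space E) (\<lambda>z. \<lambda>t\<in>{0..1}. h (z, t))"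
  unfolding path_space_def
proof (rule continuous_on_generated_topo)
  have paths: "(\<lambda>t\<in>{0..1}. h (z, t)) \<in> paths E" if "z \<in> topspace Z" for z
  proof -
    have "continuous_map unit_interval E (\<lambda>t. h (z, t))"
      using that by (intro continuous_map_compose2[OF h] continuous_intros) auto
    then have "continuous_map unit_interval E (\<lambda>t\<in>{0..1}. h (z, t))"
      by (rule continuous_map_eq) simp
    then show ?thesis
      by (simp add: paths_def pathin_def)
  qed
  show "(\<lambda>z. \<lambda>t\<in>{0..1}. h (z, t)) ` topspace Z
      \<subseteq> \<Union>{{w \<in> paths E. w ` K \<subseteq> U} |K U. compact K \<and> K \<subseteq> {0..1} \<and> openin E U}"
    using paths topspace_path_space[of E] unfolding path_space_def topology_generated_by_topspace by blast
  fix V assume "V \<in> {{w \<in> paths E. w ` K \<subseteq> U} |K U. compact K \<and> K \<subseteq> {0..1} \<and> openin E U}"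
  then obtain K U where KU: "V = {w \<in> paths E. w ` K \<subseteq> U}" "compact K" "K \<subseteq> {0..1}" "openin E U"
    by blast
  let ?W = "{x \<in> topspace (prod_topology Z unit_interval). h x \<in> U}"
  have W: "openin (prod_topology Z unit_interval) ?W"
    by (rule openin_continuous_map_preimage[OF h KU(4)])
  have K: "compactin unit_interval K"
    using KU by (simp add: compactin_subtopology)
  show "openin Z ((\<lambda>z. \<lambda>t\<in>{0..1}. h (z, t)) -` V \<inter> topspace Z)" (is "openin Z ?S")
  proof (subst openin_subopen, clarify)
    fix z assume z: "z \<in> topspace Z" and zV: "(\<lambda>t\<in>{0..1}. h (z, t)) \<in> V"
    have "{z} \<times> K \<subseteq> ?W"
      using z zV KU by (auto simp: image_subset_iff subset_iff)
    from tube_lemma_right[OF W K z this] obtain A J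
      where AJ: "openin Z A" "z \<in> A" "K \<subseteq> J" "A \<times> J \<subseteq> ?W" by blast
    have "A \<subseteq> ?S"
      using AJ openin_subset[OF AJ(1)] paths KU by (auto simp: subset_iff)
    then show "\<exists>T. openin Z T \<and> z \<in> T \<and> T \<subseteq> ?S"
      using AJ by blast
  qed
qed

context
  fixes F :: "'x point topology" and f :: "'x point \<Rightarrow> 'x point" and E :: "'x point topology"
    and g :: "'x point \<Rightarrow> 'x point" and G :: "'x point topology"
begin

lemma in_hfp_iff:
  "z \<in> topspace (hfp F f E g G) \<longleftrightarrow>
     z = Arc (start z) (track z) (finish z) \<and> start z \<in> topspace F \<and> finish z \<in> topspace G \<and>
     track z \<in> paths E \<and> f (start z) = track z 0 \<and> g (finish z) = track z 1"
  by (cases z) (auto simp: hfp_def topspace_pullback_topology)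

lemma hfp_projections_continuous:
  "continuous_map (hfp F f E g G) F start" "continuous_map (hfp F f E g G) G finish"
  "continuous_map (hfp F f E g G) (path_space E) track"
proof -
  let ?T = "\<lambda>z :: 'x point. (start z, track z, finish z)"
  let ?P = "prod_topology F (prod_topology (path_space E) G)"
  have *: "continuous_map ?P Y r \<Longrightarrow> continuous_map (hfp F f E g G) Y (r \<circ> ?T)" for Y :: "'b topology" and r
    unfolding hfp_def by (rule continuous_map_pullback)
  show "continuous_map (hfp F f E g G) F start"
    using *[OF continuous_map_fst] by (simp add: o_def)
  show "continuous_map (hfp F f E g G) G finish"
    using *[OF continuous_map_compose2[OF continuous_map_snd continuous_map_snd]] by (simp add: o_def)
  show "continuous_map (hfp F f E g G) (path_space E) track"
    using *[OF continuous_map_compose2[OF continuous_map_fst continuous_map_snd]] by (simp add: o_def)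
qed

lemma track_continuous:
  assumes "continuous_map Z (hfp F f E g G) u" "continuous_map Z unit_interval s"
  shows "continuous_map Z E (\<lambda>z. track (u z) (s z))"
proof -
  have "continuous_map Z (prod_topology (path_space E) unit_interval) (\<lambda>z. (track (u z), s z))"
    by (intro continuous_map_pairedI continuous_map_compose2[OF hfp_projections_continuous(3)] assms)
  then show ?thesis
    using continuous_map_compose2[OF path_evaluation_continuous] by fastforce
qed

text \<open>
  Maps into spaces of arcs are constructed through this lemma, from a family of paths that is
  continuous as a function of two variables.
\<close>

lemma into_hfp_continuous:
  assumes a: "continuous_map Z F a" and b: "continuous_map Z G b"
    and h: "continuous_map (prod_topology Z unit_interval) E (\<lambda>(z, t). h z t)"
    and ends: "\<And>z. z \<in> topspace Z \<Longrightarrow> f (a z) = h z 0" "\<And>z. z \<in> topspace Z \<Longrightarrow> g (b z) = h z 1"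
  shows "continuous_map Z (hfp F f E g G) (\<lambda>z. Arc (a z) (\<lambda>t\<in>{0..1}. h z t) (b z))"
proof -
  have w: "continuous_map Z (path_space E) (\<lambda>z. \<lambda>t\<in>{0..1}. h z t)"
    using adjoint_path_continuous[OF h] by simp
  have "continuous_map Z (prod_topology F (prod_topology (path_space E) G))
      ((\<lambda>z. (start z, track z, finish z)) \<circ> (\<lambda>z. Arc (a z) (\<lambda>t\<in>{0..1}. h z t) (b z)))"
    using continuous_map_pairedI[OF a continuous_map_pairedI[OF w b]] by (simp add: o_def)
  then show ?thesis
    unfolding hfp_def
  proof (rule continuous_map_pullback')
    have "a z \<in> topspace F" "b z \<in> topspace G" "(\<lambda>t\<in>{0..1}. h z t) \<in> paths E" if "z \<in> topspace Z" for z
      using that a b continuous_map_image_subset_topspace[OF w] by (auto simp: continuous_map_def)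
    then show "topspace Z \<subseteq> (\<lambda>z. Arc (a z) (restrict (h z) {0..1}) (b z)) -`
        {Arc a w b |a w b. a \<in> topspace F \<and> w \<in> paths E \<and> b \<in> topspace G \<and> f a = w 0 \<and> g b = w 1}"
      using ends by auto
  qed
qed

lemma hfp_point_eq:
  "z \<in> topspace (hfp F f E g G) \<Longrightarrow> Arc (start z) (\<lambda>t\<in>{0..1}. track z t) (finish z) = z"
  by (cases z) (auto simp: in_hfp_iff paths_def extensional_restrict)

end

lemma const_arc_continuous:
  assumes g: "continuous_map G E g" shows "continuous_map G (hfp G g E g G) (const_arc g)"
proof -
  have "continuous_map G (hfp G g E g G) (\<lambda>b. Arc b (\<lambda>t\<in>{0..1}. g b) b)"
    by (rule into_hfp_continuous) (use continuous_map_compose2[OF g continuous_map_fst] in \<open>simp_all add: case_prod_unfold\<close>)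
  then show ?thesis
    by (simp add: const_arc_def[abs_def])
qed

lemma prod_space_projections_continuous:
  "continuous_map (prod_space X Y) X left" "continuous_map (prod_space X Y) Y right"
proof -
  have *: "continuous_map (prod_topology X Y) W r \<Longrightarrow> continuous_map (prod_space X Y) W (r \<circ> (\<lambda>z. (left z, right z)))"
    for W :: "'b topology" and r
    unfolding prod_space_def by (rule continuous_map_pullback)
  show "continuous_map (prod_space X Y) X left" "continuous_map (prod_space X Y) Y right"
    using *[OF continuous_map_fst] *[OF continuous_map_snd] by (simp_all add: o_def)
qed

lemma in_prod_space_iff:
  "z \<in> topspace (prod_space X Y) \<longleftrightarrow> z = Pair (left z) (right z) \<and> left z \<in> topspace X \<and> right z \<in> topspace Y"
  by (cases z) (auto simp: prod_space_def topspace_pullback_topology)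

lemma into_prod_space_continuous:
  assumes "continuous_map Z X u" "continuous_map Z Y v"
  shows "continuous_map Z (prod_space X Y) (\<lambda>z. Pair (u z) (v z))"
  unfolding prod_space_def
  by (rule continuous_map_pullback')
    (use assms continuous_map_pairedI[OF assms] in \<open>auto simp: o_def continuous_map_def\<close>)

lemma in_composable_iff:
  "z \<in> topspace (composable X Y) \<longleftrightarrow> z = Pair (left z) (right z) \<and> left z \<in> topspace X \<and> right z \<in> topspace Y
     \<and> finish (left z) = start (right z)"
  by (auto simp: composable_def in_prod_space_iff)

lemma composable_projections_continuous:
  "continuous_map (composable X Y) X left" "continuous_map (composable X Y) Y right"
  by (simp_all add: composable_def prod_space_projections_continuous continuous_map_from_subtopology)

lemma into_composable_continuous:
  assumes "continuous_map Z X u" "continuous_map Z Y v" "\<And>z. z \<in> topspace Z \<Longrightarrow> finish (u z) = start (v z)"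
  shows "continuous_map Z (composable X Y) (\<lambda>z. Pair (u z) (v z))"
  unfolding composable_def
  by (rule continuous_map_into_subtopology) (use assms into_prod_space_continuous in auto)

lemma clamped_into_interval:
  assumes "continuous_map X euclideanreal s"
  shows "continuous_map X unit_interval (\<lambda>x. max 0 (min 1 (s x)))"
  by (intro continuous_map_into_subtopology continuous_intros assms) auto

lemma time_continuous: "continuous_map (prod_topology Z unit_interval) euclideanreal snd"
  "continuous_map (prod_topology unit_interval Z) euclideanreal fst"
  by (rule continuous_map_into_fulltopology[OF continuous_map_snd] continuous_map_into_fulltopology[OF continuous_map_fst])+

text \<open>
  Clamping the time extends both halves of a concatenation to the whole interval, so that they can
  be pasted as maps on the same space.
\<close>

lemma concat_arc_continuous:
  fixes f g h :: "'x point \<Rightarrow> 'x point"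
  shows "continuous_map (composable (hfp F f E g G) (hfp G g E h H)) (hfp F f E h H) concat_arc"
proof -
  let ?Y = "composable (hfp F f E g G) (hfp G g E h H)"
  let ?P = "prod_topology ?Y unit_interval"
  note Y = composable_projections_continuous[of "hfp F f E g G" "hfp G g E h H"]
  note L = continuous_map_compose2[OF Y(1) continuous_map_fst] and R = continuous_map_compose2[OF Y(2) continuous_map_fst]
  define u where "u = (\<lambda>(z :: 'x point) t. if t \<le> 1/2 then track (left z) (2 * t) else track (right z) (2 * t - 1))"
  have cl: "continuous_map ?P E (\<lambda>x. track (left (fst x)) (max 0 (min 1 (2 * snd x))))"
    by (rule track_continuous[OF L clamped_into_interval]) (intro continuous_intros time_continuous)
  have cr: "continuous_map ?P E (\<lambda>x. track (right (fst x)) (max 0 (min 1 (2 * snd x - 1))))"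
    by (rule track_continuous[OF R clamped_into_interval]) (intro continuous_intros time_continuous)
  have "continuous_map ?P E (\<lambda>x. if snd x \<le> 1/2 then track (left (fst x)) (max 0 (min 1 (2 * snd x)))
      else track (right (fst x)) (max 0 (min 1 (2 * snd x - 1))))"
    by (rule continuous_map_cases_le)
      (use continuous_map_from_subtopology[OF cl] continuous_map_from_subtopology[OF cr] in
        \<open>auto simp: in_composable_iff in_hfp_iff time_continuous\<close>)
  then have u: "continuous_map ?P E (\<lambda>(z, t). u z t)"
  proof (rule continuous_map_eq)
    fix x assume "x \<in> topspace ?P"
    then have "0 \<le> snd x" "snd x \<le> 1" by auto
    then have "max 0 (min 1 (2 * snd x)) = 2 * snd x" if "snd x \<le> 1/2"
      using that by simp
    moreover have "max 0 (min 1 (2 * snd x - 1)) = 2 * snd x - 1" if "\<not> snd x \<le> 1/2"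
      using that \<open>snd x \<le> 1\<close> by simp
    ultimately show "(if snd x \<le> 1/2 then track (left (fst x)) (max 0 (min 1 (2 * snd x)))
      else track (right (fst x)) (max 0 (min 1 (2 * snd x - 1)))) = (\<lambda>(z, t). u z t) x"
      by (simp add: u_def case_prod_unfold)
  qed
  have "continuous_map ?Y (hfp F f E h H) (\<lambda>z. Arc (start (left z)) (\<lambda>t\<in>{0..1}. u z t) (finish (right z)))"
    by (rule into_hfp_continuous[OF _ _ u])
      (auto simp: u_def in_composable_iff in_hfp_iff
        intro: continuous_map_compose2[OF hfp_projections_continuous(1) Y(1)]
          continuous_map_compose2[OF hfp_projections_continuous(2) Y(2)])
  then show ?thesis
    by (simp add: concat_arc_def[abs_def] u_def)
qed

text \<open>
  The time \<open>\<rho> s t\<close> may leave the unit interval and is clamped back into it, so that a path runs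
  through its whole course and then rests at an end.
\<close>

lemma reparametrization_homotopic:
  fixes f g :: "'x point \<Rightarrow> 'x point"
  assumes \<rho>: "continuous_map (prod_topology euclideanreal euclideanreal) euclideanreal (\<lambda>(s, t). \<rho> s t)"
    and start: "\<And>t. \<rho> 0 t = t" and ends: "\<And>s. s \<in> {0..1} \<Longrightarrow> \<rho> s 0 \<le> 0" "\<And>s. s \<in> {0..1} \<Longrightarrow> 1 \<le> \<rho> s 1"
    and \<theta>: "\<And>z. z \<in> topspace (hfp F f E g G) \<Longrightarrow>
      \<theta> z = Arc (start z) (\<lambda>t\<in>{0..1}. track z (max 0 (min 1 (\<rho> 1 t)))) (finish z)"
  shows "homotopic_with (\<lambda>_. True) (hfp F f E g G) (hfp F f E g G) \<theta> id"
proof -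
  let ?X = "hfp F f E g G"
  let ?P = "prod_topology unit_interval ?X" let ?PP = "prod_topology ?P unit_interval"
  have clamped_ends: "max 0 (min 1 (\<rho> s 0)) = 0" "max 0 (min 1 (\<rho> s 1)) = 1" if "s \<in> {0..1}" for s
    using ends[OF that] by simp_all
  define k where "k = (\<lambda>(x :: real \<times> 'x point) t. track (snd x) (max 0 (min 1 (\<rho> (fst x) t))))"
  have "continuous_map ?PP (prod_topology euclideanreal euclideanreal) (\<lambda>x. (fst (fst x), snd x))"
    by (intro continuous_map_pairedI time_continuous continuous_map_compose2[OF time_continuous(2) continuous_map_fst])
  then have "continuous_map ?PP euclideanreal (\<lambda>x. \<rho> (fst (fst x)) (snd x))"
    using continuous_map_compose2[OF \<rho>] by fastforce
  then have "continuous_map ?PP E (\<lambda>x. track (snd (fst x)) (max 0 (min 1 (\<rho> (fst (fst x)) (snd x)))))"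
    by (rule track_continuous[OF continuous_map_compose2[OF continuous_map_snd continuous_map_fst] clamped_into_interval])
  then have k: "continuous_map ?PP E (\<lambda>(x, t). k x t)"
    by (simp add: k_def case_prod_unfold)
  have K: "continuous_map ?P ?X (\<lambda>x. Arc (start (snd x)) (\<lambda>t\<in>{0..1}. k x t) (finish (snd x)))"
    by (rule into_hfp_continuous[OF _ _ k])
      (use clamped_ends in \<open>auto simp: k_def in_hfp_iff
        intro: continuous_map_compose2[OF hfp_projections_continuous(1) continuous_map_snd]
          continuous_map_compose2[OF hfp_projections_continuous(2) continuous_map_snd]\<close>)
  have "homotopic_with (\<lambda>_. True) ?X ?X id \<theta>"
  proof (subst homotopic_with, simp, intro exI conjI ballI TrueI)
    show "Arc (start (snd (0, z))) (\<lambda>t\<in>{0..1}. k (0, z) t) (finish (snd (0, z))) = id z"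
      if "z \<in> topspace ?X" for z
    proof -
      have "(\<lambda>t\<in>{0..1}. k (0, z) t) = (\<lambda>t\<in>{0..1}. track z t)"
        by (auto simp: k_def start fun_eq_iff)
      then show ?thesis using hfp_point_eq[OF that] by simp
    qed
    show "Arc (start (snd (1, z))) (\<lambda>t\<in>{0..1}. k (1, z) t) (finish (snd (1, z))) = \<theta> z"
      if "z \<in> topspace ?X" for z
      unfolding \<theta>[OF that] k_def fst_conv snd_conv ..
  qed (rule K)
  then show ?thesis by (rule homotopic_with_symD)
qed

text \<open>
  At \<open>s = 1\<close> the time runs twice as fast and is clamped at \<open>1\<close> from \<open>t = 1/2\<close> on.
\<close>

lemma append_constant_homotopic:
  "homotopic_with (\<lambda>_. True) (hfp F f E g G) (hfp F f E g G)
    (concat_arc \<circ> (\<lambda>z. Pair z (const_arc g (finish z)))) id"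
proof (rule reparametrization_homotopic[where \<rho> = "\<lambda>s t. (1 + s) * t"])
  show "continuous_map (prod_topology euclideanreal euclideanreal) euclideanreal (\<lambda>(s, t). (1 + s) * t :: real)"
    unfolding case_prod_unfold
    by (intro continuous_map_real_mult continuous_map_add continuous_map_canonical_const continuous_map_fst continuous_map_snd)
  fix z assume z: "z \<in> topspace (hfp F f E g G)"
  have "track z (max 0 (min 1 ((1 + 1) * t))) = (if t \<le> 1/2 then track z (2 * t) else g (finish z))"
    if "t \<in> {0..1}" for t
    using z that by (cases "t \<le> 1/2") (simp_all add: in_hfp_iff)
  then show "(concat_arc \<circ> (\<lambda>z. Pair z (const_arc g (finish z)))) z
      = Arc (start z) (\<lambda>t\<in>{0..1}. track z (max 0 (min 1 ((1 + 1) * t)))) (finish z)"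
    by (auto simp: concat_arc_def const_arc_def fun_eq_iff)
qed simp_all

text \<open>
  Here the time at \<open>s = 1\<close> is \<open>2 t - 1\<close>, which is clamped at \<open>0\<close> up to \<open>t = 1/2\<close>.
\<close>

lemma prepend_constant_homotopic:
  "homotopic_with (\<lambda>_. True) (hfp G g E h H) (hfp G g E h H)
    (concat_arc \<circ> (\<lambda>z. Pair (const_arc g (start z)) z)) id"
proof (rule reparametrization_homotopic[where \<rho> = "\<lambda>s t. (1 + s) * t - s"])
  show "continuous_map (prod_topology euclideanreal euclideanreal) euclideanreal (\<lambda>(s, t). (1 + s) * t - s :: real)"
    unfolding case_prod_unfold
    by (intro continuous_map_real_mult continuous_map_add continuous_map_diff continuous_map_canonical_const
        continuous_map_fst continuous_map_snd)
  fix z assume z: "z \<in> topspace (hfp G g E h H)"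
  have "track z (max 0 (min 1 ((1 + 1) * t - 1))) = (if t \<le> 1/2 then g (start z) else track z (2 * t - 1))"
    if "t \<in> {0..1}" for t
    using z that by (cases "t \<le> 1/2") (simp_all add: in_hfp_iff)
  then show "(concat_arc \<circ> (\<lambda>z. Pair (const_arc g (start z)) z)) z
      = Arc (start z) (\<lambda>t\<in>{0..1}. track z (max 0 (min 1 ((1 + 1) * t - 1)))) (finish z)"
    by (auto simp: concat_arc_def const_arc_def fun_eq_iff)
qed simp_all

section \<open>Compression into the preimage of the core\<close>

text \<open>
  To move the midpoint of an arc along a homotopy \<open>D\<close> of \<open>N\<close> while keeping its ends, one lifts the
  motion of the midpoint to a path \<open>\<gamma>\<close> in \<open>E\<close> and inserts a spike into the arc: halfway it runs along
  \<open>\<gamma>\<close> and returns, and the tip of the spike becomes the new midpoint. The function \<open>l\<close> controls the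
  final length of the spike over each parameter, and spikes of length \<open>0\<close> change nothing, whatever
  the lift does there.
\<close>

lemma spike_compression:
  fixes f h p :: "'x point \<Rightarrow> 'x point" and Z :: "'z topology"
  assumes lift: "has_HLP E B p Z" and p: "continuous_map E B p"
    and D: "continuous_map (prod_topology unit_interval (subtopology B N)) (subtopology B N) D"
    and D0: "\<And>x. x \<in> N \<Longrightarrow> D (0, x) = x"
    and u: "continuous_map Z (hfp F f E h H) u"
    and mid: "\<And>z. z \<in> topspace Z \<Longrightarrow> p (track (u z) (1/2)) \<in> N"
    and l: "continuous_map Z unit_interval l"
  obtains K where "continuous_map (prod_topology unit_interval Z) (hfp F f E h H) K"
    and "\<And>z. z \<in> topspace Z \<Longrightarrow> K (0, z) = u z"
    and "\<And>t z. z \<in> topspace Z \<Longrightarrow> t \<in> {0..1} \<Longrightarrow> l z = 0 \<Longrightarrow> K (t, z) = u z"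
    and "\<And>t z. z \<in> topspace Z \<Longrightarrow> t \<in> {0..1} \<Longrightarrow>
      p (track (K (t, z)) (1/2)) = D (t * l z, p (track (u z) (1/2)))"
proof -
  let ?X = "hfp F f E h H" and ?IZ = "prod_topology unit_interval Z"
  let ?P = "prod_topology ?IZ unit_interval"
  have c: "continuous_map Z E (\<lambda>z. track (u z) (1/2))"
    by (rule track_continuous[OF u]) simp
  have cN: "continuous_map Z (subtopology B N) (\<lambda>z. p (track (u z) (1/2)))"
    by (rule continuous_map_into_subtopology[OF continuous_map_compose2[OF p c]]) (use mid in auto)
  have uX: "u z \<in> topspace ?X" if "z \<in> topspace Z" for z
    using u that by (auto simp: continuous_map_def)
  have "continuous_map ?IZ (subtopology B N) (\<lambda>x. D (fst x, p (track (u (snd x)) (1/2))))"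
    by (intro continuous_map_compose2[OF D] continuous_map_pairedI continuous_map_fst
        continuous_map_compose2[OF cN] continuous_map_snd)
  then have "continuous_map ?IZ B (\<lambda>(t, z). D (t, p (track (u z) (1/2))))"
    by (simp add: case_prod_unfold continuous_map_in_subtopology)
  then obtain \<gamma> where \<gamma>: "continuous_map ?IZ E \<gamma>"
      "\<And>z. z \<in> topspace Z \<Longrightarrow> \<gamma> (0, z) = track (u z) (1/2)"
      "\<And>t z. t \<in> {0..1} \<Longrightarrow> z \<in> topspace Z \<Longrightarrow> p (\<gamma> (t, z)) = D (t, p (track (u z) (1/2)))"
    using lift[unfolded has_HLP_def, rule_format, of "\<lambda>z. track (u z) (1/2)"
        "\<lambda>(t, z). D (t, p (track (u z) (1/2)))"] c D0 mid by auto
  \<comment> \<open>The length \<open>s\<close> of the spike, the rescaled time \<open>y\<close> and the time \<open>r\<close> along the old path.\<close>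
  define s where "s = (\<lambda>x. fst x * l (snd x))"
  define y where "y = (\<lambda>x t. (1 + s x) * (t - 1/2))"
  define r where "r = (\<lambda>x t. 1/2 + y x t - max (- s x / 2) (min (s x / 2) (y x t)))"
  define k where "k = (\<lambda>x t. if \<bar>y x t\<bar> \<le> s x / 2
      then \<gamma> (max 0 (min 1 (s x - 2 * \<bar>y x t\<bar>)), snd x) else track (u (snd x)) (max 0 (min 1 (r x t))))"
  have lr: "continuous_map Z euclideanreal l" and l01: "\<And>z. z \<in> topspace Z \<Longrightarrow> 0 \<le> l z \<and> l z \<le> 1"
    using l by (auto simp: continuous_map_in_subtopology)
  have s: "continuous_map ?IZ euclideanreal s"
    unfolding s_def by (intro continuous_map_real_mult time_continuous continuous_map_compose2[OF lr continuous_map_snd])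
  have s01: "0 \<le> s x" "s x \<le> 1" if "x \<in> topspace ?IZ" for x
    using that l01[of "snd x"] by (auto simp: s_def intro: mult_le_one)
  have y: "continuous_map ?P euclideanreal (\<lambda>x. y (fst x) (snd x))"
    unfolding y_def by (intro continuous_map_real_mult continuous_map_add continuous_map_diff
        continuous_map_canonical_const time_continuous continuous_map_compose2[OF s continuous_map_fst])
  have s': "continuous_map ?P euclideanreal (\<lambda>x. s (fst x))"
    by (rule continuous_map_compose2[OF s continuous_map_fst])
  have r: "continuous_map ?P euclideanreal (\<lambda>x. r (fst x) (snd x))"
    unfolding r_def by (intro continuous_intros y s') auto
  have z: "continuous_map ?P Z (\<lambda>x. snd (fst x))"
    by (rule continuous_map_compose2[OF continuous_map_snd continuous_map_fst])
  have "continuous_map ?P euclideanreal (\<lambda>x. s (fst x) - 2 * \<bar>y (fst x) (snd x)\<bar>)"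
    by (intro continuous_intros y s')
  then have k1: "continuous_map ?P E (\<lambda>x. \<gamma> (max 0 (min 1 (s (fst x) - 2 * \<bar>y (fst x) (snd x)\<bar>)), snd (fst x)))"
    by (intro continuous_map_compose2[OF \<gamma>(1)] continuous_map_pairedI clamped_into_interval z)
  have k2: "continuous_map ?P E (\<lambda>x. track (u (snd (fst x))) (max 0 (min 1 (r (fst x) (snd x)))))"
    by (rule track_continuous[OF continuous_map_compose2[OF u z] clamped_into_interval[OF r]])
  have "continuous_map ?P E (\<lambda>x. k (fst x) (snd x))"
    unfolding k_def
  proof (rule continuous_map_cases_le)
    show "continuous_map ?P euclideanreal (\<lambda>x. \<bar>y (fst x) (snd x)\<bar>)" "continuous_map ?P euclideanreal (\<lambda>x. s (fst x) / 2)"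
      by (intro continuous_intros y s'; simp)+
    fix x assume x: "x \<in> topspace ?P" and eq: "\<bar>y (fst x) (snd x)\<bar> = s (fst x) / 2"
    then have rx: "r (fst x) (snd x) = 1/2" and "snd (fst x) \<in> topspace Z"
      by (auto simp: r_def abs_if split: if_splits)
    then show "\<gamma> (max 0 (min 1 (s (fst x) - 2 * \<bar>y (fst x) (snd x)\<bar>)), snd (fst x))
        = track (u (snd (fst x))) (max 0 (min 1 (r (fst x) (snd x))))"
      unfolding rx eq using \<gamma>(2) by simp
  qed (use k1 k2 in \<open>auto intro: continuous_map_from_subtopology\<close>)
  then have kc: "continuous_map ?P E (\<lambda>(x, t). k x t)"
    by (simp add: case_prod_unfold)
  have k_ends: "k x 0 = track (u (snd x)) 0" "k x 1 = track (u (snd x)) 1" if "x \<in> topspace ?IZ" for x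
  proof -
    have y_ends: "y x 0 = - (1/2) - s x / 2" "y x 1 = 1/2 + s x / 2"
      by (simp_all add: y_def field_simps)
    then have "r x 0 = 0" "r x 1 = 1" "\<not> \<bar>y x 0\<bar> \<le> s x / 2" "\<not> \<bar>y x 1\<bar> \<le> s x / 2"
      using s01[OF that] by (auto simp: r_def)
    then show "k x 0 = track (u (snd x)) 0" "k x 1 = track (u (snd x)) 1"
      by (simp_all add: k_def)
  qed
  have k_mid: "k x (1/2) = \<gamma> (s x, snd x)" if "x \<in> topspace ?IZ" for x
    using s01[OF that] by (simp add: k_def y_def)
  have k_zero: "k x t = track (u (snd x)) t" if "x \<in> topspace ?IZ" "s x = 0" "t \<in> {0..1}" for x t
  proof (cases "t = 1/2")
    case True
    have "k x (1/2) = track (u (snd x)) (1/2)"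
      using k_mid[OF that(1)] that(1,2) \<gamma>(2)[of "snd x"] by auto
    with True show ?thesis by (simp only:)
  next
    case False
    then have "\<not> \<bar>y x t\<bar> \<le> s x / 2" "r x t = t"
      using that by (auto simp: y_def r_def)
    then show ?thesis using that by (simp add: k_def)
  qed
  let ?K = "\<lambda>x. Arc (start (u (snd x))) (\<lambda>t\<in>{0..1}. k x t) (finish (u (snd x)))"
  show thesis
  proof (rule that[of ?K])
    show "continuous_map ?IZ ?X ?K"
      by (rule into_hfp_continuous[OF _ _ kc])
        (use uX in \<open>auto simp: k_ends in_hfp_iff
          intro!: continuous_map_compose2[OF hfp_projections_continuous(1)]
            continuous_map_compose2[OF hfp_projections_continuous(2)]
            continuous_map_compose2[OF u continuous_map_snd]\<close>)
    have K0: "?K x = u (snd x)" if "x \<in> topspace ?IZ" "s x = 0" for x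
    proof -
      have "(\<lambda>t\<in>{0..1}. k x t) = (\<lambda>t\<in>{0..1}. track (u (snd x)) t)"
        using k_zero[OF that] by (auto simp: fun_eq_iff)
      then show ?thesis
        using hfp_point_eq[OF uX[of "snd x"]] that(1) by auto
    qed
    show "?K (0, z) = u z" if "z \<in> topspace Z" for z
      using K0[of "(0, z)"] that by (simp add: s_def)
    show "?K (t, z) = u z" if "z \<in> topspace Z" "t \<in> {0..1}" "l z = 0" for t z
      using K0[of "(t, z)"] that by (simp add: s_def)
    show "p (track (?K (t, z)) (1/2)) = D (t * l z, p (track (u z) (1/2)))"
      if "z \<in> topspace Z" "t \<in> {0..1}" for t z
      using that k_mid[of "(t, z)"] s01[of "(t, z)"] \<gamma>(3)[of "t * l z" z] by (simp add: s_def)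
  qed
qed

section \<open>Cubes\<close>

lemma in_cube_iff: "z \<in> topspace (cube n) \<longleftrightarrow> (\<forall>i<n. 0 \<le> z i \<and> z i \<le> 1) \<and> (\<forall>i\<ge>n. z i = 0)"
  by (auto simp: cube_def topspace_Euclidean_space)

lemma cube_boundary_subset: "z \<in> cube_boundary n \<Longrightarrow> z \<in> topspace (cube n)"
  by (simp add: cube_boundary_def)

lemma into_cube_continuous:
  assumes "\<And>i. continuous_map X euclideanreal (\<lambda>x. u x i)" "\<And>x. x \<in> topspace X \<Longrightarrow> u x \<in> topspace (cube n)"
  shows "continuous_map X (cube n) u"
  using assms unfolding cube_def Euclidean_space_def continuous_map_in_subtopology continuous_map_componentwise_UNIV
  by auto

lemma cube_coordinate_continuous: "continuous_map (cube n) euclideanreal (\<lambda>z. z i)"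
  unfolding cube_def Euclidean_space_def
  by (intro continuous_map_from_subtopology continuous_map_product_coordinates) simp

lemma path_connected_cube: "path_connected_space (cube n)"
proof -
  let ?o = "\<lambda>_ :: nat. 0 :: real"
  have "homotopic_with (\<lambda>_. True) (cube n) (cube n) id (\<lambda>_. ?o)"
  proof (subst homotopic_with, simp, intro exI conjI ballI TrueI)
    show "continuous_map (prod_topology unit_interval (cube n)) (cube n) (\<lambda>x i. (1 - fst x) * snd x i)"
      by (rule into_cube_continuous)
        (auto simp: in_cube_iff mult_le_one intro!: continuous_map_real_mult continuous_map_diff time_continuous
          continuous_map_compose2[OF cube_coordinate_continuous continuous_map_snd])
  qed auto
  then have "contractible_space (cube n)"
    unfolding contractible_space_def id_def by blast
  then show ?thesis
    by (rule contractible_imp_path_connected_space)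
qed

text \<open>
  The function \<open>clamp\<close> stretches the middle half of the unit interval over the whole of it, and \<open>bump\<close>
  falls from \<open>1\<close> to \<open>0\<close> on the outer quarters, where \<open>clamp\<close> is constant. Applied to the coordinates of a
  cube they give the map \<open>collar\<close>, which presses a collar of the boundary onto the boundary, and the
  function \<open>depth\<close>, which drops from \<open>1\<close> inside to \<open>0\<close> on the boundary within that collar.
\<close>

definition clamp :: "real \<Rightarrow> real" where "clamp x = max 0 (min 1 (2 * x - 1/2))"

definition bump :: "real \<Rightarrow> real" where "bump x = min 1 (4 * min x (1 - x))"

lemma clamp_bounds: "0 \<le> clamp x" "clamp x \<le> 1" and clamp_ends [simp]: "clamp 0 = 0" "clamp 1 = 1"
  by (auto simp: clamp_def)

lemma bump_bounds: "0 \<le> x \<Longrightarrow> x \<le> 1 \<Longrightarrow> 0 \<le> bump x" "bump x \<le> 1"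
  and bump_ends [simp]: "bump 0 = 0" "bump 1 = 0"
  by (auto simp: bump_def)

lemma bump_less_1: "bump x < 1 \<Longrightarrow> clamp x = 0 \<or> clamp x = 1"
proof -
  assume "bump x < 1"
  then have "x < 1/4 \<or> 3/4 < x"
    by (auto simp: bump_def min_def split: if_splits)
  then show ?thesis
    by (auto simp: clamp_def)
qed

lemma clamp_continuous: "continuous_map X euclideanreal s \<Longrightarrow> continuous_map X euclideanreal (\<lambda>x. clamp (s x))"
  unfolding clamp_def by (intro continuous_intros) auto

lemma bump_continuous: "continuous_map X euclideanreal s \<Longrightarrow> continuous_map X euclideanreal (\<lambda>x. bump (s x))"
  unfolding bump_def by (intro continuous_intros) auto

definition collar :: "(nat \<Rightarrow> real) \<Rightarrow> nat \<Rightarrow> real" where "collar z = (\<lambda>i. clamp (z i))"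

definition depth :: "nat \<Rightarrow> (nat \<Rightarrow> real) \<Rightarrow> real" where "depth n z = (\<Prod>i<n. bump (z i))"

lemma collar_continuous: "continuous_map (cube n) (cube n) collar"
  by (rule into_cube_continuous)
    (auto simp: collar_def in_cube_iff clamp_bounds intro: clamp_continuous cube_coordinate_continuous)

lemma collar_boundary: "z \<in> cube_boundary n \<Longrightarrow> collar z \<in> cube_boundary n"
  unfolding cube_boundary_def in_cube_iff collar_def by (fastforce simp: clamp_bounds)

lemma depth_continuous: "continuous_map (cube n) unit_interval (depth n)"
proof (rule continuous_map_into_subtopology)
  show "continuous_map (cube n) euclideanreal (depth n)"
    unfolding depth_def[abs_def] by (intro continuous_map_prod bump_continuous cube_coordinate_continuous) auto
  show "depth n \<in> topspace (cube n) \<rightarrow> {0..1}"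
    by (auto simp: depth_def in_cube_iff bump_bounds intro!: prod_nonneg prod_le_1)
qed

lemma depth_boundary: "z \<in> cube_boundary n \<Longrightarrow> depth n z = 0"
proof -
  assume "z \<in> cube_boundary n"
  then obtain i where i: "i < n" "z i = 0 \<or> z i = 1"
    by (auto simp: cube_boundary_def)
  then have "bump (z i) = 0" by auto
  with i(1) show ?thesis
    unfolding depth_def by (intro prod_zero) auto
qed

lemma depth_less_1:
  assumes z: "z \<in> topspace (cube n)" and d: "depth n z \<noteq> 1" shows "collar z \<in> cube_boundary n"
proof -
  obtain i where i: "i < n" "bump (z i) \<noteq> 1"
    using d unfolding depth_def by (metis lessThan_iff prod.neutral)
  then have "clamp (z i) = 0 \<or> clamp (z i) = 1"
    using bump_less_1[of "z i"] bump_bounds(2)[of "z i"] by linarith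
  moreover have "collar z \<in> topspace (cube n)"
    using collar_continuous z by (auto simp: continuous_map_def)
  ultimately show ?thesis
    using i(1) by (auto simp: cube_boundary_def collar_def)
qed

lemma spheroid_boundary_cong:
  "(\<And>z. z \<in> topspace (cube n) \<Longrightarrow> s z = s' z) \<Longrightarrow> (\<forall>z\<in>cube_boundary n. s z = x0) \<longleftrightarrow> (\<forall>z\<in>cube_boundary n. s' z = x0)"
  using cube_boundary_subset by metis

lemma spheroid_homotopic_iff:
  "spheroid_homotopic n X x0 s s' \<longleftrightarrow>
    (\<exists>K. continuous_map (prod_topology unit_interval (cube n)) X K \<and>
      (\<forall>z\<in>topspace (cube n). K (0, z) = s z) \<and> (\<forall>z\<in>topspace (cube n). K (1, z) = s' z) \<and>
      (\<forall>t\<in>{0..1}. \<forall>z\<in>cube_boundary n. K (t, z) = x0))"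
  unfolding spheroid_homotopic_def by (rule homotopic_with) (rule spheroid_boundary_cong)

lemma spheroid_homotopic_trans:
  "spheroid_homotopic n X x0 s s' \<Longrightarrow> spheroid_homotopic n X x0 s' s'' \<Longrightarrow> spheroid_homotopic n X x0 s s''"
  unfolding spheroid_homotopic_def by (rule homotopic_with_trans)

lemma spheroid_homotopic_sym: "spheroid_homotopic n X x0 s s' \<Longrightarrow> spheroid_homotopic n X x0 s' s"
  unfolding spheroid_homotopic_def by (rule homotopic_with_symD)

text \<open>
  Every face of the cube is preserved by \<open>collar\<close>, hence by the straight-line homotopy from the identity
  to it, so precomposing with this homotopy leaves the boundary values alone.
\<close>

lemma spheroid_collar_homotopic:
  assumes s: "s \<in> spheroids n X x0" shows "spheroid_homotopic n X x0 s (s \<circ> collar)"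
proof -
  let ?P = "prod_topology unit_interval (cube n)"
  define k where "k = (\<lambda>x i. (1 - fst x) * snd x i + fst x * collar (snd x) i :: real)"
  have k01: "0 \<le> k x i \<and> k x i \<le> 1" if "x \<in> topspace ?P" "i < n" for x i
  proof -
    have "0 \<le> snd x i" "snd x i \<le> 1" "0 \<le> fst x" "fst x \<le> 1"
      using that by (auto simp: in_cube_iff)
    then show ?thesis
      using clamp_bounds[of "snd x i"] convex_bound_le[of "snd x i" 1 "clamp (snd x i)" "1 - fst x" "fst x"]
      by (simp add: k_def collar_def)
  qed
  have k_zero: "k x i = 0" if "x \<in> topspace ?P" "i \<ge> n" for x i
    using that by (auto simp: k_def collar_def in_cube_iff)
  have k: "continuous_map ?P (cube n) k"
  proof (rule into_cube_continuous)
    show "continuous_map ?P euclideanreal (\<lambda>x. k x i)" for i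
      unfolding k_def collar_def
      by (intro continuous_map_add continuous_map_real_mult continuous_map_diff continuous_map_canonical_const
          time_continuous clamp_continuous continuous_map_compose2[OF cube_coordinate_continuous continuous_map_snd])
  qed (use k01 k_zero in \<open>auto simp: in_cube_iff\<close>)
  have k_bd: "k (t, z) \<in> cube_boundary n" if z: "z \<in> cube_boundary n" and t: "t \<in> {0..1}" for t z
  proof -
    obtain i where i: "i < n" "z i = 0 \<or> z i = 1"
      using z by (auto simp: cube_boundary_def)
    then have "k (t, z) i = 0 \<or> k (t, z) i = 1"
      by (auto simp: k_def collar_def)
    moreover have "k (t, z) \<in> topspace (cube n)"
      using k cube_boundary_subset[OF z] t by (auto simp: continuous_map_def)
    ultimately show ?thesis
      using i by (auto simp: cube_boundary_def)
  qed
  show ?thesis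
    unfolding spheroid_homotopic_iff
  proof (intro exI conjI ballI)
    show "continuous_map ?P X (\<lambda>x. s (k x))"
      using s by (intro continuous_map_compose2[OF _ k]) (simp add: spheroids_def)
    show "s (k (t, z)) = x0" if "t \<in> {0..1}" "z \<in> cube_boundary n" for t z
      using s k_bd[OF that(2,1)] by (simp add: spheroids_def)
  qed (simp_all add: k_def)
qed

lemma collar_spheroid: "s \<in> spheroids n X x0 \<Longrightarrow> s \<circ> collar \<in> spheroids n X x0"
  using continuous_map_compose[OF collar_continuous] collar_boundary by (auto simp: spheroids_def)

lemma has_HLP_retract:
  assumes Z': "has_HLP E B p Z'" and i: "continuous_map Z Z' i" and r: "continuous_map Z' Z r"
    and ri: "\<And>z. z \<in> topspace Z \<Longrightarrow> r (i z) = z"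
  shows "has_HLP E B p Z"
  unfolding has_HLP_def
proof (intro allI impI)
  fix f H
  assume fH: "continuous_map Z E f \<and> continuous_map (prod_topology unit_interval Z) B H \<and>
    (\<forall>z\<in>topspace Z. H (0, z) = p (f z))"
  then have fc: "continuous_map Z E f" and Hc: "continuous_map (prod_topology unit_interval Z) B H"
    and H0: "\<And>z. z \<in> topspace Z \<Longrightarrow> H (0, z) = p (f z)"
    by auto
  have iZ: "i z \<in> topspace Z'" if "z \<in> topspace Z" for z
    using i that by (auto simp: continuous_map_def)
  have rZ: "r z \<in> topspace Z" if "z \<in> topspace Z'" for z
    using r that by (auto simp: continuous_map_def)
  have "continuous_map (prod_topology unit_interval Z') B (\<lambda>x. H (fst x, r (snd x)))"
    by (intro continuous_map_compose2[OF Hc] continuous_map_pairedI continuous_map_fst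
        continuous_map_compose2[OF r continuous_map_snd])
  then obtain K where K: "continuous_map (prod_topology unit_interval Z') E K"
      "\<forall>z\<in>topspace Z'. K (0, z) = f (r z)" "\<forall>t\<in>{0..1}. \<forall>z\<in>topspace Z'. p (K (t, z)) = H (t, r z)"
    using Z'[unfolded has_HLP_def, rule_format, of "\<lambda>z. f (r z)" "\<lambda>x. H (fst x, r (snd x))"]
      H0 rZ continuous_map_compose2[OF fc r] by auto
  have "continuous_map (prod_topology unit_interval Z) E (\<lambda>x. K (fst x, i (snd x)))"
    by (intro continuous_map_compose2[OF K(1)] continuous_map_pairedI continuous_map_fst
        continuous_map_compose2[OF i continuous_map_snd])
  moreover have "K (0, i z) = f z" "t \<in> {0..1} \<Longrightarrow> p (K (t, i z)) = H (t, z)" if "z \<in> topspace Z" for z t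
    using K(2,3) iZ[OF that] ri[OF that] by auto
  ultimately show "\<exists>K. continuous_map (prod_topology unit_interval Z) E K \<and> (\<forall>z\<in>topspace Z. K (0, z) = f z) \<and>
      (\<forall>t\<in>{0..1}. \<forall>z\<in>topspace Z. p (K (t, z)) = H (t, z))"
    by (intro exI[where x = "\<lambda>x. K (fst x, i (snd x))"]) simp
qed

text \<open>
  The product is a copy of the cube of the next dimension, with the time as the last coordinate.
\<close>

lemma Serre_fibration_lifts_homotopies:
  assumes "Serre_fibration E B p" shows "has_HLP E B p (prod_topology unit_interval (cube n))"
proof (rule has_HLP_retract)
  show "has_HLP E B p (cube (Suc n))"
    using assms by (simp add: Serre_fibration_def)
  let ?P = "prod_topology unit_interval (cube n)"
  show "continuous_map ?P (cube (Suc n)) (\<lambda>x. (snd x)(n := fst x))"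
  proof (rule into_cube_continuous)
    show "continuous_map ?P euclideanreal (\<lambda>x. ((snd x)(n := fst x)) i)" for i
      by (cases "i = n")
        (simp_all add: time_continuous continuous_map_compose2[OF cube_coordinate_continuous continuous_map_snd])
  qed (auto simp: in_cube_iff less_Suc_eq)
  show "continuous_map (cube (Suc n)) ?P (\<lambda>z. (z n, z(n := 0)))"
  proof (rule continuous_map_pairedI)
    show "continuous_map (cube (Suc n)) unit_interval (\<lambda>z. z n)"
      by (rule continuous_map_into_subtopology[OF cube_coordinate_continuous]) (auto simp: in_cube_iff)
    show "continuous_map (cube (Suc n)) (cube n) (\<lambda>z. z(n := 0))"
    proof (rule into_cube_continuous)
      show "continuous_map (cube (Suc n)) euclideanreal (\<lambda>z. (z(n := 0)) i)" for i
        by (cases "i = n") (simp_all add: cube_coordinate_continuous)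
    qed (auto simp: in_cube_iff le_Suc_eq Suc_le_eq)
  qed
  show "(((snd z)(n := fst z)) n, ((snd z)(n := fst z))(n := 0)) = z" if "z \<in> topspace ?P" for z
    using that by (auto simp: in_cube_iff fun_eq_iff)
qed

section \<open>Restriction to the preimage of the core\<close>

locale lifted_embedding =
  multiplicative_tubular_embedding ct \<Phi>
  for ct :: "('x point, 'k) cohomology" and \<Phi> :: "('x point, 'v, 'k) embedding_data" +
  fixes E :: "'x point topology" and p :: "'x point \<Rightarrow> 'x point"
  assumes fibration: "Hurewicz_fibration E (target \<Phi>) p \<or> (Serre_fibration E (target \<Phi>) p \<and> weakly_invariant ct)"
begin

abbreviation middle :: "'x point \<Rightarrow> 'x point" where "middle z \<equiv> p (track z (1/2))"

definition over :: "'x point topology \<Rightarrow> 'x point set \<Rightarrow> 'x point topology" where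
  "over X S = subtopology X {z \<in> topspace X. middle z \<in> S}"

lemma p_continuous: "continuous_map E (target \<Phi>) p"
  using fibration by (auto simp: Hurewicz_fibration_def Serre_fibration_def)

lemma middle_continuous: "continuous_map (hfp F f E h H) (target \<Phi>) middle"
  by (rule continuous_map_compose2[OF p_continuous track_continuous[OF continuous_map_id[unfolded id_def]]]) simp

lemma in_over_iff: "z \<in> topspace (over X S) \<longleftrightarrow> z \<in> topspace X \<and> middle z \<in> S"
  by (auto simp: over_def)

lemma into_over_continuous:
  "continuous_map Z (over X S) u \<longleftrightarrow> continuous_map Z X u \<and> (\<forall>z\<in>topspace Z. middle (u z) \<in> S)"
  unfolding over_def continuous_map_in_subtopology
  using continuous_map_image_subset_topspace[of Z X u] by blast

lemma core_in_tube: "x \<in> core \<Phi> \<Longrightarrow> x \<in> tube \<Phi>"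
  by (rule core_neighbourhood) blast

lemma over_core_inclusion: "continuous_map (over X (core \<Phi>)) (over X (tube \<Phi>)) id"
  using continuous_map_from_subtopology[of X X id] core_in_tube
  by (auto simp: into_over_continuous in_over_iff) (simp add: over_def)

text \<open>
  Arcs with midpoint over the tube are compressed to arcs with midpoint over the core by spikes along
  lifts of the radial contraction. The cut-off \<open>l\<close> may be below \<open>1\<close> only at arcs that already have their
  midpoint over the core. The contraction is stationary there, so the lift stays in a fibre and a
  spike of any length keeps the midpoint over the core.
\<close>

lemma compression:
  fixes Z :: "'z topology" and F H :: "'x point topology" and f h :: "'x point \<Rightarrow> 'x point"
  defines "X \<equiv> hfp F f E h H"
  assumes lift: "has_HLP E (target \<Phi>) p Z" and u: "continuous_map Z (over X (tube \<Phi>)) u"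
    and l: "continuous_map Z unit_interval l"
    and cut: "\<And>z. z \<in> topspace Z \<Longrightarrow> l z \<noteq> 1 \<Longrightarrow> middle (u z) \<in> core \<Phi>"
  obtains K where "continuous_map (prod_topology unit_interval Z) (over X (tube \<Phi>)) K"
    and "\<And>z. z \<in> topspace Z \<Longrightarrow> K (0, z) = u z"
    and "\<And>t z. z \<in> topspace Z \<Longrightarrow> t \<in> {0..1} \<Longrightarrow> l z = 0 \<Longrightarrow> K (t, z) = u z"
    and "\<And>t z. z \<in> topspace Z \<Longrightarrow> t \<in> {0..1} \<Longrightarrow> middle (u z) \<in> core \<Phi> \<Longrightarrow> middle (K (t, z)) \<in> core \<Phi>"
    and "\<And>z. z \<in> topspace Z \<Longrightarrow> middle (K (1, z)) \<in> core \<Phi>"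
proof -
  have uX: "continuous_map Z (hfp F f E h H) u" and mid: "\<And>z. z \<in> topspace Z \<Longrightarrow> middle (u z) \<in> tube \<Phi>"
    using u by (auto simp: into_over_continuous X_def)
  obtain K where K: "continuous_map (prod_topology unit_interval Z) (hfp F f E h H) K"
      "\<And>z. z \<in> topspace Z \<Longrightarrow> K (0, z) = u z"
      "\<And>t z. z \<in> topspace Z \<Longrightarrow> t \<in> {0..1} \<Longrightarrow> l z = 0 \<Longrightarrow> K (t, z) = u z"
      "\<And>t z. z \<in> topspace Z \<Longrightarrow> t \<in> {0..1} \<Longrightarrow>
        middle (K (t, z)) = contraction (t * l z, middle (u z))"
    using spike_compression[OF lift p_continuous contraction_continuous contraction_start uX mid l] by blast
  have l01: "0 \<le> l z \<and> l z \<le> 1" if "z \<in> topspace Z" for z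
    using l that by (auto simp: continuous_map_in_subtopology)
  have core: "middle (K (t, z)) \<in> core \<Phi>"
    if "z \<in> topspace Z" "t \<in> {0..1}" "middle (u z) \<in> core \<Phi>" for t z
    using K(4)[OF that(1,2)] contraction_core[OF that(3)] that(3) by simp
  have "contraction (t * l z, middle (u z)) \<in> tube \<Phi>" if "z \<in> topspace Z" "t \<in> {0..1}" for t z
    using contraction_continuous mid[OF that(1)] l01[OF that(1)] that(2) tube_subset(1)
    by (auto simp: continuous_map_def Pi_iff mult_le_one)
  then have "continuous_map (prod_topology unit_interval Z) (over X (tube \<Phi>)) K"
    using K(1,4) by (auto simp: into_over_continuous X_def)
  moreover have "middle (K (1, z)) \<in> core \<Phi>" if "z \<in> topspace Z" for z
  proof (cases "l z = 1")
    case True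
    then show ?thesis
      using K(4)[OF that, of 1] contraction_end[OF mid[OF that]] by simp
  next
    case False
    then show ?thesis
      using core[OF that _ cut[OF that False], of 1] by simp
  qed
  ultimately show thesis
    using that K(2,3) core by blast
qed

text \<open>
  For a Hurewicz fibration all arcs over the tube can be compressed at once, which makes the
  inclusion of the arcs over the core a homotopy equivalence.
\<close>

lemma Hurewicz_core_restriction_surj:
  fixes F H :: "'x point topology" and f h :: "'x point \<Rightarrow> 'x point"
  assumes "Hurewicz_fibration E (target \<Phi>) p"
  defines "X \<equiv> hfp F f E h H"
  shows "pull ct n (over X (core \<Phi>)) (over X (tube \<Phi>)) id ` carrier (coh ct n (over X (tube \<Phi>)))
    = carrier (coh ct n (over X (core \<Phi>)))"
proof -
  let ?N = "over X (tube \<Phi>)" and ?M = "over X (core \<Phi>)"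
  have lift: "has_HLP E (target \<Phi>) p ?N"
    using assms by (simp add: Hurewicz_fibration_def)
  have id: "continuous_map ?N ?N (\<lambda>z. z)" by simp
  obtain K where K: "continuous_map (prod_topology unit_interval ?N) ?N K"
      "\<And>z. z \<in> topspace ?N \<Longrightarrow> K (0, z) = z"
      "\<And>t z. z \<in> topspace ?N \<Longrightarrow> t \<in> {0..1} \<Longrightarrow> middle z \<in> core \<Phi> \<Longrightarrow> middle (K (t, z)) \<in> core \<Phi>"
      "\<And>z. z \<in> topspace ?N \<Longrightarrow> middle (K (1, z)) \<in> core \<Phi>"
    using compression[OF lift[unfolded X_def] id[unfolded X_def], of "\<lambda>_. 1"] unfolding X_def by auto
  have KX: "continuous_map (prod_topology unit_interval ?N) X K"
    using K(1) by (simp add: into_over_continuous)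
  have r: "continuous_map ?N ?M (\<lambda>z. K (1, z))"
    unfolding into_over_continuous
  proof
    show "continuous_map ?N X (\<lambda>z. K (1, z))"
      by (rule continuous_map_compose2[OF KX]) (simp add: continuous_map_pairedI)
  qed (use K(4) in blast)
  have "homotopic_with (\<lambda>_. True) ?M ?M id ((\<lambda>z. K (1, z)) \<circ> id)"
  proof (subst homotopic_with, simp, intro exI conjI ballI TrueI)
    show "continuous_map (prod_topology unit_interval ?M) ?M K"
      unfolding into_over_continuous
    proof
      have "continuous_map (prod_topology unit_interval ?M) (prod_topology unit_interval ?N) (\<lambda>x. (fst x, id (snd x)))"
        by (intro continuous_map_pairedI continuous_map_fst continuous_map_compose2[OF over_core_inclusion] continuous_map_snd)
      then show "continuous_map (prod_topology unit_interval ?M) X K"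
        using continuous_map_compose2[OF KX] by fastforce
    qed (use K(3) core_in_tube in \<open>auto simp: in_over_iff\<close>)
  qed (use K(2) core_in_tube in \<open>auto simp: in_over_iff\<close>)
  then show ?thesis
    by (intro homotopy_retract_surj[OF over_core_inclusion r]) (rule homotopic_with_symD)
qed

text \<open>
  A Serre fibration allows compression only over cubes. Homotopy classes of spheroids have to be
  compared relative to the boundary, but lifts of stationary homotopies need not be stationary. So the
  spheroid is first replaced by one that takes its boundary values on a collar, and the
  length of the spikes is damped to zero within this collar.
\<close>

lemma Serre_weak_equivalence:
  fixes F H :: "'x point topology" and f h :: "'x point \<Rightarrow> 'x point"
  assumes Serre: "Serre_fibration E (target \<Phi>) p"
  defines "X \<equiv> hfp F f E h H"
  shows "weak_equivalence (over X (core \<Phi>)) (over X (tube \<Phi>)) id"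
proof -
  let ?N = "over X (tube \<Phi>)" and ?M = "over X (core \<Phi>)"
  have lift: "has_HLP E (target \<Phi>) p (cube n)" for n
    using Serre by (simp add: Serre_fibration_def)
  have incl: "continuous_map Z ?M u \<Longrightarrow> continuous_map Z ?N u" for Z :: "'z topology" and u
    using core_in_tube by (auto simp: into_over_continuous)
  have mM: "middle z \<in> core \<Phi>" if "z \<in> topspace ?M" for z
    using that by (simp add: in_over_iff)
  have empty: "topspace ?N = {}" if "topspace ?M = {}"
  proof (rule ccontr)
    assume "topspace ?N \<noteq> {}"
    then obtain z where z: "z \<in> topspace ?N" by blast
    then have c: "continuous_map (cube 0) ?N (\<lambda>_. z)" by simp
    have "\<exists>K. continuous_map (prod_topology unit_interval (cube 0)) ?N K \<and>
        (\<forall>v\<in>topspace (cube 0). middle (K (1, v)) \<in> core \<Phi>)"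
      unfolding X_def by (rule compression[OF lift[of 0] c[unfolded X_def], of "\<lambda>_. 1"]) auto
    then obtain K where K: "continuous_map (prod_topology unit_interval (cube 0)) ?N K"
        "\<And>v. v \<in> topspace (cube 0) \<Longrightarrow> middle (K (1, v)) \<in> core \<Phi>"
      by blast
    have o: "(\<lambda>_. 0) \<in> topspace (cube 0)" by (simp add: in_cube_iff)
    then have "(1, \<lambda>_. 0) \<in> topspace (prod_topology unit_interval (cube 0))" by simp
    then have "K (1, \<lambda>_. 0) \<in> topspace ?N"
      using continuous_map_image_subset_topspace[OF K(1)] by blast
    then have "K (1, \<lambda>_. 0) \<in> topspace ?M"
      using K(2)[OF o] by (simp add: in_over_iff)
    with that show False by blast
  qed
  have injective: "spheroid_homotopic n ?M x0 s s'"
    if s: "s \<in> spheroids n ?M x0" and s': "s' \<in> spheroids n ?M x0" and x0: "x0 \<in> topspace ?M"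
      and hom: "spheroid_homotopic n ?N x0 s s'" for n x0 s s'
  proof -
    let ?Z = "prod_topology unit_interval (cube n)"
    obtain J where J: "continuous_map ?Z ?N J" "\<And>z. z \<in> topspace (cube n) \<Longrightarrow> J (0, z) = s z"
        "\<And>z. z \<in> topspace (cube n) \<Longrightarrow> J (1, z) = s' z"
        "\<And>t z. t \<in> {0..1} \<Longrightarrow> z \<in> cube_boundary n \<Longrightarrow> J (t, z) = x0"
      using hom unfolding spheroid_homotopic_iff by blast
    have sM: "s z \<in> topspace ?M" "s' z \<in> topspace ?M" if "z \<in> topspace (cube n)" for z
      using s s' that by (auto simp: spheroids_def continuous_map_def)
    have cz: "collar z \<in> topspace (cube n)" if "z \<in> topspace (cube n)" for z
      using collar_continuous that by (auto simp: continuous_map_def)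
    define u where "u = (\<lambda>x. J (clamp (fst x), collar (snd x)))"
    define l where "l = (\<lambda>x. bump (fst x) * depth n (snd x))"
    have "continuous_map ?Z unit_interval (\<lambda>x. clamp (fst x))"
      by (rule continuous_map_into_subtopology[OF clamp_continuous[OF time_continuous(2)]]) (auto simp: clamp_bounds)
    then have u: "continuous_map ?Z ?N u"
      unfolding u_def
      by (intro continuous_map_compose2[OF J(1)] continuous_map_pairedI
          continuous_map_compose2[OF collar_continuous continuous_map_snd])
    have dr: "continuous_map (cube n) euclideanreal (depth n)"
      and d01: "\<And>z. z \<in> topspace (cube n) \<Longrightarrow> 0 \<le> depth n z \<and> depth n z \<le> 1"
      using depth_continuous[of n] by (auto simp: continuous_map_in_subtopology)
    have l: "continuous_map ?Z unit_interval l"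
    proof (rule continuous_map_into_subtopology)
      show "continuous_map ?Z euclideanreal l"
        unfolding l_def by (intro continuous_map_real_mult bump_continuous time_continuous
            continuous_map_compose2[OF dr continuous_map_snd])
      show "l \<in> topspace ?Z \<rightarrow> {0..1}"
        using d01 by (auto simp: l_def bump_bounds intro!: mult_le_one)
    qed
    have cut: "middle (u x) \<in> core \<Phi>" if x: "x \<in> topspace ?Z" and lx: "l x \<noteq> 1" for x
    proof -
      have x': "fst x \<in> {0..1}" "snd x \<in> topspace (cube n)" using x by auto
      consider "bump (fst x) < 1" | "depth n (snd x) \<noteq> 1"
        using lx bump_bounds(2)[of "fst x"] by (fastforce simp: l_def)
      then have "u x \<in> topspace ?M"
      proof cases
        case 1
        then have "clamp (fst x) = 0 \<or> clamp (fst x) = 1" by (rule bump_less_1)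
        then show ?thesis
          using J(2,3) sM cz[OF x'(2)] by (auto simp: u_def)
      next
        case 2
        then show ?thesis
          using J(4) depth_less_1[OF x'(2) 2] clamp_bounds[of "fst x"] x0 by (simp add: u_def)
      qed
      then show ?thesis by (rule mM)
    qed
    obtain K where K: "continuous_map (prod_topology unit_interval ?Z) ?N K"
        "\<And>x. x \<in> topspace ?Z \<Longrightarrow> l x = 0 \<Longrightarrow> K (1, x) = u x"
        "\<And>x. x \<in> topspace ?Z \<Longrightarrow> middle (K (1, x)) \<in> core \<Phi>"
      using compression[OF Serre_fibration_lifts_homotopies[OF Serre] u[unfolded X_def] l cut] unfolding X_def
      by (metis atLeastAtMost_iff order_refl zero_le_one)
    have KM: "continuous_map ?Z ?M (\<lambda>x. K (1, x))"
    proof -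
      have "continuous_map ?Z ?N (\<lambda>x. K (1, x))"
        by (rule continuous_map_compose2[OF K(1)]) (simp add: continuous_map_pairedI)
      then show ?thesis
        using K(3) by (auto simp: into_over_continuous)
    qed
    have "spheroid_homotopic n ?M x0 (s \<circ> collar) (s' \<circ> collar)"
      unfolding spheroid_homotopic_iff
    proof (intro exI[where x = "\<lambda>x. K (1, x)"] conjI ballI KM)
      show "K (1, (0, z)) = (s \<circ> collar) z" "K (1, (1, z)) = (s' \<circ> collar) z" if "z \<in> topspace (cube n)" for z
        using that K(2)[of "(0, z)"] K(2)[of "(1, z)"] J(2,3) cz[OF that] by (auto simp: l_def u_def)
      show "K (1, (t, z)) = x0" if "t \<in> {0..1}" "z \<in> cube_boundary n" for t z
        using that K(2)[of "(t, z)"] depth_boundary[OF that(2)] J(4)[OF _ collar_boundary[OF that(2)]]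
          cube_boundary_subset[OF that(2)] clamp_bounds[of t] by (auto simp: l_def u_def)
    qed
    then show ?thesis
      using spheroid_collar_homotopic[OF s] spheroid_homotopic_sym[OF spheroid_collar_homotopic[OF s']]
      by (metis spheroid_homotopic_trans)
  qed
  have surjective: "\<exists>s\<in>spheroids n ?M x0. spheroid_homotopic n ?N x0 s r"
    if r: "r \<in> spheroids n ?N x0" and x0: "x0 \<in> topspace ?M" for n x0 r
  proof -
    have u: "continuous_map (cube n) ?N (r \<circ> collar)" and rb: "\<And>z. z \<in> cube_boundary n \<Longrightarrow> (r \<circ> collar) z = x0"
      using collar_spheroid[OF r] by (auto simp: spheroids_def)
    have rb': "\<And>z. z \<in> cube_boundary n \<Longrightarrow> r z = x0"
      using r by (simp add: spheroids_def)
    have cut: "middle ((r \<circ> collar) z) \<in> core \<Phi>" if "z \<in> topspace (cube n)" "depth n z \<noteq> 1" for z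
      using depth_less_1[OF that] rb' mM[OF x0] by simp
    obtain K where K: "continuous_map (prod_topology unit_interval (cube n)) ?N K"
        "\<And>z. z \<in> topspace (cube n) \<Longrightarrow> K (0, z) = (r \<circ> collar) z"
        "\<And>t z. z \<in> topspace (cube n) \<Longrightarrow> t \<in> {0..1} \<Longrightarrow> depth n z = 0 \<Longrightarrow> K (t, z) = (r \<circ> collar) z"
        "\<And>z. z \<in> topspace (cube n) \<Longrightarrow> middle (K (1, z)) \<in> core \<Phi>"
      using compression[OF lift u[unfolded X_def] depth_continuous cut] unfolding X_def by metis
    have Kb: "K (t, z) = x0" if "t \<in> {0..1}" "z \<in> cube_boundary n" for t z
      using K(3)[OF cube_boundary_subset that(1) depth_boundary] rb that(2) by simp
    have "continuous_map (cube n) ?N (\<lambda>z. K (1, z))"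
      by (rule continuous_map_compose2[OF K(1)]) (simp add: continuous_map_pairedI)
    then have "(\<lambda>z. K (1, z)) \<in> spheroids n ?M x0"
      using K(4) Kb by (auto simp: spheroids_def into_over_continuous)
    moreover have "spheroid_homotopic n ?N x0 (r \<circ> collar) (\<lambda>z. K (1, z))"
      unfolding spheroid_homotopic_iff
      by (rule exI[where x = K]) (use K(1,2) Kb in auto)
    then have "spheroid_homotopic n ?N x0 (\<lambda>z. K (1, z)) r"
      using spheroid_collar_homotopic[OF r] by (metis spheroid_homotopic_sym spheroid_homotopic_trans)
    ultimately show ?thesis by blast
  qed
  show ?thesis
    unfolding weak_equivalence_def
    using over_core_inclusion empty injective surjective by simp
qed

lemma core_restriction_surj:
  fixes F H :: "'x point topology" and f h :: "'x point \<Rightarrow> 'x point"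
  defines "X \<equiv> hfp F f E h H"
  shows "pull ct n (over X (core \<Phi>)) (over X (tube \<Phi>)) id ` carrier (coh ct n (over X (tube \<Phi>)))
    = carrier (coh ct n (over X (core \<Phi>)))"
  using fibration
proof
  assume "Hurewicz_fibration E (target \<Phi>) p"
  then show ?thesis
    unfolding X_def by (rule Hurewicz_core_restriction_surj)
next
  assume "Serre_fibration E (target \<Phi>) p \<and> weakly_invariant ct"
  then show ?thesis
    unfolding X_def using Serre_weak_equivalence unfolding weakly_invariant_def bij_betw_def by blast
qed

end

section \<open>The coproduct along a section of concatenation\<close>

locale coproduct_data =
  lifted_embedding ct \<Phi> E p
  for ct :: "('x point, 'k) cohomology" and \<Phi> :: "('x point, 'v, 'k) embedding_data"
    and E :: "'x point topology" and p :: "'x point \<Rightarrow> 'x point" +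
  fixes G :: "'x point topology" and g q :: "'x point \<Rightarrow> 'x point"
  assumes g: "continuous_map G E g" and square: "pullback_square G g E q (source \<Phi>) p (emap \<Phi>)"
begin

abbreviation deg :: int where "deg \<equiv> int (codim \<Phi>)"

abbreviation euler :: 'k where "euler \<equiv> pull ct deg G (source \<Phi>) q (Euler_class ct \<Phi>)"

lemma square_homeomorphism:
  "homeomorphic_map G (subtopology (prod_topology E (source \<Phi>)) {(e, x). p e = emap \<Phi> x}) (\<lambda>b. (g b, q b))"
  using square by (simp add: pullback_square_def)

lemma q: "continuous_map G (source \<Phi>) q"
  using homeomorphic_imp_continuous_map[OF square_homeomorphism]
  by (simp add: continuous_map_in_subtopology continuous_map_paired)

lemma square_commutes: "b \<in> topspace G \<Longrightarrow> p (g b) = emap \<Phi> (q b)"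
  using homeomorphic_imp_continuous_map[OF square_homeomorphism] by (auto simp: continuous_map_in_subtopology)

lemma euler_pullback_in_carrier: "euler \<in> carrier (coh ct deg G)"
  by (rule pull_closed[OF q euler_in_carrier])

lemma middle_concat:
  "z \<in> topspace (composable (hfp F f E g G) (hfp G g E h H)) \<Longrightarrow>
    middle (concat_arc z) = emap \<Phi> (q (finish (left z)))"
  using square_commutes[of "finish (left z)"] by (auto simp: in_composable_iff in_hfp_iff concat_arc_def)

lemma concat_arc_over_core:
  "continuous_map (composable (hfp F f E g G) (hfp G g E h H)) (over (hfp F f E h H) (core \<Phi>)) concat_arc"
  unfolding into_over_continuous
proof
  let ?Y = "composable (hfp F f E g G) (hfp G g E h H)"
  show "continuous_map ?Y (hfp F f E h H) concat_arc" by (rule concat_arc_continuous)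
  have "q (finish (left z)) \<in> topspace (source \<Phi>)" if "z \<in> topspace ?Y" for z
    using that q by (auto simp: in_composable_iff in_hfp_iff continuous_map_def)
  then show "\<forall>z\<in>topspace ?Y. middle (concat_arc z) \<in> core \<Phi>"
    using middle_concat by (simp add: core_def)
qed

lemma concat_arc_over_tube:
  "continuous_map (composable (hfp F f E g G) (hfp G g E h H)) (over (hfp F f E h H) (tube \<Phi>)) concat_arc"
  using concat_arc_over_core core_in_tube by (simp add: into_over_continuous)

text \<open>
  An arc whose midpoint lies over the core is cut in two at time \<open>1/2\<close>. The point of \<open>G\<close> at which the
  halves meet is determined by the pull-back square, from the value of the path in \<open>E\<close> and the point
  of \<open>M\<close> below it.
\<close>

lemma cut_exists:
  fixes F H :: "'x point topology" and f h :: "'x point \<Rightarrow> 'x point"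
  obtains cut where
    "continuous_map (over (hfp F f E h H) (core \<Phi>)) (composable (hfp F f E g G) (hfp G g E h H)) cut"
    "\<And>z. z \<in> topspace (composable (hfp F f E g G) (hfp G g E h H)) \<Longrightarrow> cut (concat_arc z) = z"
proof -
  let ?X = "hfp F f E h H" and ?Y = "composable (hfp F f E g G) (hfp G g E h H)"
  let ?XM = "over ?X (core \<Phi>)"
  let ?S = "subtopology (prod_topology E (source \<Phi>)) {(e, x). p e = emap \<Phi> x}"
  obtain \<beta> where \<beta>: "homeomorphic_maps G ?S (\<lambda>b. (g b, q b)) \<beta>"
    using square_homeomorphism unfolding homeomorphic_map_maps by blast
  obtain j where j: "homeomorphic_maps (source \<Phi>) (subtopology (target \<Phi>) (core \<Phi>)) (emap \<Phi>) j"
    using core_embedding unfolding homeomorphic_map_maps by blast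
  have \<beta>c: "continuous_map ?S G \<beta>" and \<beta>g: "\<And>b. b \<in> topspace G \<Longrightarrow> \<beta> (g b, q b) = b"
    and "\<forall>x\<in>topspace ?S. (g (\<beta> x), q (\<beta> x)) = x"
    using \<beta> by (simp_all add: homeomorphic_maps_def)
  then have g\<beta>: "\<And>x. x \<in> topspace ?S \<Longrightarrow> g (\<beta> x) = fst x"
    by (metis fst_conv)
  have jc: "continuous_map (subtopology (target \<Phi>) (core \<Phi>)) (source \<Phi>) j"
    and jemap: "\<And>x. x \<in> topspace (source \<Phi>) \<Longrightarrow> j (emap \<Phi> x) = x"
    and emapj: "\<And>y. y \<in> topspace (target \<Phi>) \<Longrightarrow> y \<in> core \<Phi> \<Longrightarrow> emap \<Phi> (j y) = y"
    using j by (auto simp: homeomorphic_maps_def)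
  have id: "continuous_map ?XM ?X (\<lambda>z. z)"
    using continuous_map_from_subtopology[OF continuous_map_id[of ?X]] by (simp add: over_def id_def)
  have XM: "z \<in> topspace ?X" "middle z \<in> core \<Phi>" "middle z \<in> topspace (target \<Phi>)" if "z \<in> topspace ?XM" for z
    using that middle_continuous[of F f h H] by (auto simp: in_over_iff continuous_map_def)
  define c where "c = (\<lambda>z. \<beta> (track z (1/2), j (middle z)))"
  have half: "continuous_map ?XM E (\<lambda>z. track z (1/2))"
    by (rule track_continuous[OF id]) simp
  have mid: "continuous_map ?XM (subtopology (target \<Phi>) (core \<Phi>)) middle"
    using XM continuous_map_compose2[OF p_continuous half] by (auto simp: continuous_map_in_subtopology)
  have pair: "continuous_map ?XM ?S (\<lambda>z. (track z (1/2), j (middle z)))"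
    using half continuous_map_compose2[OF jc mid] XM emapj
    by (auto simp: continuous_map_in_subtopology continuous_map_paired)
  have c: "continuous_map ?XM G c"
    unfolding c_def by (rule continuous_map_compose2[OF \<beta>c pair])
  have gc: "g (c z) = track z (1/2)" if "z \<in> topspace ?XM" for z
    using g\<beta>[of "(track z (1/2), j (middle z))"] continuous_map_image_subset_topspace[OF pair] that
    unfolding c_def by force
  let ?P = "prod_topology ?XM unit_interval"
  have idP: "continuous_map ?P ?X fst"
    by (rule continuous_map_compose2[OF id continuous_map_fst])
  define h1 h2 where "h1 = (\<lambda>(z :: 'x point) t. track z (max 0 (min 1 (t / 2))))"
    and "h2 = (\<lambda>(z :: 'x point) t. track z (max 0 (min 1 ((1 + t) / 2))))"
  have h1: "continuous_map ?P E (\<lambda>(z, t). h1 z t)"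
    unfolding case_prod_unfold h1_def
    by (rule track_continuous[OF idP clamped_into_interval]) (intro continuous_intros time_continuous; simp)
  have h2: "continuous_map ?P E (\<lambda>(z, t). h2 z t)"
    unfolding case_prod_unfold h2_def
    by (rule track_continuous[OF idP clamped_into_interval]) (intro continuous_intros time_continuous; simp)
  let ?cut = "\<lambda>z. Pair (Arc (start z) (\<lambda>t\<in>{0..1}. h1 z t) (c z)) (Arc (c z) (\<lambda>t\<in>{0..1}. h2 z t) (finish z))"
  show thesis
  proof (rule that[of ?cut])
    have s: "continuous_map ?XM F start" "continuous_map ?XM H finish"
      using continuous_map_compose2[OF hfp_projections_continuous(1) id]
        continuous_map_compose2[OF hfp_projections_continuous(2) id] by auto
    have "continuous_map ?XM (hfp F f E g G) (\<lambda>z. Arc (start z) (\<lambda>t\<in>{0..1}. h1 z t) (c z))"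
      by (rule into_hfp_continuous[OF s(1) c h1]) (use XM(1) gc in \<open>auto simp: in_hfp_iff h1_def\<close>)
    moreover have "continuous_map ?XM (hfp G g E h H) (\<lambda>z. Arc (c z) (\<lambda>t\<in>{0..1}. h2 z t) (finish z))"
      by (rule into_hfp_continuous[OF c s(2) h2]) (use XM(1) gc in \<open>auto simp: in_hfp_iff h2_def\<close>)
    ultimately show "continuous_map ?XM ?Y ?cut"
      by (rule into_composable_continuous) simp
    show "?cut (concat_arc z) = z" if z: "z \<in> topspace ?Y" for z
    proof -
      have L: "left z \<in> topspace (hfp F f E g G)" and R: "right z \<in> topspace (hfp G g E h H)"
        and zLR: "z = Pair (left z) (right z)" and mid: "finish (left z) = start (right z)"
        using z by (auto simp: in_composable_iff)
      have b: "finish (left z) \<in> topspace G" "track (left z) 1 = g (finish (left z))"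
        "track (right z) 0 = g (finish (left z))"
        using L R mid by (auto simp: in_hfp_iff)
      have "q (finish (left z)) \<in> topspace (source \<Phi>)"
        using q b(1) by (auto simp: continuous_map_def)
      then have cz: "c (concat_arc z) = finish (left z)"
        using middle_concat[OF z] jemap \<beta>g[OF b(1)] b(2) by (simp add: c_def concat_arc_def)
      have "h1 (concat_arc z) t = track (left z) t" if "t \<in> {0..1}" for t
        using that by (auto simp: h1_def concat_arc_def)
      then have "(\<lambda>t\<in>{0..1}. h1 (concat_arc z) t) = (\<lambda>t\<in>{0..1}. track (left z) t)"
        by auto
      then have 1: "Arc (start (concat_arc z)) (\<lambda>t\<in>{0..1}. h1 (concat_arc z) t) (c (concat_arc z)) = left z"
        using hfp_point_eq[OF L] cz by (simp add: concat_arc_def)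
      have "h2 (concat_arc z) t = track (right z) t" if t: "t \<in> {0..1}" for t
      proof (cases "t = 0")
        case True
        then show ?thesis using b by (simp add: h2_def concat_arc_def)
      next
        case False
        then have "max 0 (min 1 ((1 + t) / 2)) = (1 + t) / 2" "\<not> (1 + t) / 2 \<le> 1/2" "2 * ((1 + t) / 2) - 1 = t"
          using t by (auto simp: field_simps)
        then show ?thesis using t unfolding h2_def concat_arc_def by simp
      qed
      then have "(\<lambda>t\<in>{0..1}. h2 (concat_arc z) t) = (\<lambda>t\<in>{0..1}. track (right z) t)"
        by auto
      then have "Arc (c (concat_arc z)) (\<lambda>t\<in>{0..1}. h2 (concat_arc z) t) (finish (concat_arc z)) = right z"
        using hfp_point_eq[OF R] cz mid by (simp add: concat_arc_def)
      then show ?thesis using 1 zLR by simp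
    qed
  qed
qed

lemma concat_restriction_surj:
  assumes y: "y \<in> carrier (coh ct n (composable (hfp F f E g G) (hfp G g E h H)))"
  shows "y \<in> pull ct n (composable (hfp F f E g G) (hfp G g E h H)) (over (hfp F f E h H) (tube \<Phi>)) concat_arc
    ` carrier (coh ct n (over (hfp F f E h H) (tube \<Phi>)))"
proof -
  let ?Y = "composable (hfp F f E g G) (hfp G g E h H)" and ?M = "over (hfp F f E h H) (core \<Phi>)"
  let ?N = "over (hfp F f E h H) (tube \<Phi>)"
  obtain cut where cut: "continuous_map ?M ?Y cut" "\<And>z. z \<in> topspace ?Y \<Longrightarrow> cut (concat_arc z) = z"
    using cut_exists by blast
  have "pull ct n ?M ?Y cut y \<in> carrier (coh ct n ?M)"
    by (rule pull_closed[OF cut(1) y])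
  then have "pull ct n ?M ?Y cut y \<in> pull ct n ?M ?N id ` carrier (coh ct n ?N)"
    by (simp only: core_restriction_surj)
  then obtain x where x: "x \<in> carrier (coh ct n ?N)" "pull ct n ?M ?Y cut y = pull ct n ?M ?N id x"
    by (rule imageE)
  have "pull ct n ?Y ?N concat_arc x = pull ct n ?Y ?M concat_arc (pull ct n ?M ?N id x)"
    by (rule pull_factor[OF concat_arc_over_core over_core_inclusion _ x(1)]) simp
  also have "\<dots> = pull ct n ?Y ?Y (\<lambda>z. z) y"
    unfolding x(2)[symmetric] using cut(2) by (intro pull_factor[symmetric, OF concat_arc_over_core cut(1) _ y]) simp
  also have "\<dots> = y"
    by (rule pull_identity[OF _ y]) simp
  finally show ?thesis
    using x(1) by (intro image_eqI[OF sym])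
qed

text \<open>
  If \<open>z \<mapsto> (s z, t z)\<close> is a homotopy section of concatenation, a class on \<open>X\<close> is recovered from its
  restriction along concatenation by pulling it back along this section. The restriction of the shriek class is
  known from \<open>pull_shriek\<close>.
\<close>

lemma lcp_along_section:
  fixes F H :: "'x point topology" and f h :: "'x point \<Rightarrow> 'x point" and k l :: int
  defines "X \<equiv> hfp F f E h H" and "FG \<equiv> hfp F f E g G" and "GH \<equiv> hfp G g E h H"
  assumes s: "continuous_map X FG s" and t: "continuous_map X GH t"
    and st: "\<And>z. z \<in> topspace X \<Longrightarrow> finish (s z) = start (t z)"
    and hom: "homotopic_with (\<lambda>_. True) X X (concat_arc \<circ> (\<lambda>z. Pair (s z) (t z))) id"
    and a: "a \<in> carrier (coh ct k FG)" and b: "b \<in> carrier (coh ct l GH)"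
  shows "lcp ct \<Phi> p F f E g G h H k l a b
    = cup ct (k + l) deg X (cup ct k l X (pull ct k X FG s a) (pull ct l X GH t b))
        (pull ct deg X G (\<lambda>z. finish (s z)) euler)"
proof -
  let ?Y = "composable FG GH" and ?P = "prod_space FG GH"
  let ?\<Theta> = "\<lambda>z. Pair (s z) (t z)"
  define y where "y = pull ct (k + l) ?Y ?P id (cross ct k l FG GH a b)"
  have idY: "continuous_map ?Y ?P id"
    by (simp add: composable_def continuous_map_from_subtopology)
  have pa: "pull ct k ?P FG left a \<in> carrier (coh ct k ?P)" and pb: "pull ct l ?P GH right b \<in> carrier (coh ct l ?P)"
    using a b by (auto intro: pull_closed prod_space_projections_continuous)
  have cross: "cross ct k l FG GH a b \<in> carrier (coh ct (k + l) ?P)"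
    unfolding cross_def by (rule cup_in_carrier[OF pa pb])
  then have y: "y \<in> carrier (coh ct (k + l) ?Y)"
    unfolding y_def by (rule pull_closed[OF idY])
  define S where "S = shriek ct \<Phi> (k + l) ?Y X concat_arc middle y"
  have P: "continuous_map X (target \<Phi>) middle"
    unfolding X_def by (rule middle_continuous)
  have \<psi>: "continuous_map ?Y (subtopology X {z \<in> topspace X. middle z \<in> tube \<Phi>}) concat_arc"
    using concat_arc_over_tube[of F f h H] by (simp add: over_def X_def FG_def GH_def)
  have r: "continuous_map ?Y (source \<Phi>) (\<lambda>z. q (finish (left z)))"
    using composable_projections_continuous(1)[of FG GH] unfolding FG_def
    by (intro continuous_map_compose2[OF q] continuous_map_compose2[OF hfp_projections_continuous(2)])
  have Pr: "middle (concat_arc z) = emap \<Phi> (q (finish (left z)))" if "z \<in> topspace ?Y" for z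
    using middle_concat that by (simp add: FG_def GH_def)
  have y_ext: "y \<in> pull ct (k + l) ?Y (subtopology X {z \<in> topspace X. middle z \<in> tube \<Phi>}) concat_arc
      ` carrier (coh ct (k + l) (subtopology X {z \<in> topspace X. middle z \<in> tube \<Phi>}))"
    using concat_restriction_surj[of y "k + l" F f h H] y by (simp add: over_def X_def FG_def GH_def)
  have S: "S \<in> carrier (coh ct (k + l + deg) X)"
    "pull ct (k + l + deg) ?Y X concat_arc S
      = cup ct (k + l) deg ?Y y (pull ct deg ?Y (source \<Phi>) (\<lambda>z. q (finish (left z))) (Euler_class ct \<Phi>))"
    unfolding S_def by (rule pull_shriek[OF P \<psi> r Pr y_ext], assumption)+
  have \<Theta>: "continuous_map X ?Y ?\<Theta>"
    by (rule into_composable_continuous[OF s t st])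
  have \<psi>X: "continuous_map ?Y X concat_arc"
    unfolding X_def FG_def GH_def by (rule concat_arc_continuous)
  have e: "pull ct deg ?Y (source \<Phi>) (\<lambda>z. q (finish (left z))) (Euler_class ct \<Phi>) \<in> carrier (coh ct deg ?Y)"
    by (rule pull_closed[OF r euler_in_carrier])
  have "S = pull ct (k + l + deg) X X id S"
    using pull_identity[OF _ S(1)] by simp
  also have "\<dots> = pull ct (k + l + deg) X X (concat_arc \<circ> ?\<Theta>) S"
    by (rule pull_homotopic[symmetric, OF hom S(1)])
  also have "\<dots> = pull ct (k + l + deg) X ?Y ?\<Theta> (pull ct (k + l + deg) ?Y X concat_arc S)"
    by (rule pull_factor[OF \<Theta> \<psi>X _ S(1)]) simp
  also have "\<dots> = cup ct (k + l) deg X (pull ct (k + l) X ?Y ?\<Theta> y)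
      (pull ct deg X ?Y ?\<Theta> (pull ct deg ?Y (source \<Phi>) (\<lambda>z. q (finish (left z))) (Euler_class ct \<Phi>)))"
    unfolding S(2) by (rule pull_cup[OF \<Theta> y e])
  also have "pull ct deg X ?Y ?\<Theta> (pull ct deg ?Y (source \<Phi>) (\<lambda>z. q (finish (left z))) (Euler_class ct \<Phi>))
      = pull ct deg X (source \<Phi>) (\<lambda>z. q (finish (s z))) (Euler_class ct \<Phi>)"
    by (rule pull_factor[symmetric, OF \<Theta> r _ euler_in_carrier]) simp
  also have "\<dots> = pull ct deg X G (\<lambda>z. finish (s z)) euler"
    by (rule pull_factor[OF _ q _ euler_in_carrier])
      (use continuous_map_compose2[OF hfp_projections_continuous(2) s[unfolded FG_def]] in simp_all)
  also have "pull ct (k + l) X ?Y ?\<Theta> y = pull ct (k + l) X ?P ?\<Theta> (cross ct k l FG GH a b)"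
    unfolding y_def by (rule pull_factor[symmetric, OF \<Theta> idY _ cross]) simp
  also have "\<dots> = cup ct k l X (pull ct k X ?P ?\<Theta> (pull ct k ?P FG left a))
      (pull ct l X ?P ?\<Theta> (pull ct l ?P GH right b))"
    unfolding cross_def by (rule pull_cup[OF into_prod_space_continuous[OF s t] pa pb])
  also have "pull ct k X ?P ?\<Theta> (pull ct k ?P FG left a) = pull ct k X FG s a"
    by (rule pull_factor[symmetric, OF into_prod_space_continuous[OF s t] prod_space_projections_continuous(1) _ a]) simp
  also have "pull ct l X ?P ?\<Theta> (pull ct l ?P GH right b) = pull ct l X GH t b"
    by (rule pull_factor[symmetric, OF into_prod_space_continuous[OF s t] prod_space_projections_continuous(2) _ b]) simp
  finally show ?thesis
    by (simp add: lcp_def Let_def S_def y_def X_def FG_def GH_def)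
qed

lemma constant_section: "continuous_map G (hfp G g E g G) (const_arc g)"
  by (rule const_arc_continuous[OF g])

lemma start_continuous: "continuous_map (hfp G g E h H) G start"
  and finish_continuous: "continuous_map (hfp F f E g G) G finish"
  by (rule hfp_projections_continuous)+

text \<open>
  The section appends to an arc the constant arc at its end.
\<close>

lemma lcp_right:
  assumes a: "a \<in> carrier (coh ct k (hfp F f E g G))" and b: "b \<in> carrier (coh ct l (hfp G g E g G))"
  shows "lcp ct \<Phi> p F f E g G g G k l a b = cup ct k (l + deg) (hfp F f E g G) a
    (pull ct (l + deg) (hfp F f E g G) G finish (cup ct l deg G (pull ct l G (hfp G g E g G) (const_arc g) b) euler))"
proof -
  let ?X = "hfp F f E g G" and ?GG = "hfp G g E g G"
  note fin = finish_continuous[of F f]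
  let ?b = "pull ct l G ?GG (const_arc g) b"
  have b': "?b \<in> carrier (coh ct l G)" by (rule pull_closed[OF constant_section b])
  have t: "continuous_map ?X ?GG (\<lambda>z. const_arc g (finish z))"
    by (rule continuous_map_compose2[OF constant_section fin])
  have "lcp ct \<Phi> p F f E g G g G k l a b
      = cup ct (k + l) deg ?X (cup ct k l ?X (pull ct k ?X ?X (\<lambda>z. z) a) (pull ct l ?X ?GG (\<lambda>z. const_arc g (finish z)) b))
        (pull ct deg ?X G finish euler)"
    by (rule lcp_along_section[OF _ t _ append_constant_homotopic a b]) (simp_all add: const_arc_def)
  also have "pull ct k ?X ?X (\<lambda>z. z) a = a"
    by (rule pull_identity[OF _ a]) simp
  also have "pull ct l ?X ?GG (\<lambda>z. const_arc g (finish z)) b = pull ct l ?X G finish ?b"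
    by (rule pull_factor[OF fin constant_section _ b]) simp
  also have "cup ct (k + l) deg ?X (cup ct k l ?X a (pull ct l ?X G finish ?b)) (pull ct deg ?X G finish euler)
      = cup ct k (l + deg) ?X a (cup ct l deg ?X (pull ct l ?X G finish ?b) (pull ct deg ?X G finish euler))"
    by (intro cup_absolute_assoc a pull_closed[OF fin] b' euler_pullback_in_carrier)
  also have "cup ct l deg ?X (pull ct l ?X G finish ?b) (pull ct deg ?X G finish euler)
      = pull ct (l + deg) ?X G finish (cup ct l deg G ?b euler)"
    by (rule pull_cup[symmetric, OF fin b' euler_pullback_in_carrier])
  finally show ?thesis .
qed

lemma lcp_left:
  assumes b: "b \<in> carrier (coh ct k (hfp G g E g G))" and c: "c \<in> carrier (coh ct l (hfp G g E h H))"
  shows "lcp ct \<Phi> p G g E g G h H k l b c = cup ct (k + l) deg (hfp G g E h H)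
    (cup ct k l (hfp G g E h H) (pull ct k (hfp G g E h H) G start (pull ct k G (hfp G g E g G) (const_arc g) b)) c)
    (pull ct deg (hfp G g E h H) G start euler)"
proof -
  let ?X = "hfp G g E h H" and ?GG = "hfp G g E g G"
  note st = start_continuous[of h H]
  have s: "continuous_map ?X ?GG (\<lambda>z. const_arc g (start z))"
    by (rule continuous_map_compose2[OF constant_section st])
  have "lcp ct \<Phi> p G g E g G h H k l b c
      = cup ct (k + l) deg ?X (cup ct k l ?X (pull ct k ?X ?GG (\<lambda>z. const_arc g (start z)) b) (pull ct l ?X ?X (\<lambda>z. z) c))
        (pull ct deg ?X G (\<lambda>z. finish (const_arc g (start z))) euler)"
    by (rule lcp_along_section[OF s _ _ prepend_constant_homotopic b c]) (simp_all add: const_arc_def)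
  also have "pull ct l ?X ?X (\<lambda>z. z) c = c"
    by (rule pull_identity[OF _ c]) simp
  also have "pull ct k ?X ?GG (\<lambda>z. const_arc g (start z)) b = pull ct k ?X G start (pull ct k G ?GG (const_arc g) b)"
    by (rule pull_factor[OF st constant_section _ b]) simp
  also have "(\<lambda>z. finish (const_arc g (start z))) = start"
    by (simp add: const_arc_def)
  finally show ?thesis .
qed

text \<open>
  Evaluation along the arc is a homotopy in \<open>B\<close> between the images of its two ends. It may leave \<open>M\<close>, so
  the classes are compared through the extension of the Euler class over \<open>B\<close>.
\<close>

lemma euler_start_eq_finish:
  "pull ct deg (hfp G g E g G) G start euler = pull ct deg (hfp G g E g G) G finish euler"
proof -
  let ?GG = "hfp G g E g G"
  obtain t where t: "t \<in> carrier (coh ct deg (target \<Phi>))"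
      "Euler_class ct \<Phi> = pull ct deg (source \<Phi>) (target \<Phi>) (emap \<Phi>) t"
    using euler_extends .
  have pg: "continuous_map G (target \<Phi>) (\<lambda>b. p (g b))"
    by (rule continuous_map_compose2[OF p_continuous g])
  have "euler = pull ct deg G (target \<Phi>) (\<lambda>b. p (g b)) t"
    unfolding t(2) using square_commutes by (intro pull_factor[symmetric, OF q emap_continuous _ t(1)])
  then have eu: "pull ct deg ?GG G r euler = pull ct deg ?GG (target \<Phi>) (\<lambda>z. p (g (r z))) t"
    if "continuous_map ?GG G r" for r
    using pull_factor[symmetric, OF that pg _ t(1)] by simp
  have "homotopic_with (\<lambda>_. True) ?GG (target \<Phi>) (\<lambda>z. p (g (start z))) (\<lambda>z. p (g (finish z)))"
  proof (subst homotopic_with, simp, intro exI conjI ballI TrueI)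
    show "continuous_map (prod_topology unit_interval ?GG) (target \<Phi>) (\<lambda>x. p (track (snd x) (fst x)))"
      by (intro continuous_map_compose2[OF p_continuous] track_continuous[OF continuous_map_snd continuous_map_fst])
  qed (auto simp: in_hfp_iff)
  then show ?thesis
    using eu[OF start_continuous] eu[OF finish_continuous] pull_homotopic[OF _ t(1)] by simp
qed

end

section \<open>Cohomology and path components\<close>

text \<open>
  The topological sum of the path components in \<open>\<C>\<close>, realised as a finer topology on the same points:
  additivity then speaks about the components themselves, and the comparison map is the identity.
\<close>

definition component_sum :: "'a topology \<Rightarrow> 'a set set \<Rightarrow> 'a topology" where
  "component_sum X \<C> = topology (\<lambda>U. U \<subseteq> \<Union>\<C> \<and> (\<forall>C\<in>\<C>. openin (subtopology X C) (U \<inter> C)))"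

lemma openin_component_sum:
  "openin (component_sum X \<C>) U \<longleftrightarrow> U \<subseteq> \<Union>\<C> \<and> (\<forall>C\<in>\<C>. openin (subtopology X C) (U \<inter> C))"
proof -
  have "istopology (\<lambda>U. U \<subseteq> \<Union>\<C> \<and> (\<forall>C\<in>\<C>. openin (subtopology X C) (U \<inter> C)))"
    unfolding istopology_def
  proof (intro conjI allI impI ballI)
    fix S T C assume "S \<subseteq> \<Union>\<C> \<and> (\<forall>C\<in>\<C>. openin (subtopology X C) (S \<inter> C))"
      "T \<subseteq> \<Union>\<C> \<and> (\<forall>C\<in>\<C>. openin (subtopology X C) (T \<inter> C))" "C \<in> \<C>"
    then have "openin (subtopology X C) ((S \<inter> C) \<inter> (T \<inter> C))" by blast
    then show "openin (subtopology X C) (S \<inter> T \<inter> C)" by (simp add: Int_ac)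
  next
    fix \<K> C assume K: "\<forall>S\<in>\<K>. S \<subseteq> \<Union>\<C> \<and> (\<forall>C\<in>\<C>. openin (subtopology X C) (S \<inter> C))" "C \<in> \<C>"
    then have "openin (subtopology X C) (\<Union>S\<in>\<K>. S \<inter> C)" by (intro openin_Union) blast
    moreover have "(\<Union>S\<in>\<K>. S \<inter> C) = \<Union>\<K> \<inter> C" by blast
    ultimately show "openin (subtopology X C) (\<Union>\<K> \<inter> C)" by (simp only:)
  qed blast+
  then show ?thesis
    by (simp add: component_sum_def topology_inverse')
qed

context
  fixes X :: "'a topology" and \<C> :: "'a set set"
  assumes components: "\<C> \<subseteq> path_components_of X"
begin

lemma component_subset: "C \<in> \<C> \<Longrightarrow> C \<subseteq> topspace X"
  using components Union_path_components_of[of X] by blast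

lemma component_disjoint: "C \<in> \<C> \<Longrightarrow> D \<in> \<C> \<Longrightarrow> C \<noteq> D \<Longrightarrow> C \<inter> D = {}"
  using components pairwise_disjoint_path_components_of[of X] unfolding disjoint_def by blast

lemma openin_component: "C \<in> \<C> \<Longrightarrow> openin (subtopology X C) T \<Longrightarrow> openin (component_sum X \<C>) T"
proof -
  assume C: "C \<in> \<C>" and T: "openin (subtopology X C) T"
  then have TC: "T \<subseteq> C" using openin_subset[OF T] by auto
  have "openin (subtopology X D) (T \<inter> D)" if D: "D \<in> \<C>" for D
  proof (cases "D = C")
    case True
    then show ?thesis using T TC by (simp add: Int_absorb2)
  next
    case False
    then have "T \<inter> D = {}" using component_disjoint[OF C D] TC by blast
    then show ?thesis by simp
  qed
  then show ?thesis
    using C TC by (auto simp: openin_component_sum)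
qed

lemma topspace_component_sum: "topspace (component_sum X \<C>) = \<Union>\<C>"
proof
  show "\<Union>\<C> \<subseteq> topspace (component_sum X \<C>)"
  proof
    fix x assume "x \<in> \<Union>\<C>"
    then obtain C where C: "C \<in> \<C>" "x \<in> C" by blast
    then have "openin (component_sum X \<C>) C"
      using openin_component[OF C(1)] component_subset[OF C(1)] openin_topspace[of "subtopology X C"]
      by (simp add: Int_absorb1)
    then show "x \<in> topspace (component_sum X \<C>)"
      using C(2) openin_subset by blast
  qed
  show "topspace (component_sum X \<C>) \<subseteq> \<Union>\<C>"
    using openin_topspace[of "component_sum X \<C>"] by (simp only: openin_component_sum)
qed

lemma subtopology_component_sum: "C \<in> \<C> \<Longrightarrow> subtopology (component_sum X \<C>) C = subtopology X C"
proof (rule topology_eq[THEN iffD2], intro allI iffI)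
  fix T assume C: "C \<in> \<C>"
  { assume "openin (subtopology (component_sum X \<C>) C) T"
    then show "openin (subtopology X C) T"
      using C by (auto simp: openin_subtopology[of "component_sum X \<C>"] openin_component_sum) }
  { assume T: "openin (subtopology X C) T"
    then have "T = T \<inter> C" using openin_subset[OF T] by auto
    then show "openin (subtopology (component_sum X \<C>) C) T"
      using openin_component[OF C T] unfolding openin_subtopology by blast }
qed

lemma component_sum_coarsens: "continuous_map (component_sum X \<C>) (subtopology X (\<Union>\<C>)) id"
proof (rule continuous_map_into_subtopology)
  show "continuous_map (component_sum X \<C>) X id"
    unfolding continuous_map_def
  proof (intro conjI allI impI)
    show "id \<in> topspace (component_sum X \<C>) \<rightarrow> topspace X"
      using component_subset by (fastforce simp: topspace_component_sum)
    fix U assume U: "openin X U"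
    have "openin (subtopology X C) ({x \<in> topspace (component_sum X \<C>). id x \<in> U} \<inter> C)" if C: "C \<in> \<C>" for C
    proof -
      have "{x \<in> topspace (component_sum X \<C>). id x \<in> U} \<inter> C = U \<inter> C"
        using C by (auto simp: topspace_component_sum)
      then show ?thesis using openin_subtopology_Int[OF U] by simp
    qed
    then show "openin (component_sum X \<C>) {x \<in> topspace (component_sum X \<C>). id x \<in> U}"
      by (auto simp: openin_component_sum topspace_component_sum)
  qed
qed (simp add: topspace_component_sum)

text \<open>
  A map from a path-connected space has its image in a single component.
\<close>

lemma into_component_sum_continuous:
  assumes Z: "path_connected_space Z" and u: "continuous_map Z (subtopology X (\<Union>\<C>)) u"
  shows "continuous_map Z (component_sum X \<C>) u"
proof (cases "topspace Z = {}")
  case True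
  then show ?thesis by (simp add: continuous_map_def)
next
  case False
  have uX: "continuous_map Z X u" and uC: "u ` topspace Z \<subseteq> \<Union>\<C>"
    using u by (auto simp: continuous_map_in_subtopology)
  obtain z where z: "z \<in> topspace Z" using False by blast
  then obtain C where C: "C \<in> \<C>" "u z \<in> C" using uC by blast
  have "path_connectedin X (u ` topspace Z)"
    using path_connectedin_continuous_map_image[OF uX] Z path_connectedin_topspace by blast
  moreover have "\<not> disjnt C (u ` topspace Z)"
    using z C(2) by (auto simp: disjnt_def)
  ultimately have im: "u ` topspace Z \<subseteq> C"
    using path_components_of_maximal C(1) components by blast
  show ?thesis
    unfolding continuous_map_def
  proof (intro conjI allI impI)
    show "u \<in> topspace Z \<rightarrow> topspace (component_sum X \<C>)"
      using uC by (auto simp: topspace_component_sum)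
    fix U assume "openin (component_sum X \<C>) U"
    then have "openin (subtopology X C) (U \<inter> C)"
      using C(1) by (simp add: openin_component_sum)
    moreover have "continuous_map Z (subtopology X C) u"
      using uX im by (auto simp: continuous_map_in_subtopology)
    ultimately have "openin Z {x \<in> topspace Z. u x \<in> U \<inter> C}"
      by (rule openin_continuous_map_preimage[rotated])
    moreover have "{x \<in> topspace Z. u x \<in> U \<inter> C} = {x \<in> topspace Z. u x \<in> U}"
      using im by auto
    ultimately show "openin Z {x \<in> topspace Z. u x \<in> U}" by simp
  qed
qed

lemma component_sum_weak_equivalence:
  "weak_equivalence (component_sum X \<C>) (subtopology X (\<Union>\<C>)) id"
proof -
  have I: "path_connected_space (prod_topology unit_interval (cube n))" for n
  proof -
    have "path_connected_space unit_interval"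
      using path_connectedin_euclidean[of "{0..1::real}"] convex_imp_path_connected[of "{0..1::real}"]
      unfolding path_connectedin_def by simp
    then show ?thesis
      using path_connected_cube by (simp add: path_connected_space_prod_topology)
  qed
  have "topspace (subtopology X (\<Union>\<C>)) = topspace (component_sum X \<C>)"
    using component_subset by (fastforce simp: topspace_component_sum)
  moreover have "spheroid_homotopic n (component_sum X \<C>) x0 s s'"
    if "spheroid_homotopic n (subtopology X (\<Union>\<C>)) x0 s s'" for n x0 s s'
    using that into_component_sum_continuous[OF I] unfolding spheroid_homotopic_iff by blast
  moreover have "\<exists>s\<in>spheroids n (component_sum X \<C>) x0. spheroid_homotopic n (subtopology X (\<Union>\<C>)) x0 s r"
    if r: "r \<in> spheroids n (subtopology X (\<Union>\<C>)) x0" for n x0 r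
  proof
    show "r \<in> spheroids n (component_sum X \<C>) x0"
      using r into_component_sum_continuous[OF path_connected_cube] by (simp add: spheroids_def)
    show "spheroid_homotopic n (subtopology X (\<Union>\<C>)) x0 r r"
      using r by (auto simp: spheroid_homotopic_def spheroids_def)
  qed
  ultimately show ?thesis
    unfolding weak_equivalence_def using component_sum_coarsens by simp
qed

end

text \<open>
  Cubes and homotopies of spheroids are path connected, so the topological sum of path components has
  the same weak homotopy type as their union. On the sum, additivity applies.
\<close>

lemma (in additive_cohomology_theory) weakly_invariant_imp_respects_path_components:
  assumes weak: "weakly_invariant ct" shows "respects_path_components ct X"
  unfolding respects_path_components_def
proof (intro allI impI)
  fix \<C> n assume C: "\<C> \<subseteq> path_components_of X"
  let ?S = "component_sum X \<C>" and ?Y = "subtopology X (\<Union>\<C>)"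
  have "bij_betw (pull ct n ?S ?Y id) (carrier (coh ct n ?Y)) (carrier (coh ct n ?S))"
    using weak component_sum_weak_equivalence[OF C] by (simp add: weakly_invariant_def)
  moreover have "bij_betw (\<lambda>a. \<lambda>U\<in>\<C>. pull ct n (subtopology ?S U) ?S id a) (carrier (coh ct n ?S))
      (\<Pi>\<^sub>E U\<in>\<C>. carrier (coh ct n (subtopology ?S U)))"
  proof (rule additivity)
    show "openin ?S U" if "U \<in> \<C>" for U
      using openin_component[OF C that, of U] component_subset[OF C that] openin_topspace[of "subtopology X U"]
      by (simp add: Int_absorb1)
    show "disjoint \<C>"
      using component_disjoint[OF C] by (auto simp: disjoint_def)
  qed (simp add: topspace_component_sum[OF C])
  ultimately have "bij_betw ((\<lambda>a. \<lambda>U\<in>\<C>. pull ct n (subtopology ?S U) ?S id a) \<circ> pull ct n ?S ?Y id)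
      (carrier (coh ct n ?Y)) (\<Pi>\<^sub>E U\<in>\<C>. carrier (coh ct n (subtopology ?S U)))"
    by (rule bij_betw_trans)
  also have "(\<Pi>\<^sub>E U\<in>\<C>. carrier (coh ct n (subtopology ?S U))) = (\<Pi>\<^sub>E U\<in>\<C>. carrier (coh ct n (subtopology X U)))"
    by (rule PiE_cong) (simp add: subtopology_component_sum[OF C])
  finally show "bij_betw (\<lambda>a. \<lambda>D\<in>\<C>. pull ct n (subtopology X D) ?Y id a)
      (carrier (coh ct n ?Y)) (\<Pi>\<^sub>E D\<in>\<C>. carrier (coh ct n (subtopology X D)))"
  proof (rule bij_betw_cong[THEN iffD1, rotated])
    fix a assume a: "a \<in> carrier (coh ct n ?Y)"
    have "pull ct n (subtopology ?S U) ?S id (pull ct n ?S ?Y id a) = pull ct n (subtopology X U) ?Y id a"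
      if "U \<in> \<C>" for U
      unfolding subtopology_component_sum[OF C that, symmetric]
      by (rule pull_factor[symmetric, OF _ component_sum_coarsens[OF C] _ a])
        (simp_all add: continuous_map_from_subtopology)
    then show "((\<lambda>a. \<lambda>U\<in>\<C>. pull ct n (subtopology ?S U) ?S id a) \<circ> pull ct n ?S ?Y id) a
        = (\<lambda>D\<in>\<C>. pull ct n (subtopology X D) ?Y id a)"
      by (auto simp: fun_eq_iff)
  qed
qed

context cohomology_theory
begin

text \<open>
  A class can be changed to zero on the path components outside \<open>S\<close>; its restriction to \<open>S\<close> is
  unchanged because it is determined by the restrictions to the path components in \<open>S\<close>.
\<close>

lemma restriction_to_factor:
  assumes resp: "respects_path_components ct X" and S: "\<Union>{C \<in> path_components_of X. C \<subseteq> S} = S"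
    and b: "b \<in> carrier (coh ct n X)"
  obtains b' where "b' \<in> factor ct n X S" "pull ct n (subtopology X S) X id b' = pull ct n (subtopology X S) X id b"
proof -
  have cC: "continuous_map (subtopology X C) X id" for C
    by (simp add: continuous_map_from_subtopology)
  have "bij_betw (\<lambda>a. \<lambda>C\<in>path_components_of X. pull ct n (subtopology X C) X id a)
      (carrier (coh ct n X)) (\<Pi>\<^sub>E C\<in>path_components_of X. carrier (coh ct n (subtopology X C)))"
    using resp[unfolded respects_path_components_def, rule_format, OF order_refl, of n]
    by (simp add: Union_path_components_of)
  moreover have "(\<lambda>C\<in>path_components_of X. if C \<subseteq> S then pull ct n (subtopology X C) X id b
      else \<one>\<^bsub>coh ct n (subtopology X C)\<^esub>) \<in> (\<Pi>\<^sub>E C\<in>path_components_of X. carrier (coh ct n (subtopology X C)))"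
    using pull_closed[OF cC b] group[of "{}" "subtopology X _" n]
    by (auto simp: comm_group_def comm_monoid_def intro!: monoid.one_closed)
  ultimately obtain b' where b': "b' \<in> carrier (coh ct n X)"
      and eq: "(\<lambda>C\<in>path_components_of X. pull ct n (subtopology X C) X id b')
        = (\<lambda>C\<in>path_components_of X. if C \<subseteq> S then pull ct n (subtopology X C) X id b
            else \<one>\<^bsub>coh ct n (subtopology X C)\<^esub>)"
    unfolding bij_betw_def by (metis (no_types, lifting) imageE)
  have comp: "pull ct n (subtopology X C) X id b' = (if C \<subseteq> S then pull ct n (subtopology X C) X id b
      else \<one>\<^bsub>coh ct n (subtopology X C)\<^esub>)" if "C \<in> path_components_of X" for C
    using fun_cong[OF eq, of C] that by simp
  let ?D = "{C \<in> path_components_of X. C \<subseteq> S}" and ?r = "pull ct n (subtopology X S) X id"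
  have inj: "inj_on (\<lambda>a. \<lambda>C\<in>?D. pull ct n (subtopology X C) (subtopology X S) id a) (carrier (coh ct n (subtopology X S)))"
    using resp[unfolded respects_path_components_def, rule_format, of ?D n]
    unfolding S bij_betw_def by auto
  have factors: "pull ct n (subtopology X C) (subtopology X S) id (?r a) = pull ct n (subtopology X C) X id a"
    if "C \<in> ?D" "a \<in> carrier (coh ct n X)" for C a
    using that(1) by (intro pull_factor[symmetric, OF _ cC _ that(2)])
      (auto simp: continuous_map_in_subtopology continuous_map_from_subtopology)
  have "?r b' = ?r b"
  proof (rule inj_onD[OF inj])
    show "(\<lambda>C\<in>?D. pull ct n (subtopology X C) (subtopology X S) id (?r b'))
        = (\<lambda>C\<in>?D. pull ct n (subtopology X C) (subtopology X S) id (?r b))"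
    proof (rule restrict_ext)
      fix C assume C: "C \<in> ?D"
      show "pull ct n (subtopology X C) (subtopology X S) id (?r b')
          = pull ct n (subtopology X C) (subtopology X S) id (?r b)"
        using factors[OF C b'] factors[OF C b] comp C by simp
    qed
  qed (use pull_closed[OF cC] b b' in auto)
  moreover have "b' \<in> factor ct n X S"
    using b' comp by (simp add: factor_def)
  ultimately show thesis
    using that by blast
qed

end

context multiplicative_cohomology_theory
begin

lemma factor_cup_left:
  assumes a: "a \<in> factor ct k X S" and x: "x \<in> carrier (coh ct l X)"
  shows "cup ct k l X a x \<in> factor ct (k + l) X S"
proof -
  have aX: "a \<in> carrier (coh ct k X)" using a by (simp add: factor_def)
  have "pull ct (k + l) (subtopology X C) X id (cup ct k l X a x) = \<one>\<^bsub>coh ct (k + l) (subtopology X C)\<^esub>"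
    if C: "C \<in> path_components_of X" "\<not> C \<subseteq> S" for C
  proof -
    have c: "continuous_map (subtopology X C) X id" by (simp add: continuous_map_from_subtopology)
    show ?thesis
      using pull_cup[OF c aX x] cup_zero_left[OF pull_closed[OF c x]] a C by (simp add: factor_def)
  qed
  then show ?thesis
    using cup_in_carrier[OF aX x] by (simp add: factor_def)
qed

lemma factor_cup_right:
  assumes a: "a \<in> factor ct l X S" and x: "x \<in> carrier (coh ct k X)"
  shows "cup ct k l X x a \<in> factor ct (k + l) X S"
proof -
  have aX: "a \<in> carrier (coh ct l X)" using a by (simp add: factor_def)
  have "pull ct (k + l) (subtopology X C) X id (cup ct k l X x a) = \<one>\<^bsub>coh ct (k + l) (subtopology X C)\<^esub>"
    if C: "C \<in> path_components_of X" "\<not> C \<subseteq> S" for C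
  proof -
    have c: "continuous_map (subtopology X C) X id" by (simp add: continuous_map_from_subtopology)
    show ?thesis
      using pull_cup[OF c x aX] cup_zero_right[OF pull_closed[OF c x]] a C by (simp add: factor_def)
  qed
  then show ?thesis
    using cup_in_carrier[OF x aX] by (simp add: factor_def)
qed

end

section \<open>Consequences of the two formulas\<close>

context coproduct_data
begin

abbreviation GG where "GG \<equiv> hfp G g E g G"
abbreviation restrict_const where "restrict_const k \<equiv> pull ct k G GG (const_arc g)"

lemma restrict_const_closed: "a \<in> carrier (coh ct k GG) \<Longrightarrow> restrict_const k a \<in> carrier (coh ct k G)"
  by (rule pull_closed[OF constant_section])

lemma restrict_const_pull:
  assumes x: "x \<in> carrier (coh ct k G)"
  shows "restrict_const k (pull ct k GG G start x) = x" "restrict_const k (pull ct k GG G finish x) = x"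
proof -
  have "restrict_const k (pull ct k GG G start x) = pull ct k G G (\<lambda>z. z) x"
    by (rule pull_factor[symmetric, OF constant_section start_continuous _ x]) (simp add: const_arc_def)
  then show "restrict_const k (pull ct k GG G start x) = x"
    using pull_identity[OF _ x] by simp
  have "restrict_const k (pull ct k GG G finish x) = pull ct k G G (\<lambda>z. z) x"
    by (rule pull_factor[symmetric, OF constant_section finish_continuous _ x]) (simp add: const_arc_def)
  then show "restrict_const k (pull ct k GG G finish x) = x"
    using pull_identity[OF _ x] by simp
qed

text \<open>
  The two formulas for the coproduct of \<open>a\<close> and \<open>1\<close> are compared: one returns \<open>a\<close> itself times the Euler
  class, the other only depends on the restriction of \<open>a\<close> to the constant arcs.
\<close>

lemma cup_euler_start:
  assumes a: "a \<in> carrier (coh ct k GG)"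
  shows "cup ct k deg GG a (pull ct deg GG G start euler) = pull ct (k + deg) GG G start (cup ct k deg G (restrict_const k a) euler)"
proof -
  let ?s = "pull ct k GG G start (restrict_const k a)"
  have s: "?s \<in> carrier (coh ct k GG)"
    by (rule pull_closed[OF start_continuous restrict_const_closed[OF a]])
  have "cup ct k deg GG a (pull ct deg GG G start euler) = lcp ct \<Phi> p G g E g G g G k 0 a (One ct GG)"
    unfolding lcp_right[OF a one_closed] one_natural[OF constant_section]
    using one_cup[of "{}" G euler deg] euler_pullback_in_carrier by (simp add: euler_start_eq_finish)
  also have "\<dots> = cup ct k deg GG ?s (pull ct deg GG G start euler)"
    unfolding lcp_left[OF a one_closed] using cup_one[of "{}" GG ?s k] s by simp
  also have "\<dots> = pull ct (k + deg) GG G start (cup ct k deg G (restrict_const k a) euler)"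
    by (rule pull_cup[symmetric, OF start_continuous restrict_const_closed[OF a] euler_pullback_in_carrier])
  finally show ?thesis .
qed

lemma cup_euler_finish:
  assumes a: "a \<in> carrier (coh ct k GG)"
  shows "cup ct k deg GG a (pull ct deg GG G start euler) = pull ct (k + deg) GG G finish (cup ct k deg G (restrict_const k a) euler)"
proof -
  let ?f = "pull ct k GG G finish (restrict_const k a)"
  have f: "?f \<in> carrier (coh ct k GG)"
    by (rule pull_closed[OF finish_continuous restrict_const_closed[OF a]])
  have "cup ct k deg GG a (pull ct deg GG G start euler) = cup ct k deg GG ?f (pull ct deg GG G start euler)"
    unfolding cup_euler_start[OF a] cup_euler_start[OF f] restrict_const_pull(2)[OF restrict_const_closed[OF a]] ..
  also have "\<dots> = pull ct (k + deg) GG G finish (cup ct k deg G (restrict_const k a) euler)"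
    unfolding euler_start_eq_finish
    by (rule pull_cup[symmetric, OF finish_continuous restrict_const_closed[OF a] euler_pullback_in_carrier])
  finally show ?thesis .
qed

lemma lcp_both:
  assumes a: "a \<in> carrier (coh ct k GG)" and b: "b \<in> carrier (coh ct l GG)"
  shows "lcp ct \<Phi> p G g E g G g G k l a b = pull ct (k + l + deg) GG G start
      (cup ct (k + l) deg G (cup ct k l G (restrict_const k a) (restrict_const l b)) euler)"
    and "lcp ct \<Phi> p G g E g G g G k l a b = pull ct (k + l + deg) GG G finish
      (cup ct (k + l) deg G (cup ct k l G (restrict_const k a) (restrict_const l b)) euler)"
proof -
  let ?s = "pull ct k GG G start (restrict_const k a)"
  have s: "?s \<in> carrier (coh ct k GG)"
    by (rule pull_closed[OF start_continuous restrict_const_closed[OF a]])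
  have sb: "cup ct k l GG ?s b \<in> carrier (coh ct (k + l) GG)"
    by (rule cup_in_carrier[OF s b])
  have "restrict_const (k + l) (cup ct k l GG ?s b) = cup ct k l G (restrict_const k a) (restrict_const l b)"
    using pull_cup[OF constant_section s b] restrict_const_pull(1)[OF restrict_const_closed[OF a]] by simp
  then show "lcp ct \<Phi> p G g E g G g G k l a b = pull ct (k + l + deg) GG G start
      (cup ct (k + l) deg G (cup ct k l G (restrict_const k a) (restrict_const l b)) euler)"
    "lcp ct \<Phi> p G g E g G g G k l a b = pull ct (k + l + deg) GG G finish
      (cup ct (k + l) deg G (cup ct k l G (restrict_const k a) (restrict_const l b)) euler)"
    using cup_euler_start[OF sb] cup_euler_finish[OF sb] by (simp_all add: lcp_left[OF a b])
qed

lemma kernel_graded_ideal: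
  "graded_ideal ct GG (\<lambda>k. kernel (coh ct k GG) (coh ct k G) (restrict_const k))"
  unfolding graded_ideal_def
proof (intro conjI allI ballI)
  fix k
  interpret group_hom "coh ct k GG" "coh ct k G" "restrict_const k"
    by (rule ind_group_hom) (use constant_section in simp)
  show "subgroup (kernel (coh ct k GG) (coh ct k G) (restrict_const k)) (coh ct k GG)"
    by (rule subgroup_kernel)
next
  fix k l a b assume a: "a \<in> kernel (coh ct k GG) (coh ct k G) (restrict_const k)" and b: "b \<in> carrier (coh ct l GG)"
  then have a': "a \<in> carrier (coh ct k GG)" "restrict_const k a = \<one>\<^bsub>coh ct k G\<^esub>"
    by (auto simp: kernel_def)
  show "cup ct k l GG a b \<in> kernel (coh ct (k + l) GG) (coh ct (k + l) G) (restrict_const (k + l))"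
    using cup_in_carrier[OF a'(1) b] pull_cup[OF constant_section a'(1) b] a'(2)
      cup_zero_left[OF restrict_const_closed[OF b]] by (simp add: kernel_def)
  show "cup ct l k GG b a \<in> kernel (coh ct (l + k) GG) (coh ct (l + k) G) (restrict_const (l + k))"
    using cup_in_carrier[OF b a'(1)] pull_cup[OF constant_section b a'(1)] a'(2)
      cup_zero_right[OF restrict_const_closed[OF b]] by (simp add: kernel_def)
qed

lemma kernel_cup_euler:
  "(\<lambda>a. cup ct k deg GG a (pull ct deg GG G start euler)) ` kernel (coh ct k GG) (coh ct k G) (restrict_const k)
    = {\<one>\<^bsub>coh ct (k + deg) GG\<^esub>}"
proof -
  have zero: "cup ct k deg GG a (pull ct deg GG G start euler) = \<one>\<^bsub>coh ct (k + deg) GG\<^esub>"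
    if "a \<in> kernel (coh ct k GG) (coh ct k G) (restrict_const k)" for a
    using that cup_euler_start[of a k] cup_zero_left[OF euler_pullback_in_carrier] pull_one[OF start_continuous]
    by (simp add: kernel_def)
  have "\<one>\<^bsub>coh ct k GG\<^esub> \<in> kernel (coh ct k GG) (coh ct k G) (restrict_const k)"
    using kernel_graded_ideal by (auto simp: graded_ideal_def dest: subgroup.one_closed)
  then have "kernel (coh ct k GG) (coh ct k G) (restrict_const k) \<noteq> {}" by blast
  then show ?thesis
    by (simp add: zero image_constant_conv cong: image_cong)
qed

lemma const_arc_in_constant_part: "b \<in> topspace G \<Longrightarrow> const_arc g b \<in> constant_part G g E"
proof -
  assume b: "b \<in> topspace G"
  then have "const_arc g b \<in> topspace GG"
    using continuous_map_image_subset_topspace[OF constant_section] by blast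
  then have "path_component_of GG (const_arc g b) (const_arc g b)"
    by (simp add: path_component_of_refl)
  with b show ?thesis
    unfolding constant_part_def by blast
qed

lemma constant_part_components:
  "\<Union>{C \<in> path_components_of GG. C \<subseteq> constant_part G g E} = constant_part G g E"
proof
  show "constant_part G g E \<subseteq> \<Union>{C \<in> path_components_of GG. C \<subseteq> constant_part G g E}"
  proof
    fix z assume "z \<in> constant_part G g E"
    then obtain b where b: "b \<in> topspace G" "path_component_of GG (const_arc g b) z"
      by (auto simp: constant_part_def)
    then have "const_arc g b \<in> topspace GG"
      using continuous_map_image_subset_topspace[OF constant_section] by blast
    then have "Collect (path_component_of GG (const_arc g b)) \<in> path_components_of GG"
      by (simp add: path_component_in_path_components_of)
    moreover have "Collect (path_component_of GG (const_arc g b)) \<subseteq> constant_part G g E"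
      using b(1) by (auto simp: constant_part_def)
    ultimately show "z \<in> \<Union>{C \<in> path_components_of GG. C \<subseteq> constant_part G g E}"
      using b(2) by blast
  qed
qed blast

lemma restrict_const_via_constant_part:
  assumes b: "b \<in> carrier (coh ct l GG)"
  shows "restrict_const l b = pull ct l G (subtopology GG (constant_part G g E)) (const_arc g)
    (pull ct l (subtopology GG (constant_part G g E)) GG id b)"
  using const_arc_in_constant_part constant_section
  by (intro pull_factor[OF _ _ _ b]) (auto simp: continuous_map_in_subtopology continuous_map_from_subtopology)

lemma restrict_const_zero:
  assumes "b \<in> carrier (coh ct l GG)" "zero_component ct l GG (constant_part G g E) b"
  shows "restrict_const l b = \<one>\<^bsub>coh ct l G\<^esub>"
proof -
  have "continuous_map G (subtopology GG (constant_part G g E)) (const_arc g)"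
    using const_arc_in_constant_part constant_section by (auto simp: continuous_map_in_subtopology)
  then show ?thesis
    using restrict_const_via_constant_part[OF assms(1)] assms(2) pull_one by (simp add: zero_component_def)
qed

lemma lcp_right_zero:
  assumes a: "a \<in> carrier (coh ct k (hfp F f E g G))" and b: "b \<in> carrier (coh ct l GG)"
    and zero: "restrict_const l b = \<one>\<^bsub>coh ct l G\<^esub>"
  shows "lcp ct \<Phi> p F f E g G g G k l a b = \<one>\<^bsub>coh ct (k + l + deg) (hfp F f E g G)\<^esub>"
  using cup_zero_left[OF euler_pullback_in_carrier] pull_one[OF finish_continuous] cup_zero_right[OF a]
  by (simp add: lcp_right[OF a b] zero add.assoc)

lemma lcp_left_zero:
  assumes b: "b \<in> carrier (coh ct k GG)" and c: "c \<in> carrier (coh ct l (hfp G g E h H))"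
    and zero: "restrict_const k b = \<one>\<^bsub>coh ct k G\<^esub>"
  shows "lcp ct \<Phi> p G g E g G h H k l b c = \<one>\<^bsub>coh ct (k + l + deg) (hfp G g E h H)\<^esub>"
  using cup_zero_left[OF c] pull_one[OF start_continuous]
    cup_zero_left[OF pull_closed[OF start_continuous euler_pullback_in_carrier]]
  by (simp add: lcp_left[OF b c] zero)

lemma lcp_right_factor:
  assumes a: "a \<in> factor ct k (hfp F f E g G) S" and b: "b \<in> carrier (coh ct l GG)"
  shows "lcp ct \<Phi> p F f E g G g G k l a b \<in> factor ct (k + l + deg) (hfp F f E g G) S"
proof -
  have a': "a \<in> carrier (coh ct k (hfp F f E g G))" using a by (simp add: factor_def)
  show ?thesis
    unfolding lcp_right[OF a' b] add.assoc
    by (intro factor_cup_left[OF a] pull_closed[OF finish_continuous] cup_in_carrier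
        restrict_const_closed[OF b] euler_pullback_in_carrier)
qed

lemma lcp_left_factor:
  assumes b: "b \<in> carrier (coh ct k GG)" and c: "c \<in> factor ct l (hfp G g E h H) S"
  shows "lcp ct \<Phi> p G g E g G h H k l b c \<in> factor ct (k + l + deg) (hfp G g E h H) S"
proof -
  have c': "c \<in> carrier (coh ct l (hfp G g E h H))" using c by (simp add: factor_def)
  show ?thesis
    unfolding lcp_left[OF b c']
    by (intro factor_cup_left factor_cup_right[OF c] pull_closed[OF start_continuous]
        restrict_const_closed[OF b] euler_pullback_in_carrier)
qed

text \<open>
  By the formula \<open>lcp_right\<close> the coproduct depends on \<open>b\<close> through its restriction to the constant arcs, so
  \<open>b\<close> may be replaced by a class that vanishes outside of their components. Then \<open>lcp_left\<close> exhibits the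
  coproduct as a product with that class.
\<close>

lemma lcp_both_factor:
  assumes resp: "respects_path_components ct GG"
    and a: "a \<in> carrier (coh ct k GG)" and b: "b \<in> carrier (coh ct l GG)"
  shows "lcp ct \<Phi> p G g E g G g G k l a b \<in> factor ct (k + l + deg) GG (constant_part G g E)"
proof -
  obtain b' where b': "b' \<in> factor ct l GG (constant_part G g E)"
      "pull ct l (subtopology GG (constant_part G g E)) GG id b'
        = pull ct l (subtopology GG (constant_part G g E)) GG id b"
    using restriction_to_factor[OF resp constant_part_components b] .
  then have c': "b' \<in> carrier (coh ct l GG)" by (simp add: factor_def)
  have "restrict_const l b' = restrict_const l b"
    using restrict_const_via_constant_part[OF c'] restrict_const_via_constant_part[OF b] b'(2) by simp
  then have "lcp ct \<Phi> p G g E g G g G k l a b = lcp ct \<Phi> p G g E g G g G k l a b'"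
    by (simp add: lcp_right[OF a b] lcp_right[OF a c'])
  then show ?thesis
    using lcp_left_factor[OF a b'(1)] by simp
qed

lemma lcp_both_degree:
  assumes zero: "carrier (coh ct (k + l + deg) G) = {\<one>\<^bsub>coh ct (k + l + deg) G\<^esub>}"
    and a: "a \<in> carrier (coh ct k GG)" and b: "b \<in> carrier (coh ct l GG)"
  shows "lcp ct \<Phi> p G g E g G g G k l a b = \<one>\<^bsub>coh ct (k + l + deg) GG\<^esub>"
proof -
  have "cup ct (k + l) deg G (cup ct k l G (restrict_const k a) (restrict_const l b)) euler
      \<in> carrier (coh ct (k + l + deg) G)"
    by (intro cup_in_carrier restrict_const_closed a b euler_pullback_in_carrier)
  then show ?thesis
    using lcp_both(1)[OF a b] pull_one[OF start_continuous] zero by simp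
qed

end

theorem theorem15:
  fixes ct :: "('x point, 'k) cohomology"
    and \<Phi> :: "('x point, 'v, 'k) embedding_data"
    and F G H E M B FG GG GH :: "'x point topology"
    and f g h p q ev0 ev1 \<sigma> :: "'x point \<Rightarrow> 'x point"
    and GG0 :: "'x point set"
    and m :: int and e :: 'k
  assumes ct: "additive_multiplicative_cohomology_theory ct"
    and f: "continuous_map F E f" and g: "continuous_map G E g" and h: "continuous_map H E h"
    and emb: "oriented_proper_embedding ct \<Phi>"
    and M: "M = source \<Phi>" and B: "B = target \<Phi>" and m: "m = int (codim \<Phi>)"
    and fib: "Hurewicz_fibration E B p \<or> (Serre_fibration E B p \<and> weakly_invariant ct)"
    and square: "pullback_square G g E q M p (emap \<Phi>)"
    and e: "e = Euler_class ct \<Phi>"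
    and FG: "FG = hfp F f E g G" and GG: "GG = hfp G g E g G" and GH: "GH = hfp G g E h H"
    and ev0: "ev0 = start" and ev1: "ev1 = finish" and \<sigma>: "\<sigma> = const_arc g"
    and GG0: "GG0 = constant_part G g E"
  shows
    \<comment> \<open>1)\<close>
    "(\<forall>k l. \<forall>a\<in>carrier (coh ct k FG). \<forall>b\<in>carrier (coh ct l GG).
        lcp ct \<Phi> p F f E g G g G k l a b
          = cup ct k (l + m) FG a
              (pull ct (l + m) FG G ev1
                (cup ct l m G (pull ct l G GG \<sigma> b) (pull ct m G M q e)))) \<and>
    \<comment> \<open>2)\<close>
     (\<forall>k l. \<forall>b\<in>carrier (coh ct k GG). \<forall>c\<in>carrier (coh ct l GH).
        lcp ct \<Phi> p G g E g G h H k l b c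
          = cup ct (k + l) m GH
              (cup ct k l GH (pull ct k GH G ev0 (pull ct k G GG \<sigma> b)) c)
              (pull ct m GH G ev0 (pull ct m G M q e))) \<and>
    \<comment> \<open>3)\<close>
     pull ct m GG G ev0 (pull ct m G M q e) = pull ct m GG G ev1 (pull ct m G M q e) \<and>
    \<comment> \<open>4)\<close>
     (graded_ideal ct GG (\<lambda>k. kernel (coh ct k GG) (coh ct k G) (pull ct k G GG \<sigma>)) \<and>
      (\<forall>k. (\<lambda>a. cup ct k m GG a (pull ct m GG G ev0 (pull ct m G M q e)))
              ` kernel (coh ct k GG) (coh ct k G) (pull ct k G GG \<sigma>)
            = {\<one>\<^bsub>coh ct (k + m) GG\<^esub>})) \<and>
    \<comment> \<open>5)\<close>
     (\<forall>k l. \<forall>a\<in>carrier (coh ct k GG). \<forall>b\<in>carrier (coh ct l GG).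
        lcp ct \<Phi> p G g E g G g G k l a b
          = pull ct (k + l + m) GG G ev0
              (cup ct (k + l) m G
                (cup ct k l G (pull ct k G GG \<sigma> a) (pull ct l G GG \<sigma> b)) (pull ct m G M q e)) \<and>
        lcp ct \<Phi> p G g E g G g G k l a b
          = pull ct (k + l + m) GG G ev1
              (cup ct (k + l) m G
                (cup ct k l G (pull ct k G GG \<sigma> a) (pull ct l G GG \<sigma> b)) (pull ct m G M q e))) \<and>
    \<comment> \<open>6) and 7)\<close>
     (weakly_invariant ct \<or> (\<forall>X\<in>{FG, GG, GH}. respects_path_components ct X) \<longrightarrow>
        (\<forall>k l. \<forall>a\<in>carrier (coh ct k FG). \<forall>b\<in>carrier (coh ct l GG).
           zero_component ct l GG GG0 b \<longrightarrow>
           lcp ct \<Phi> p F f E g G g G k l a b = \<one>\<^bsub>coh ct (k + l + m) FG\<^esub>) \<and>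
        (\<forall>k l. \<forall>b\<in>carrier (coh ct k GG). \<forall>c\<in>carrier (coh ct l GH).
           zero_component ct k GG GG0 b \<longrightarrow>
           lcp ct \<Phi> p G g E g G h H k l b c = \<one>\<^bsub>coh ct (k + l + m) GH\<^esub>) \<and>
        (\<forall>k l. \<forall>a\<in>carrier (coh ct k GG). \<forall>b\<in>carrier (coh ct l GG).
           zero_component ct k GG GG0 a \<or> zero_component ct l GG GG0 b \<longrightarrow>
           lcp ct \<Phi> p G g E g G g G k l a b = \<one>\<^bsub>coh ct (k + l + m) GG\<^esub>) \<and>
        (\<forall>\<alpha>\<in>topspace FG. \<forall>k l.
           \<forall>a\<in>factor ct k FG (Collect (path_component_of FG \<alpha>)). \<forall>b\<in>carrier (coh ct l GG).
             lcp ct \<Phi> p F f E g G g G k l a b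
               \<in> factor ct (k + l + m) FG (Collect (path_component_of FG \<alpha>))) \<and>
        (\<forall>\<alpha>\<in>topspace GH. \<forall>k l.
           \<forall>b\<in>carrier (coh ct k GG). \<forall>c\<in>factor ct l GH (Collect (path_component_of GH \<alpha>)).
             lcp ct \<Phi> p G g E g G h H k l b c
               \<in> factor ct (k + l + m) GH (Collect (path_component_of GH \<alpha>))) \<and>
        (\<forall>k l. \<forall>a\<in>carrier (coh ct k GG). \<forall>b\<in>carrier (coh ct l GG).
           lcp ct \<Phi> p G g E g G g G k l a b \<in> factor ct (k + l + m) GG GG0)) \<and>
    \<comment> \<open>8)\<close>
     (\<forall>d :: int. (\<forall>i>d. carrier (coh ct i G) = {\<one>\<^bsub>coh ct i G\<^esub>}) \<longrightarrow>
        (\<forall>k l. k + l > d - m \<longrightarrow>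
           (\<forall>a\<in>carrier (coh ct k GG). \<forall>b\<in>carrier (coh ct l GG).
              lcp ct \<Phi> p G g E g G g G k l a b = \<one>\<^bsub>coh ct (k + l + m) GG\<^esub>)))"
proof -
  interpret additive_multiplicative_cohomology_theory ct by (rule ct)
  interpret coproduct_data ct \<Phi> E p G g q
    using emb fib[unfolded B] g square[unfolded M] by unfold_locales
  note defs = M m e FG GG GH ev0 ev1 \<sigma> GG0
  have resp: "respects_path_components ct (hfp G g E g G)"
    if "weakly_invariant ct \<or> (\<forall>X\<in>{FG, GG, GH}. respects_path_components ct X)"
    using that weakly_invariant_imp_respects_path_components unfolding defs by blast
  show ?thesis
    unfolding defs
    apply (intro conjI allI ballI impI)
    subgoal by (rule lcp_right)
    subgoal by (rule lcp_left)
    subgoal by (rule euler_start_eq_finish)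
    subgoal by (rule kernel_graded_ideal)
    subgoal by (rule kernel_cup_euler)
    subgoal by (rule lcp_both(1))
    subgoal by (rule lcp_both(2))
    subgoal by (rule lcp_right_zero) (auto intro: restrict_const_zero)
    subgoal by (rule lcp_left_zero) (auto intro: restrict_const_zero)
    subgoal by (elim disjE) (auto intro: lcp_left_zero lcp_right_zero restrict_const_zero)
    subgoal by (rule lcp_right_factor)
    subgoal by (rule lcp_left_factor)
    subgoal by (rule lcp_both_factor) (use resp in \<open>auto simp: defs\<close>)
    subgoal by (rule lcp_both_degree) simp_all
    done
qed

end
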